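(* Every exceptional orthogonal polynomial system can be obtained by applying a finite sequence of Darboux transformations to a classical orthogonal polynomial system. Precisely: let $\{y_k\}_{k\in\mathbb N\setminus\{k_1,\ldots,k_m\}}$ be a Sturm-Liouville orthogonal polynomial system (SL-OPS) with associated operator $T$. Then, after a suitable real affine change of the independent variable, there exist a classical operator $T_{\mathrm{cl}}$ and constants $a\neq 0$, $c$ such that $a\,T_{\mathrm{cl}}+c$ and $T$ are connected by a factorization chain.
   Context: $\mathcal P=\mathbb C[z]$, $\mathcal Q=\mathbb C(z)$; $\mathbb R\mathcal P$, $\mathbb R\mathcal Q$ are the corresponding real polynomials and real rational functions; $\mathbb R\mathcal P_k^*$ is the set of real polynomials of degree exactly $k$. $\mathbb N=\{0,1,2,\ldots\}$. $\mathrm{Diff}_\rho(\mathcal Q)$ (resp. $\mathrm{Diff}_\rho(\mathbb R\mathcal Q)$) is the set of linear differential operators of order exactly $\rho$ with coefficients in $\mathcal Q$ (resp. $\mathbb R\mathcal Q$). For $T=p(z)D_{zz}+q(z)D_z+r(z)$ of order two the associated weight is $W(z)=\frac{1}{p(z)}\exp\left(\int^z \frac{q(x)}{p(x)}dx\right)$, defined up to a nonzero multiplicative constant. SL-OPS: a real polynomial sequence $y_k\in\mathbb R\mathcal P_k^*$, $k\in\mathbb N\setminus\{k_1,\ldots,k_m\}$ (finitely many missing degrees; $m=0$ allowed), is a Sturm-Liouville orthogonal polynomial system with associated operator $T$ if: (i) the $y_k$ are the eigenpolynomials of the operator $T\in\mathrm{Diff}_2(\mathbb R\mathcal Q)$ (so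 $T[y_k]=\lambda_k y_k$ for each such $k$, and $T$ has no eigenpolynomial of degree $k_1,\ldots,k_m$); (ii) there is an open interval $I\subset\mathbb R$ such that (ii-a) the associated weight $W$ is positive, single-valued and integrable on $I$; (ii-b) all moments $\int_I z^jW(z)\,dz$, $j\in\mathbb N$, are finite; (ii-c) $y(z)p(z)W(z)\to0$ at the endpoints of $I$ for every polynomial $y$; (iii) $\mathrm{span}\{y_k\}$ is dense in $L^2(I,W(z)dz)$. These systems are what is meant by exceptional orthogonal polynomial systems. Classical operators: the Hermite operator $D_{zz}-2zD_z$; the Laguerre operators $zD_{zz}+(1+\alpha-z)D_z$ with $\alpha>-1$; the Jacobi operators $(1-z^2)D_{zz}+(\beta-\alpha-(2+\alpha+\beta)z)D_z$ with $\alpha,\beta>-1$. Their eigenpolynomials form the classical orthogonal polynomial systems. Rational Darboux transformation: if $T=BA+\lambda_0$ with $A,B\in\mathrm{Diff}_1(\mathcal Q)$, $\lambda_0\in\mathbb C$, then $T\mapsto AB+\lambda_0$ is a rational Darboux transformation. Two operators $T,\hat T\in\mathrm{Diff}_2(\mathcal Q)$ are connected by a factorization chain if there are $n\in\mathbb N$, operators $T_0=T,T_1,\ldots,T_n=\hat T$ in $\mathrm{Diff}_2(\mathcal Q)$, operators $A_i,B_i\in\mathrm{Diff}_1(\mathcal Q)$ and constants $\lambda_i\in\mathbb C$ ($0\le i\le n-1$) with $T_i=B_iA_i+\lambda_i$ and $T_{i+1}=A_iB_i+\lambda_i$. *)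

theory Defs
  imports
    "HOL-Analysis.Analysis"
    "HOL-Computational_Algebra.Computational_Algebra"
    "HOL-Computational_Algebra.Field_as_Ring"
begin

text \<open>The field of rational functions over \<open>'a\<close> is \<open>'a poly fract\<close>.\<close>

abbreviation constf :: "'a::field \<Rightarrow> 'a poly fract" where
  "constf c \<equiv> to_fract [:c:]"

text \<open>The library's \<open>quot_of_fract\<close> returns the reduced fraction. The operations below do not
  depend on that choice of representative, except for the values at poles.\<close>

abbreviation num :: "'a::field_gcd poly fract \<Rightarrow> 'a poly" where
  "num f \<equiv> fst (quot_of_fract f)"

abbreviation den :: "'a::field_gcd poly fract \<Rightarrow> 'a poly" where
  "den f \<equiv> snd (quot_of_fract f)"

definition fract_deriv :: "'a::field_gcd poly fract \<Rightarrow> 'a poly fract" where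
  "fract_deriv f = Fraction_Field.Fract
     (pderiv (num f) * den f - num f * pderiv (den f)) (den f * den f)"

definition complexify :: "real poly fract \<Rightarrow> complex poly fract" where
  "complexify f = Fraction_Field.Fract
     (map_poly complex_of_real (num f)) (map_poly complex_of_real (den f))"

text \<open>\<open>f(z) \<mapsto> f(s z + t)\<close>, meaningful for \<open>s \<noteq> 0\<close>.\<close>

definition affine_subst :: "'a::field_gcd \<Rightarrow> 'a \<Rightarrow> 'a poly fract \<Rightarrow> 'a poly fract" where
  "affine_subst s t f = Fraction_Field.Fract
     (pcompose (num f) [:t, s:]) (pcompose (den f) [:t, s:])"

text \<open>At a pole \<open>fract_eval\<close> has the dummy value 0.\<close>

definition poles :: "'a::field_gcd poly fract \<Rightarrow> 'a set" where
  "poles f = {x. poly (den f) x = 0}"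

definition fract_eval :: "'a::field_gcd poly fract \<Rightarrow> 'a \<Rightarrow> 'a" where
  "fract_eval f x = poly (num f) x / poly (den f) x"


section \<open>Differential operators\<close>

text \<open>Operators are identified with the linear maps they induce on rational functions. In
  characteristic 0 an operator is determined by that map, and the product of operators is
  composition.\<close>

type_synonym 'a diffop = "'a poly fract \<Rightarrow> 'a poly fract"

definition Diff :: "nat \<Rightarrow> 'a::{field_char_0,field_gcd} diffop set" where
  "Diff \<rho> = {T. \<exists>c. c \<rho> \<noteq> 0 \<and> T = (\<lambda>f. \<Sum>i\<le>\<rho>. c i * (fract_deriv ^^ i) f)}"

definition diffop2 ::
  "'a::{field_char_0,field_gcd} poly fract \<Rightarrow> 'a poly fract \<Rightarrow> 'a poly fract \<Rightarrow> 'a diffop" where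
  "diffop2 p q r = (\<lambda>f. p * fract_deriv (fract_deriv f) + q * fract_deriv f + r * f)"

text \<open>The operator \<open>T\<close> written in the variable \<open>x\<close>, where \<open>z = (x - t) / s\<close>; that is,
  \<open>T\<close> conjugated by the substitution \<open>x = s z + t\<close>.\<close>

definition affine_change :: "'a::{field_char_0,field_gcd} \<Rightarrow> 'a \<Rightarrow> 'a diffop \<Rightarrow> 'a diffop" where
  "affine_change s t T = (\<lambda>f. affine_subst (1 / s) (- t / s) (T (affine_subst s t f)))"

definition rational_darboux :: "complex diffop \<Rightarrow> complex diffop \<Rightarrow> bool" where
  "rational_darboux T T' \<longleftrightarrow> (\<exists>A\<in>Diff 1. \<exists>B\<in>Diff 1. \<exists>l.
     T = (\<lambda>f. B (A f) + constf l * f) \<and> T' = (\<lambda>f. A (B f) + constf l * f))"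

definition factorization_chain :: "complex diffop \<Rightarrow> complex diffop \<Rightarrow> bool" where
  "factorization_chain T T' \<longleftrightarrow> (\<exists>n Ts. Ts 0 = T \<and> Ts n = T' \<and>
     (\<forall>i\<le>n. Ts i \<in> Diff 2) \<and> (\<forall>i<n. rational_darboux (Ts i) (Ts (Suc i))))"

definition hermite_op :: "complex diffop" where
  "hermite_op = diffop2 1 (to_fract [:0, -2:]) 0"

definition laguerre_op :: "real \<Rightarrow> complex diffop" where
  "laguerre_op \<alpha> = diffop2 (to_fract [:0, 1:]) (to_fract [:complex_of_real (1 + \<alpha>), -1:]) 0"

definition jacobi_op :: "real \<Rightarrow> real \<Rightarrow> complex diffop" where
  "jacobi_op \<alpha> \<beta> = diffop2 (to_fract [:1, 0, -1:])
     (to_fract [:complex_of_real (\<beta> - \<alpha>), - complex_of_real (2 + \<alpha> + \<beta>):]) 0"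

definition classical_op :: "complex diffop \<Rightarrow> bool" where
  "classical_op T \<longleftrightarrow> T = hermite_op \<or> (\<exists>\<alpha>>-1. T = laguerre_op \<alpha>) \<or>
     (\<exists>\<alpha>>-1. \<exists>\<beta>>-1. T = jacobi_op \<alpha> \<beta>)"


section \<open>Sturm-Liouville orthogonal polynomial systems\<close>

definition eigenpolynomial :: "real diffop \<Rightarrow> real poly \<Rightarrow> bool" where
  "eigenpolynomial T y \<longleftrightarrow> y \<noteq> 0 \<and> (\<exists>l. T (to_fract y) = constf l * to_fract y)"

text \<open>\<open>W\<close> is a positive, single-valued determination on the open interval \<open>(a, b)\<close> of
  \<open>exp (\<integral> q / p) / p\<close>. The interval may contain points where \<open>q / p\<close> or \<open>1 / p\<close> has a pole
  but where the singularity of the product is removable (as for \<open>p = 1 - z\<^sup>2\<close>, \<open>q = - 2 z\<close>, where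
  \<open>W\<close> is constant). The formula is therefore imposed on the pole-free subintervals;
  continuity and positivity of \<open>W\<close> on all of \<open>(a, b)\<close> force the analytic continuation
  across the remaining, isolated, points.\<close>

definition sl_weight ::
  "real poly fract \<Rightarrow> real poly fract \<Rightarrow> ereal \<Rightarrow> ereal \<Rightarrow> (real \<Rightarrow> real) \<Rightarrow> bool" where
  "sl_weight p q a b W \<longleftrightarrow>
     continuous_on (einterval a b) W \<and> (\<forall>x\<in>einterval a b. W x > 0) \<and>
     (\<forall>c d. a \<le> c \<and> d \<le> b \<and> einterval c d \<inter> (poles (q / p) \<union> poles (1 / p)) = {} \<longrightarrow>
        (\<exists>C F. C \<noteq> 0 \<and> (\<forall>x\<in>einterval c d.
           (F has_real_derivative fract_eval (q / p) x) (at x) \<and>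
           W x = C * (fract_eval (1 / p) x * exp (F x)))))"

definition weighted_measure :: "ereal \<Rightarrow> ereal \<Rightarrow> (real \<Rightarrow> real) \<Rightarrow> real measure" where
  "weighted_measure a b W = density lborel (\<lambda>x. ennreal (indicator (einterval a b) x * W x))"

definition dense_in_L2 :: "real measure \<Rightarrow> real poly set \<Rightarrow> bool" where
  "dense_in_L2 M U \<longleftrightarrow>
     (\<forall>f\<in>borel_measurable M. integrable M (\<lambda>x. (f x)\<^sup>2) \<longrightarrow>
        (\<forall>\<epsilon>>0. \<exists>u\<in>U. sqrt (LINT x|M. (f x - poly u x)\<^sup>2) < \<epsilon>))"

text \<open>\<open>K\<close> is the set of missing degrees, and \<open>T = p D\<^sub>z\<^sub>z + q D\<^sub>z + r\<close>. The values of \<open>y\<close> on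
  \<open>K\<close> are irrelevant.\<close>

definition sl_ops ::
  "real poly fract \<Rightarrow> real poly fract \<Rightarrow> real poly fract \<Rightarrow> nat set \<Rightarrow> (nat \<Rightarrow> real poly) \<Rightarrow> bool"
where
  "sl_ops p q r K y \<longleftrightarrow>
     p \<noteq> 0 \<and> finite K \<and>
     (\<forall>k. k \<notin> K \<longrightarrow> degree (y k) = k \<and> eigenpolynomial (diffop2 p q r) (y k)) \<and>
     (\<forall>u. eigenpolynomial (diffop2 p q r) u \<longrightarrow> degree u \<notin> K) \<and>
     (\<exists>a b W. a < b \<and> sl_weight p q a b W \<and>
        set_integrable lborel (einterval a b) W \<and>
        (\<forall>j. set_integrable lborel (einterval a b) (\<lambda>x. x ^ j * W x)) \<and>
        (\<forall>u :: real poly.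
          ((\<lambda>e. let x = real_of_ereal e in poly u x * fract_eval p x * W x) \<longlongrightarrow> 0) (at_right a) \<and>
          ((\<lambda>e. let x = real_of_ereal e in poly u x * fract_eval p x * W x) \<longlongrightarrow> 0) (at_left b)) \<and>
        dense_in_L2 (weighted_measure a b W) (module.span smult (y ` (- K))))"

end

theory Submission
  imports Defs
begin

text \<open>
  Comparing orders of vanishing of the \<open>y\<^sub>k\<close> at the poles shows that \<open>p\<close> is a polynomial and that
  \<open>q + 2 p \<eta>' / \<eta>\<close> is a polynomial \<open>qt\<close> of degree at most 1 for some polynomial \<open>\<eta>\<close>; so \<open>\<eta>\<^sup>2 W\<close> is the
  weight of \<open>S = p D\<^sub>z\<^sub>z + qt D\<^sub>z + \<mu>\<close>. Positivity of the moments forces \<open>S\<close> to be affinely equivalent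
  to a classical operator, up to the values of the parameters, which a Darboux transformation
  raises by 1.

  Since \<open>T\<close> is symmetric and its eigenpolynomials span a space of finite codimension, for a suitable
  polynomial \<open>G\<close> the product \<open>G y\<^sub>k\<close> is a combination of boundedly many eigenvectors of \<open>S\<close> with
  eigenvalues \<open>lam (k + i)\<close>, \<open>\<bar>i\<bar> \<le> N\<close>. As \<open>lam\<close> is quadratic, the component with \<open>i = 0\<close> can be
  extracted by left multiplications by \<open>S\<close> and right multiplications by \<open>T\<close>, which yields a nonzero
  differential operator \<open>L\<close> with \<open>L T = S L\<close>. Finally, \<open>L\<close> and some \<open>T - l\<close> have a common right
  factor; if it has order 1 it gives a Darboux transformation of \<open>T\<close> that lowers the order of \<open>L\<close>,
  and otherwise \<open>T - l\<close> can be cancelled from \<open>L\<close>.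
\<close>

section \<open>The derivation on rational functions\<close>

text \<open>The guiding picture is that \<open>L\<close> should send \<open>y k\<close> to an
  eigenpolynomial of \<open>S\<close> of degree \<open>k - d\<close>, with
  \<open>d = degree \<eta>\<close>; comparing eigenvalues at these degrees fixes the constant
  \<open>\<mu>\<close> in \<open>S\<close> and the shift by \<open>d\<close> in \<open>lam\<close>.
  Three obstacles shape the argument. \<open>T\<close> has poles, and what it is known to preserve
  is only the span \<open>U\<close> of the \<open>y k\<close>; the finite codimension of
  \<open>U\<close> enters as linear dependence modulo \<open>U\<close> of any
  \<open>card K + 1\<close> polynomials. Eigenvalues at small degrees may collide, and
  \<open>S\<close> may lack eigenpolynomials of some degrees, so spectral decompositions are
  replaced by products of factors \<open>S - lam (k + i)\<close>, and the argument is run for large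
  \<open>k\<close>; this suffices because an operator vanishing on infinitely many
  \<open>y k\<close> is zero. Finally, the component with \<open>i = 0\<close> may vanish for
  \<open>G y_k\<close> itself, so powers of \<open>S\<close> and of \<open>z\<close> are applied
  first, and some choice of them is shown to work. Positivity is a real notion, whereas the
  exponents at the poles and the constant \<open>l\<close> require complex numbers; hence the
  passages between the two fields.\<close>

lemma fract_cases:
  fixes f :: "'a::field_gcd poly fract"
  obtains a b where "b \<noteq> 0" "f = to_fract a / to_fract b"
  using Fract_conv_to_fract[of "num f" "den f"] by (metis Fract_quot_of_fract snd_quot_of_fract_nonzero)

text \<open>Differentiating \<open>n * b = a * d\<close> shows that the quotient rule gives the same
  value for every representative, not just the reduced one of the definition.\<close>

lemma fract_deriv_Fract:
  fixes a b :: "'a::field_gcd poly"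
  assumes b: "b \<noteq> 0"
  shows "fract_deriv (to_fract a / to_fract b)
    = to_fract (pderiv a * b - a * pderiv b) / to_fract (b * b)"
proof -
  define f where "f = to_fract a / to_fract b"
  define n d where "n = num f" and "d = den f"
  have d: "d \<noteq> 0" by (simp add: d_def)
  have "to_fract n / to_fract d = to_fract a / to_fract b"
    unfolding n_def d_def Fract_conv_to_fract[symmetric] by (simp add: f_def) (simp add: Fract_conv_to_fract)
  then have "to_fract (n * b) = to_fract (a * d)"
    using b d by (simp add: field_simps)
  then have e: "n * b = a * d" by (simp only: to_fract_eq_iff)
  have "pderiv (n * b) = pderiv (a * d)" using e by simp
  then have e': "pderiv n * b + n * pderiv b = pderiv a * d + a * pderiv d"
    by (simp add: pderiv_mult algebra_simps)
  have "(pderiv n * d - n * pderiv d) * (b * b)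
      = d * b * (pderiv n * b + n * pderiv b) - d * pderiv b * (n * b) - (n * b) * (pderiv d * b)"
    by (simp add: algebra_simps)
  also have "\<dots> = (pderiv a * b - a * pderiv b) * (d * d)"
    unfolding e e' by (simp add: algebra_simps)
  finally have "to_fract ((pderiv n * d - n * pderiv d) * (b * b))
      = to_fract ((pderiv a * b - a * pderiv b) * (d * d))" by simp
  then have "to_fract (pderiv n * d - n * pderiv d) / to_fract (d * d)
      = to_fract (pderiv a * b - a * pderiv b) / to_fract (b * b)"
    using b d by (simp add: field_simps)
  then show ?thesis
    by (simp add: fract_deriv_def Fract_conv_to_fract n_def d_def flip: f_def)
qed

lemma fract_deriv_to_fract [simp]: "fract_deriv (to_fract u) = to_fract (pderiv u)"
  for u :: "'a::field_gcd poly"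
  using fract_deriv_Fract[of 1 u] by simp

lemma fract_deriv_add: "fract_deriv (f + g) = fract_deriv f + fract_deriv g"
  for f g :: "'a::field_gcd poly fract"
proof -
  obtain a b where b: "b \<noteq> 0" and f: "f = to_fract a / to_fract b" by (rule fract_cases)
  obtain c d where d: "d \<noteq> 0" and g: "g = to_fract c / to_fract d" by (rule fract_cases)
  have "f + g = to_fract (a * d + c * b) / to_fract (b * d)"
    using b d by (simp add: f g field_simps)
  then have "fract_deriv (f + g) = to_fract (pderiv (a * d + c * b) * (b * d)
      - (a * d + c * b) * pderiv (b * d)) / to_fract (b * d * (b * d))"
    using b d by (simp only: fract_deriv_Fract mult_eq_0_iff simp_thms)
  also have "\<dots> = fract_deriv f + fract_deriv g"
    using b d by (simp add: f g fract_deriv_Fract pderiv_mult pderiv_add divide_simps)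
      (simp add: algebra_simps)
  finally show ?thesis .
qed

lemma fract_deriv_mult: "fract_deriv (f * g) = fract_deriv f * g + f * fract_deriv g"
  for f g :: "'a::field_gcd poly fract"
proof -
  obtain a b where b: "b \<noteq> 0" and f: "f = to_fract a / to_fract b" by (rule fract_cases)
  obtain c d where d: "d \<noteq> 0" and g: "g = to_fract c / to_fract d" by (rule fract_cases)
  have "f * g = to_fract (a * c) / to_fract (b * d)"
    using b d by (simp add: f g field_simps)
  then have "fract_deriv (f * g) = to_fract (pderiv (a * c) * (b * d)
      - (a * c) * pderiv (b * d)) / to_fract (b * d * (b * d))"
    using b d by (simp only: fract_deriv_Fract mult_eq_0_iff simp_thms)
  also have "\<dots> = fract_deriv f * g + f * fract_deriv g"
    using b d by (simp add: f g fract_deriv_Fract pderiv_mult divide_simps)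
      (simp add: algebra_simps)
  finally show ?thesis .
qed

lemma fract_deriv_0 [simp]: "fract_deriv 0 = (0 :: 'a::field_gcd poly fract)"
  using fract_deriv_to_fract[of "0::'a poly"] by simp

lemma fract_deriv_1 [simp]: "fract_deriv 1 = (0 :: 'a::field_gcd poly fract)"
  using fract_deriv_to_fract[of "1::'a poly"] by simp

lemma fract_deriv_const [simp]: "fract_deriv (constf c) = 0"
  by (simp add: pderiv_pCons)

lemma fract_deriv_cmult: "fract_deriv (constf c * f) = constf c * fract_deriv f"
  for f :: "'a::field_gcd poly fract"
  by (simp add: fract_deriv_mult del: fract_deriv_to_fract)

lemma fract_deriv_sum: "fract_deriv (\<Sum>i\<in>A. f i) = (\<Sum>i\<in>A. fract_deriv (f i))"
  for f :: "'b \<Rightarrow> 'a::field_gcd poly fract"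
  by (induction A rule: infinite_finite_induct) (simp_all add: fract_deriv_add)

text \<open>In reduced form \<open>n / d\<close>, a zero derivative gives
  \<open>d dvd n * pderiv d\<close>, hence \<open>d dvd pderiv d\<close> by coprimality, and degrees
  force \<open>pderiv d = 0\<close>.\<close>

lemma fract_deriv_eq_0_imp_const:
  fixes f :: "'a::{field_char_0,field_gcd} poly fract"
  assumes "fract_deriv f = 0"
  obtains c where "f = constf c"
proof -
  define n d where "n = num f" and "d = den f"
  have d: "d \<noteq> 0" by (simp add: d_def)
  have f: "f = to_fract n / to_fract d"
    by (metis Fract_conv_to_fract Fract_quot_of_fract d_def n_def)
  have "to_fract (pderiv n * d - n * pderiv d) = 0"
    using assms d by (simp add: f fract_deriv_Fract)
  then have e: "pderiv n * d = n * pderiv d" by (simp only: to_fract_eq_0_iff) simp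
  then have "d dvd n * pderiv d" by (metis dvd_triv_right)
  moreover have "coprime d n"
    using coprime_quot_of_fract[of f] by (simp add: n_def d_def coprime_commute)
  ultimately have "d dvd pderiv d" by (simp add: coprime_dvd_mult_right_iff)
  then have "pderiv d = 0"
    by (metis d degree_pderiv diff_less dvd_imp_degree_le leD less_one less_or_eq_imp_le
        neq0_conv pderiv_eq_0_iff)
  with e d have "pderiv n = 0" by simp
  from \<open>pderiv d = 0\<close> \<open>pderiv n = 0\<close> obtain n' d' where "n = [:n':]" "d = [:d':]"
    by (metis degree_eq_zeroE pderiv_eq_0_iff)
  then have "f = constf (n' / d')" using d by (simp add: f field_simps flip: to_fract_mult)
  then show ?thesis by (rule that)
qed

lemma to_fract_of_nat [simp]: "to_fract (of_nat k) = of_nat k"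
  by (induction k) simp_all

lemma of_nat_fract_eq_0_iff [simp]: "(of_nat k :: 'a::{field_char_0,field_gcd} poly fract) = 0 \<longleftrightarrow> k = 0"
  by (metis of_nat_eq_0_iff to_fract_eq_0_iff to_fract_of_nat)

lemma to_fract_sum [simp]: "to_fract (\<Sum>i\<in>A. f i) = (\<Sum>i\<in>A. to_fract (f i))"
  by (induction A rule: infinite_finite_induct) simp_all

section \<open>Differential operators by order and leading coefficient\<close>

definition ordlt :: "nat \<Rightarrow> 'a::{field_char_0,field_gcd} diffop \<Rightarrow> bool" where
  "ordlt n T \<longleftrightarrow> (\<exists>c. T = (\<lambda>f. \<Sum>i<n. c i * (fract_deriv ^^ i) f))"

text \<open>The coefficient \<open>x\<close> may be zero: \<open>oplead n 0\<close> then expresses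
  order less than \<open>n\<close>, so sums and differences need no case distinction.\<close>

definition oplead :: "nat \<Rightarrow> 'a::{field_char_0,field_gcd} poly fract \<Rightarrow> 'a diffop \<Rightarrow> bool" where
  "oplead n x T \<longleftrightarrow> (\<exists>c. c n = x \<and> T = (\<lambda>f. \<Sum>i\<le>n. c i * (fract_deriv ^^ i) f))"

lemma Diff_iff_oplead: "T \<in> Diff n \<longleftrightarrow> (\<exists>x. x \<noteq> 0 \<and> oplead n x T)"
  by (auto simp: Diff_def oplead_def)

lemma ordlt_Suc_iff: "ordlt (Suc n) T \<longleftrightarrow> (\<exists>x. oplead n x T)"
  by (auto simp: ordlt_def oplead_def lessThan_Suc_atMost)

lemma ordlt_0_iff: "ordlt 0 T \<longleftrightarrow> T = (\<lambda>f. 0)"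
  by (auto simp: ordlt_def)

lemma oplead_0I: "oplead 0 x (\<lambda>f. x * f)"
  by (auto simp: oplead_def)

lemma oplead_0D: "oplead 0 x T \<Longrightarrow> T = (\<lambda>f. x * f)"
  by (auto simp: oplead_def)

lemma oplead_deriv: "oplead 1 1 fract_deriv"
  unfolding oplead_def by (rule exI[of _ "\<lambda>i. if i = 1 then 1 else 0"]) (auto simp: fun_eq_iff)

lemma oplead_id: "oplead 0 1 (\<lambda>f. f)"
  using oplead_0I[of 1] by simp

lemma oplead_add:
  assumes "oplead n x T" "oplead n y S"
  shows "oplead n (x + y) (\<lambda>f. T f + S f)"
proof -
  from assms obtain c d where "c n = x" "T = (\<lambda>f. \<Sum>i\<le>n. c i * (fract_deriv ^^ i) f)"
    "d n = y" "S = (\<lambda>f. \<Sum>i\<le>n. d i * (fract_deriv ^^ i) f)"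
    by (auto simp: oplead_def)
  then show ?thesis unfolding oplead_def
    by (intro exI[of _ "\<lambda>i. c i + d i"]) (auto simp: sum.distrib distrib_right)
qed

lemma oplead_mult:
  assumes "oplead n x T" shows "oplead n (g * x) (\<lambda>f. g * T f)"
proof -
  from assms obtain c where "c n = x" "T = (\<lambda>f. \<Sum>i\<le>n. c i * (fract_deriv ^^ i) f)"
    by (auto simp: oplead_def)
  then show ?thesis unfolding oplead_def
    by (intro exI[of _ "\<lambda>i. g * c i"]) (auto simp: sum_distrib_left mult.assoc)
qed

lemma oplead_diff:
  assumes "oplead n x T" "oplead n y S"
  shows "oplead n (x - y) (\<lambda>f. T f - S f)"
  using oplead_add[OF assms(1) oplead_mult[OF assms(2), of "-1"]] by simp

lemma oplead_Suc:
  assumes "oplead n x T" shows "oplead (Suc n) 0 T"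
proof -
  from assms obtain c where c: "c n = x" "T = (\<lambda>f. \<Sum>i\<le>n. c i * (fract_deriv ^^ i) f)"
    by (auto simp: oplead_def)
  then show ?thesis unfolding oplead_def
    by (intro exI[of _ "c(Suc n := 0)"]) auto
qed

lemma oplead_SucD:
  assumes "oplead (Suc n) 0 T" shows "\<exists>x. oplead n x T"
proof -
  from assms obtain c where c: "c (Suc n) = 0" "T = (\<lambda>f. \<Sum>i\<le>Suc n. c i * (fract_deriv ^^ i) f)"
    by (auto simp: oplead_def)
  then show ?thesis unfolding oplead_def by (intro exI[of _ "c n"] exI[of _ c]) auto
qed

lemma oplead_less:
  assumes "oplead n x T" "n < m" shows "oplead m 0 T"
  using assms(2)
proof (induction m)
  case (Suc m)
  then show ?case
    by (metis assms(1) less_Suc_eq oplead_Suc)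
qed simp

lemma ordlt_less: "ordlt n T \<Longrightarrow> n \<le> m \<Longrightarrow> oplead m 0 T"
proof (cases n)
  case 0
  assume "ordlt n T"
  with 0 have "T = (\<lambda>f. 0 * f)" by (simp add: ordlt_0_iff)
  then have "oplead 0 0 T" using oplead_0I[of 0] by simp
  then show ?thesis using oplead_less[of 0 0 T m] by (cases "m = 0") auto
next
  case (Suc k)
  assume "ordlt n T" "n \<le> m"
  with Suc show ?thesis by (auto simp: ordlt_Suc_iff intro: oplead_less)
qed

lemma ordlt_iff_oplead_0: "ordlt n T \<longleftrightarrow> oplead n 0 T"
proof
  show "ordlt n T \<Longrightarrow> oplead n 0 T" using ordlt_less by blast
  assume T: "oplead n 0 T"
  show "ordlt n T"
  proof (cases n)
    case 0
    with T oplead_0D[of 0 T] show ?thesis by (simp add: ordlt_0_iff)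
  next
    case (Suc k)
    with T show ?thesis by (auto simp: ordlt_Suc_iff dest: oplead_SucD)
  qed
qed

lemma oplead_deriv_comp:
  assumes "oplead n x T" shows "oplead (Suc n) x (\<lambda>f. fract_deriv (T f))"
proof -
  from assms obtain c where c: "c n = x" "T = (\<lambda>f. \<Sum>i\<le>n. c i * (fract_deriv ^^ i) f)"
    by (auto simp: oplead_def)
  \<comment> \<open>Leibniz rule: the shifted coefficient \<open>c (i - 1)\<close> plus the
    derivative of \<open>c i\<close>.\<close>
  define d where "d i = (case i of 0 \<Rightarrow> 0 | Suc j \<Rightarrow> c j) + (if i \<le> n then fract_deriv (c i) else 0)" for i
  have "fract_deriv (T f) = (\<Sum>i\<le>Suc n. d i * (fract_deriv ^^ i) f)" for f
  proof -
    have "(\<Sum>i\<le>Suc n. d i * (fract_deriv ^^ i) f)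
      = (\<Sum>i\<le>Suc n. (case i of 0 \<Rightarrow> 0 | Suc j \<Rightarrow> c j) * (fract_deriv ^^ i) f)
       + (\<Sum>i\<le>Suc n. (if i \<le> n then fract_deriv (c i) else 0) * (fract_deriv ^^ i) f)"
      by (simp only: d_def distrib_right sum.distrib)
    also have "(\<Sum>i\<le>Suc n. (case i of 0 \<Rightarrow> 0 | Suc j \<Rightarrow> c j) * (fract_deriv ^^ i) f)
      = (\<Sum>i\<le>n. c i * fract_deriv ((fract_deriv ^^ i) f))"
      by (simp only: sum.atMost_Suc_shift) simp
    also have "(\<Sum>i\<le>Suc n. (if i \<le> n then fract_deriv (c i) else 0) * (fract_deriv ^^ i) f)
      = (\<Sum>i\<le>n. fract_deriv (c i) * (fract_deriv ^^ i) f)"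
      by simp
    finally show ?thesis
      by (simp add: c fract_deriv_sum fract_deriv_mult sum.distrib)
  qed
  moreover have "d (Suc n) = x" by (simp add: d_def c)
  ultimately show ?thesis unfolding oplead_def by blast
qed

lemma oplead_funpow: "oplead n x T \<Longrightarrow> oplead (i + n) x (\<lambda>f. (fract_deriv ^^ i) (T f))"
  by (induction i) (auto dest: oplead_deriv_comp)

lemma oplead_deriv_funpow: "oplead i 1 (fract_deriv ^^ i)"
  using oplead_funpow[OF oplead_id, of i] by simp

lemma oplead_sum:
  assumes "\<And>i. i \<in> I \<Longrightarrow> oplead n 0 (T i)" shows "oplead n 0 (\<lambda>f. \<Sum>i\<in>I. T i f)"
  using assms
proof (induction I rule: infinite_finite_induct)
  case (insert i I)
  then show ?case using oplead_add[of n 0 "T i" 0 "\<lambda>f. \<Sum>i\<in>I. T i f"] by simp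
next
  case (infinite A)
  then show ?case using ordlt_less[of 0 "\<lambda>f. 0" n] by (simp add: ordlt_0_iff)
next
  case empty
  then show ?case using ordlt_less[of 0 "\<lambda>f. 0" n] by (simp add: ordlt_0_iff)
qed

text \<open>Only the top term of \<open>A\<close> reaches order \<open>m + n\<close>. As the
  coefficients form a field, it follows that orders add under composition.\<close>

lemma oplead_comp:
  assumes "oplead m x A" "oplead n y B"
  shows "oplead (m + n) (x * y) (\<lambda>f. A (B f))"
proof -
  from assms(1) obtain c where c: "c m = x" "A = (\<lambda>f. \<Sum>i\<le>m. c i * (fract_deriv ^^ i) f)"
    by (auto simp: oplead_def)
  have *: "oplead (i + n) (c i * y) (\<lambda>f. c i * (fract_deriv ^^ i) (B f))" for i
    by (intro oplead_mult oplead_funpow assms)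
  have 1: "oplead (m + n) 0 (\<lambda>f. \<Sum>i<m. c i * (fract_deriv ^^ i) (B f))"
    by (rule oplead_sum) (rule oplead_less[OF *], simp)
  have "oplead (m + n) (0 + c m * y)
    (\<lambda>f. (\<Sum>i<m. c i * (fract_deriv ^^ i) (B f)) + c m * (fract_deriv ^^ m) (B f))"
    by (rule oplead_add[OF 1 *])
  then show ?thesis by (simp add: c add.commute lessThan_Suc flip: lessThan_Suc_atMost)
qed

lemma Diff_comp: "A \<in> Diff m \<Longrightarrow> B \<in> Diff n \<Longrightarrow> (\<lambda>f. A (B f)) \<in> Diff (m + n)"
  unfolding Diff_iff_oplead by (metis mult_eq_0_iff oplead_comp)

section \<open>Operators of unspecified order and right division\<close>

definition dop :: "'a::{field_char_0,field_gcd} diffop \<Rightarrow> bool" where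
  "dop T \<longleftrightarrow> (\<exists>n. ordlt n T)"

lemma dop_iff_oplead: "dop T \<longleftrightarrow> (\<exists>n x. oplead n x T)"
  unfolding dop_def by (metis ordlt_Suc_iff ordlt_iff_oplead_0)

lemma oplead_imp_dop: "oplead n x T \<Longrightarrow> dop T"
  by (auto simp: dop_iff_oplead)

lemma Diff_imp_dop: "T \<in> Diff n \<Longrightarrow> dop T"
  by (auto simp: Diff_iff_oplead dop_iff_oplead)

lemma dop_add: assumes "dop T" "dop S" shows "dop (\<lambda>f. T f + S f)"
proof -
  from assms obtain m n where "ordlt m T" "ordlt n S" by (auto simp: dop_def)
  then have "oplead (max m n) 0 T" "oplead (max m n) 0 S" by (auto intro: ordlt_less)
  then show ?thesis by (metis oplead_add oplead_imp_dop)
qed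

lemma dop_mult: "dop T \<Longrightarrow> dop (\<lambda>f. g * T f)"
  unfolding dop_iff_oplead by (blast dest: oplead_mult)

lemma dop_mult_id: "dop (\<lambda>f. g * f)"
  using oplead_0I oplead_imp_dop by blast

lemma dop_diff: "dop T \<Longrightarrow> dop S \<Longrightarrow> dop (\<lambda>f. T f - S f)"
  using dop_add[OF _ dop_mult[of S "-1"]] by simp

lemma dop_comp: "dop T \<Longrightarrow> dop S \<Longrightarrow> dop (\<lambda>f. T (S f))"
  unfolding dop_iff_oplead by (blast dest: oplead_comp)

lemma dop_deriv: "dop fract_deriv"
  using oplead_deriv by (rule oplead_imp_dop)

lemma dop_id: "dop (\<lambda>f. f)"
  using oplead_id by (rule oplead_imp_dop)

lemma dop_0: "dop (\<lambda>f. 0)"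
  using dop_mult_id[of 0] by simp

lemma dop_funpow: "dop T \<Longrightarrow> dop (T ^^ j)"
proof (induction j)
  case 0
  then show ?case using dop_id by (simp add: id_def)
next
  case (Suc j)
  then show ?case using dop_comp[of T "T ^^ j"] by (simp add: comp_def)
qed

lemma dop_diffop2: "dop (diffop2 p q r)"
  unfolding diffop2_def by (intro dop_add dop_mult dop_mult_id dop_deriv dop_comp[of fract_deriv fract_deriv])

lemma funpow_fract_deriv_add:
  "(fract_deriv ^^ i) (f + g) = (fract_deriv ^^ i) f + (fract_deriv ^^ i) (g::'a::field_gcd poly fract)"
  by (induction i) (simp_all add: fract_deriv_add)

lemma funpow_fract_deriv_cmult:
  "(fract_deriv ^^ i) (constf c * f) = constf c * (fract_deriv ^^ i) (f::'a::field_gcd poly fract)"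
  by (induction i) (simp_all add: fract_deriv_cmult)

lemma dop_plus: assumes "dop T" shows "T (f + g) = T f + T g"
proof -
  from assms obtain n c where "T = (\<lambda>f. \<Sum>i<n. c i * (fract_deriv ^^ i) f)"
    by (auto simp: dop_def ordlt_def)
  then show ?thesis by (simp add: funpow_fract_deriv_add distrib_left sum.distrib)
qed

lemma dop_cmult: assumes "dop T" shows "T (constf c * f) = constf c * T f"
proof -
  from assms obtain n d where "T = (\<lambda>f. \<Sum>i<n. d i * (fract_deriv ^^ i) f)"
    by (auto simp: dop_def ordlt_def)
  then show ?thesis by (simp add: funpow_fract_deriv_cmult sum_distrib_left mult.left_commute)
qed

lemma dop_zero: assumes "dop T" shows "T 0 = 0"
  using dop_cmult[OF assms, of 0 0] by simp

lemma dop_uminus: assumes "dop T" shows "T (- f) = - T f"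
  using dop_plus[OF assms, of f "- f"] dop_zero[OF assms] by (simp add: eq_neg_iff_add_eq_0 add.commute)

lemma dop_minus: assumes "dop T" shows "T (f - g) = T f - T g"
  using dop_plus[OF assms, of f "- g"] dop_uminus[OF assms] by simp

lemma dop_sum: assumes "dop T" shows "T (\<Sum>i\<in>A. f i) = (\<Sum>i\<in>A. T (f i))"
  by (induction A rule: infinite_finite_induct) (simp_all add: dop_plus dop_zero assms)

lemma funpow_fract_deriv_to_fract:
  "(fract_deriv ^^ i) (to_fract u) = to_fract ((pderiv ^^ i) (u::'a::field_gcd poly))"
  by (induction i) simp_all

text \<open>Applied to \<open>z ^ i\<close>, the terms above \<open>i\<close> vanish and those below
  \<open>i\<close> have zero coefficients by induction, which leaves
  \<open>c i * fact i = 0\<close>.\<close>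

lemma oplead_zero_imp:
  fixes x :: "'a::{field_char_0,field_gcd} poly fract"
  assumes "oplead n x T" "\<And>u. T (to_fract u) = 0"
  shows "x = 0"
proof -
  from assms obtain c where c: "c n = x" "T = (\<lambda>f. \<Sum>i\<le>n. c i * (fract_deriv ^^ i) f)"
    by (auto simp: oplead_def)
  have "c i = 0" if "i \<le> n" for i using that
  proof (induction i rule: less_induct)
    case (less i)
    let ?u = "monom 1 i :: 'a poly"
    have d: "(pderiv ^^ j) ?u = 0" if "j > i" for j
      by (rule poly_eqI) (use that in \<open>simp add: coeff_higher_pderiv\<close>)
    have di: "(pderiv ^^ i) ?u = of_nat (fact i)"
      by (rule poly_eqI)
        (auto simp: coeff_higher_pderiv of_nat_poly coeff_pCons simp flip: pochhammer_fact split: nat.splits)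
    have di': "to_fract ((pderiv ^^ i) ?u) = of_nat (fact i)" unfolding di by (rule to_fract_of_nat)
    have "T (to_fract ?u) = (\<Sum>j\<le>n. if j = i then c i * of_nat (fact i) else 0)"
      unfolding c
    proof (rule sum.cong)
      fix j assume "j \<in> {..n}"
      then show "c j * (fract_deriv ^^ j) (to_fract ?u) = (if j = i then c i * of_nat (fact i) else 0)"
        using less d di' by (cases j i rule: linorder_cases) (auto simp: funpow_fract_deriv_to_fract)
    qed simp
    also have "\<dots> = c i * of_nat (fact i)" using less by simp
    finally show ?case using assms(2)[of ?u] by (metis fact_nonzero mult_eq_0_iff of_nat_fract_eq_0_iff)
  qed
  with c show ?thesis by auto
qed

lemma Diff_nonzero:
  assumes "T \<in> Diff n" obtains u where "T (to_fract u) \<noteq> 0"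
  using assms oplead_zero_imp unfolding Diff_iff_oplead by blast

lemma Diff_unique:
  assumes "T \<in> Diff m" "T \<in> Diff n" shows "m = n"
proof -
  have False if "T \<in> Diff m" "T \<in> Diff n" "m < n" for m n
  proof -
    from that obtain x y where xy: "oplead m x T" "oplead n y T" "y \<noteq> 0" by (auto simp: Diff_iff_oplead)
    have "oplead n (y - 0) (\<lambda>f. T f - T f)"
      by (rule oplead_diff[OF xy(2) oplead_less[OF xy(1) that(3)]])
    then show False using xy(3) oplead_zero_imp by force
  qed
  with assms show ?thesis by (metis linorder_neqE_nat)
qed

lemma dop_cases:
  assumes "dop T" obtains "T = (\<lambda>f. 0)" | n where "T \<in> Diff n"
proof -
  from assms obtain n where "ordlt n T" by (auto simp: dop_def)
  then have "T = (\<lambda>f. 0) \<or> (\<exists>n. T \<in> Diff n)"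
  proof (induction n)
    case 0
    then show ?case by (simp add: ordlt_0_iff)
  next
    case (Suc n)
    then show ?case by (metis Diff_iff_oplead ordlt_Suc_iff ordlt_iff_oplead_0)
  qed
  then show ?thesis using that by blast
qed

lemma dop_eq_0I:
  assumes "dop T" "\<And>u. T (to_fract u) = 0" shows "T = (\<lambda>f. 0)"
  using assms(1) by (rule dop_cases) (use assms(2) Diff_nonzero in \<open>blast+\<close>)

text \<open>Orders add, so the ring of operators has no zero divisors.\<close>

lemma dop_cancel:
  assumes "dop X" "A \<in> Diff m" "\<And>f. X (A f) = 0" shows "X = (\<lambda>f. 0)"
  using assms(1)
proof (rule dop_cases)
  fix n assume "X \<in> Diff n"
  then have "(\<lambda>f. X (A f)) \<in> Diff (n + m)" using assms(2) by (rule Diff_comp)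
  then show ?thesis using assms(3) Diff_nonzero by force
qed

lemma Diff_quotient:
  assumes "T \<in> Diff n" "A \<in> Diff m" "dop Q" "T = (\<lambda>f. Q (A f))"
  shows "m \<le> n" "Q \<in> Diff (n - m)"
proof -
  from assms(3) have "\<exists>k. Q \<in> Diff k"
    using assms(1,4) Diff_nonzero by (auto elim!: dop_cases)
  then obtain k where k: "Q \<in> Diff k" by blast
  then have "n = k + m" using Diff_comp[OF k assms(2)] Diff_unique assms(1,4) by blast
  with k show "m \<le> n" "Q \<in> Diff (n - m)" by auto
qed

text \<open>Euclidean division on the right: the multiple \<open>(y / x) D^k A\<close> has the same
  leading term as \<open>T\<close>, and subtracting it lowers the order.\<close>

lemma op_division:
  assumes A: "A \<in> Diff m" and T: "dop T"
  obtains Q R where "dop Q" "ordlt m R" "\<And>f. T f = Q (A f) + R f"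
proof -
  from A obtain x where x: "x \<noteq> 0" "oplead m x A" by (auto simp: Diff_iff_oplead)
  from T obtain n where "ordlt n T" by (auto simp: dop_def)
  then have "\<exists>Q R. dop Q \<and> ordlt m R \<and> (\<forall>f. T f = Q (A f) + R f)"
  proof (induction n arbitrary: T)
    case 0
    then have "T = (\<lambda>f. 0)" by (simp add: ordlt_0_iff)
    then show ?case using dop_0 ordlt_less[of 0 "\<lambda>f. 0" m]
      by (intro exI[of _ "\<lambda>f. 0"]) (auto simp: ordlt_iff_oplead_0[symmetric] ordlt_0_iff)
  next
    case (Suc n)
    show ?case
    proof (cases "Suc n \<le> m")
      case True
      then show ?thesis using Suc.prems dop_0
        by (intro exI[of _ "\<lambda>f. 0"] exI[of _ T]) (auto simp: ordlt_iff_oplead_0[of m] ordlt_less)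
    next
      case False
      then obtain k where n: "n = k + m" by (metis add.commute le_Suc_ex not_less_eq_eq)
      from Suc.prems obtain y where y: "oplead n y T" by (auto simp: ordlt_Suc_iff)
      let ?B = "\<lambda>f. y / x * (fract_deriv ^^ k) f"
      have B: "oplead k (y / x) ?B" using oplead_mult[OF oplead_deriv_funpow[of k], of "y / x"] by simp
      have "oplead n (y / x * x) (\<lambda>f. ?B (A f))" unfolding n by (rule oplead_comp[OF B x(2)])
      then have "oplead n (y - y) (\<lambda>f. T f - ?B (A f))" using y x(1) by (intro oplead_diff) auto
      then have "ordlt n (\<lambda>f. T f - ?B (A f))" by (simp add: ordlt_iff_oplead_0)
      from Suc.IH[OF this] obtain Q R where
        QR: "dop Q" "ordlt m R" "\<forall>f. T f - ?B (A f) = Q (A f) + R f" by blast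
      have "T f = (Q (A f) + ?B (A f)) + R f" for f using QR(3)[rule_format, of f] by (simp add: algebra_simps)
      moreover have "dop (\<lambda>f. Q f + ?B f)" using QR(1) B by (intro dop_add) (auto intro: oplead_imp_dop)
      ultimately show ?thesis using QR(2) by (intro exI[of _ "\<lambda>f. Q f + ?B f"] exI[of _ R]) blast
    qed
  qed
  then show ?thesis using that by blast
qed

section \<open>Intertwining operators and factorization chains\<close>

text \<open>Gaussian elimination: the pivot \<open>j0\<close> clears the coordinate
  \<open>i0\<close> from the other vectors, and its own coefficient \<open>- s\<close> is restored
  at the end.\<close>

lemma nontrivial_relation:
  fixes v :: "'j \<Rightarrow> 'i \<Rightarrow> 'a::field"
  assumes "finite I" "finite J" "card I < card J"
  shows "\<exists>g. (\<exists>j\<in>J. g j \<noteq> 0) \<and> (\<forall>i\<in>I. (\<Sum>j\<in>J. g j * v j i) = 0)"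
  using assms
proof (induction I arbitrary: J v rule: finite_induct)
  case empty
  then obtain j where "j \<in> J" by fastforce
  then show ?case by (intro exI[of _ "\<lambda>_. 1"]) auto
next
  case (insert i0 I)
  show ?case
  proof (cases "\<forall>j\<in>J. v j i0 = 0")
    case True
    from insert obtain g where "\<exists>j\<in>J. g j \<noteq> 0" "\<forall>i\<in>I. (\<Sum>j\<in>J. g j * v j i) = 0"
      by (metis Suc_lessD card_insert_disjoint)
    then show ?thesis using True by (intro exI[of _ g]) auto
  next
    case False
    then obtain j0 where j0: "j0 \<in> J" "v j0 i0 \<noteq> 0" by blast
    let ?J = "J - {j0}"
    have "card I < card ?J" using insert j0 by simp
    then obtain g where g: "\<exists>j\<in>?J. g j \<noteq> 0"
      "\<forall>i\<in>I. (\<Sum>j\<in>?J. g j * (v j i - v j i0 / v j0 i0 * v j0 i)) = 0"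
      using insert.IH[of ?J "\<lambda>j i. v j i - v j i0 / v j0 i0 * v j0 i"] insert.prems by auto
    define s where "s = (\<Sum>j\<in>?J. g j * (v j i0 / v j0 i0))"
    define h where "h = g(j0 := - s)"
    have h: "(\<Sum>j\<in>J. h j * v j i) = (\<Sum>j\<in>?J. g j * (v j i - v j i0 / v j0 i0 * v j0 i))" for i
    proof -
      have "(\<Sum>j\<in>J. h j * v j i) = - s * v j0 i + (\<Sum>j\<in>?J. h j * v j i)"
        using j0 insert.prems by (subst sum.remove[of _ j0]) (auto simp: h_def)
      also have "(\<Sum>j\<in>?J. h j * v j i) = (\<Sum>j\<in>?J. g j * v j i)"
        by (rule sum.cong) (auto simp: h_def)
      also have "- s * v j0 i = - (\<Sum>j\<in>?J. g j * (v j i0 / v j0 i0 * v j0 i))"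
        by (simp add: s_def sum_distrib_right mult.assoc)
      finally show ?thesis by (simp add: right_diff_distrib sum_subtractf)
    qed
    have "(\<Sum>j\<in>J. h j * v j i) = 0" if "i \<in> insert i0 I" for i
      unfolding h using that g(2) j0 by auto
    moreover have "\<exists>j\<in>J. h j \<noteq> 0" using g(1) by (auto simp: h_def)
    ultimately show ?thesis by blast
  qed
qed

lemma dop_sum_op: "(\<And>i. i \<in> I \<Longrightarrow> dop (T i)) \<Longrightarrow> dop (\<lambda>f. \<Sum>i\<in>I. T i f)"
  by (induction I rule: infinite_finite_induct) (auto intro: dop_0 dop_add)

lemma intertwiner_funpow:
  assumes "\<And>f. L (T f) = S (L f)" shows "L ((T ^^ j) f) = (S ^^ j) (L f)"
  by (induction j) (simp_all add: assms)

text \<open>Right multiplication by \<open>T\<close> is an endomorphism of the left module of operators modulo left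
  multiples of \<open>L\<close>. A shortest linear relation over the rational functions between its powers
  has constant coefficients, as one sees by differentiating it.\<close>

lemma intertwiner_annihilator:
  fixes L :: "'a::{field_char_0,field_gcd} diffop"
  assumes L: "L \<in> Diff n" and T: "dop T" and S: "dop S" and LT: "\<And>f. L (T f) = S (L f)"
  obtains J c Y where "c J = 1" "dop Y"
    "\<And>f. (\<Sum>j\<le>J. constf (c j) * (T ^^ j) f) = Y (L f)"
proof -
  \<comment> \<open>The relation is demanded after every \<open>X\<close>, because \<open>X\<close>
    does not commute with the functions \<open>g j\<close>. Closure under replacing \<open>X\<close>
    by its derivative is what permits differentiation below.\<close>
  define rel where "rel J g \<longleftrightarrow> g J = 1 \<and> (\<forall>X. dop X \<longrightarrow>
    (\<exists>Y. dop Y \<and> (\<forall>f. (\<Sum>j\<le>J. g j * X ((T ^^ j) f)) = Y (L f))))"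
    for J :: nat and g :: "nat \<Rightarrow> 'a poly fract"
  have LTj: "L ((T ^^ j) f) = (S ^^ j) (L f)" for j f
    by (rule intertwiner_funpow) (rule LT)
  have T_j: "dop (T ^^ j)" for j using T by (rule dop_funpow)
  have S_j: "dop (S ^^ j)" for j using S by (rule dop_funpow)
  have D_i: "dop (fract_deriv ^^ i)" for i using dop_deriv by (rule dop_funpow)
  have "\<exists>J g. rel J g"
  proof -
    have "\<forall>i j. \<exists>Q c. dop Q \<and> (\<forall>f. (fract_deriv ^^ i) ((T ^^ j) f)
      = Q (L f) + (\<Sum>l<n. c l * (fract_deriv ^^ l) f))"
    proof (intro allI)
      fix i j
      obtain Q R where "dop Q" "ordlt n R" "\<And>f. (fract_deriv ^^ i) ((T ^^ j) f) = Q (L f) + R f"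
        using op_division[OF L dop_comp[OF D_i T_j]] by blast
      then show "\<exists>Q c. dop Q \<and> (\<forall>f. (fract_deriv ^^ i) ((T ^^ j) f)
          = Q (L f) + (\<Sum>l<n. c l * (fract_deriv ^^ l) f))"
        unfolding ordlt_def by auto
    qed
    then obtain Q c where Q: "\<And>i j. dop (Q i j)" and Qc: "\<And>i j f. (fract_deriv ^^ i) ((T ^^ j) f)
      = Q i j (L f) + (\<Sum>l<n. c i j l * (fract_deriv ^^ l) f)"
      unfolding choice_iff by blast
    \<comment> \<open>Modulo \<open>L\<close> the action of \<open>T ^^ j\<close> is an
      \<open>n\<close> by \<open>n\<close> matrix of remainders, so \<open>n * n + 1\<close> powers
      are dependent over the rational functions.\<close>
    obtain g where g: "\<exists>j\<in>{..n*n}. g j \<noteq> 0"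
      "\<forall>i\<in>{..<n}\<times>{..<n}. (\<Sum>j\<le>n*n. g j * (case i of (i, l) \<Rightarrow> c i j l)) = 0"
      using nontrivial_relation[of "{..<n}\<times>{..<n}" "{..n*n}" "\<lambda>j (i, l). c i j l"] by auto
    define J where "J = Max {j\<in>{..n*n}. g j \<noteq> 0}"
    have J: "J \<in> {j\<in>{..n*n}. g j \<noteq> 0}" unfolding J_def by (rule Max_in) (use g in auto)
    have Jmax: "g j = 0" if "j \<le> n * n" "j > J" for j
      using Max_ge[of "{j\<in>{..n*n}. g j \<noteq> 0}" j] that by (fold J_def) auto
    define h where "h j = g j / g J" for j
    have hc: "(\<Sum>j\<le>J. h j * c i j l) = 0" if "i < n" "l < n" for i l
    proof -
      have "(\<Sum>j\<le>J. g j * c i j l) = (\<Sum>j\<le>n*n. g j * c i j l)"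
        by (rule sum.mono_neutral_left) (use J Jmax in auto)
      also have "\<dots> = 0" using g(2) that by auto
      finally show ?thesis by (simp add: h_def flip: sum_divide_distrib)
    qed
    have "rel J h"
      unfolding rel_def
    proof (intro conjI allI impI)
      show "h J = 1" using J by (simp add: h_def)
      fix X :: "'a diffop" assume "dop X"
      then obtain Q0 R0 where Q0: "dop Q0" "ordlt n R0" "\<And>f. X f = Q0 (L f) + R0 f"
        using op_division[OF L] by blast
      then obtain x where x: "R0 = (\<lambda>f. \<Sum>i<n. x i * (fract_deriv ^^ i) f)" by (auto simp: ordlt_def)
      let ?Y = "\<lambda>u. \<Sum>j\<le>J. h j * (Q0 ((S ^^ j) u) + (\<Sum>i<n. x i * Q i j u))"
      have "(\<Sum>j\<le>J. h j * X ((T ^^ j) f)) = ?Y (L f)" for f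
      proof -
        have "(\<Sum>j\<le>J. h j * X ((T ^^ j) f)) = ?Y (L f)
            + (\<Sum>j\<le>J. h j * (\<Sum>i<n. x i * (\<Sum>l<n. c i j l * (fract_deriv ^^ l) f)))"
          by (simp add: Q0 x LTj Qc distrib_left sum.distrib)
        also have "(\<Sum>j\<le>J. h j * (\<Sum>i<n. x i * (\<Sum>l<n. c i j l * (fract_deriv ^^ l) f)))
          = (\<Sum>j\<le>J. \<Sum>i<n. \<Sum>l<n. h j * (x i * (c i j l * (fract_deriv ^^ l) f)))"
          by (simp add: sum_distrib_left)
        also have "\<dots> = (\<Sum>i<n. \<Sum>l<n. \<Sum>j\<le>J. h j * (x i * (c i j l * (fract_deriv ^^ l) f)))"
          by (subst sum.swap, rule sum.cong[OF refl], rule sum.swap)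
        also have "\<dots> = (\<Sum>i<n. \<Sum>l<n. x i * (\<Sum>j\<le>J. h j * c i j l) * (fract_deriv ^^ l) f)"
          by (simp add: sum_distrib_left sum_distrib_right mult_ac)
        also have "\<dots> = 0" by (simp add: hc)
        finally show ?thesis by simp
      qed
      moreover have "dop ?Y"
        by (intro dop_sum_op dop_mult dop_add Q dop_comp[of Q0, OF Q0(1) S_j])
      ultimately show "\<exists>Y. dop Y \<and> (\<forall>f. (\<Sum>j\<le>J. h j * X ((T ^^ j) f)) = Y (L f))" by blast
    qed
    then show ?thesis by blast
  qed
  then obtain g where g: "rel (LEAST J. \<exists>g. rel J g) g"
    using LeastI_ex[of "\<lambda>J. \<exists>g. rel J g"] by blast
  define J where "J = (LEAST J. \<exists>g. rel J g)"
  have relJ: "rel J g" using g by (simp add: J_def)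
  have least: "\<not> rel J' g'" if "J' < J" for J' g'
    using not_less_Least[of J' "\<lambda>J. \<exists>g. rel J g"] that by (auto simp: J_def)
  have der: "fract_deriv (g j) = 0" if "j \<le> J" for j
  proof (rule ccontr)
    assume ne: "fract_deriv (g j) \<noteq> 0"
    let ?A = "{j\<in>{..J}. fract_deriv (g j) \<noteq> 0}"
    define K where "K = Max ?A"
    have K: "K \<in> ?A" unfolding K_def by (rule Max_in) (use ne that in auto)
    have Kmax: "fract_deriv (g j) = 0" if "j \<le> J" "j > K" for j
      using Max_ge[of ?A j] that by (fold K_def) auto
    have "K \<noteq> J" using K relJ by (auto simp: rel_def)
    then have KJ: "K < J" using K by auto
    \<comment> \<open>Differentiating the relation for \<open>X\<close> and subtracting the one for
      \<open>fract_deriv (X f)\<close> leaves the coefficients \<open>fract_deriv (g j)\<close>. The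
      top one vanishes because \<open>g J = 1\<close>, so a shorter relation results.\<close>
    define h where "h j = fract_deriv (g j) / fract_deriv (g K)" for j
    have "rel K h"
      unfolding rel_def
    proof (intro conjI allI impI)
      show "h K = 1" using K by (simp add: h_def)
      fix X :: "'a diffop" assume X: "dop X"
      obtain Y1 where Y1: "dop Y1" "\<And>f. (\<Sum>j\<le>J. g j * X ((T ^^ j) f)) = Y1 (L f)"
        using relJ X by (auto simp: rel_def)
      obtain Y2 where Y2: "dop Y2" "\<And>f. (\<Sum>j\<le>J. g j * fract_deriv (X ((T ^^ j) f))) = Y2 (L f)"
        using relJ dop_comp[OF dop_deriv X] unfolding rel_def by blast
      let ?Y = "\<lambda>u. 1 / fract_deriv (g K) * (fract_deriv (Y1 u) - Y2 u)"
      have "(\<Sum>j\<le>K. h j * X ((T ^^ j) f)) = ?Y (L f)" for f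
      proof -
        have "(\<Sum>j\<le>K. fract_deriv (g j) * X ((T ^^ j) f)) = (\<Sum>j\<le>J. fract_deriv (g j) * X ((T ^^ j) f))"
          by (rule sum.mono_neutral_left) (use KJ Kmax in auto)
        also have "\<dots> = fract_deriv (Y1 (L f)) - Y2 (L f)"
          unfolding Y1(2)[symmetric] Y2(2)[symmetric]
          by (simp add: fract_deriv_sum fract_deriv_mult sum.distrib)
        finally show ?thesis by (simp add: h_def sum_divide_distrib[symmetric])
      qed
      moreover have "dop ?Y" by (intro dop_mult dop_diff dop_comp[OF dop_deriv] Y1 Y2)
      ultimately show "\<exists>Y. dop Y \<and> (\<forall>f. (\<Sum>j\<le>K. h j * X ((T ^^ j) f)) = Y (L f))" by blast
    qed
    then show False using least KJ by blast
  qed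
  have "\<forall>j. \<exists>c. j \<le> J \<longrightarrow> g j = constf c"
    using der fract_deriv_eq_0_imp_const by metis
  then obtain c where c: "\<And>j. j \<le> J \<Longrightarrow> g j = constf (c j)" by metis
  have "to_fract [:c J:] = to_fract [:1:]" using c[of J] relJ by (simp add: rel_def flip: one_pCons)
  then have "c J = 1" by (simp only: to_fract_eq_iff pCons_eq_iff)
  moreover obtain Y where "dop Y" "\<And>f. (\<Sum>j\<le>J. g j * (T ^^ j) f) = Y (L f)"
    using relJ dop_id unfolding rel_def by blast
  ultimately show ?thesis using that[of c J Y] c by simp
qed

lemma mult_in_Diff_0: "g \<noteq> 0 \<Longrightarrow> (\<lambda>f. g * f) \<in> Diff 0"
  unfolding Diff_iff_oplead by (intro exI[of _ g] conjI oplead_0I)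

definition op_poly :: "'a::{field_char_0,field_gcd} poly \<Rightarrow> 'a diffop \<Rightarrow> 'a diffop" where
  "op_poly \<psi> T f = (\<Sum>j\<le>degree \<psi>. constf (coeff \<psi> j) * (T ^^ j) f)"

lemma op_poly_le: "degree \<psi> \<le> N \<Longrightarrow> op_poly \<psi> T f = (\<Sum>j\<le>N. constf (coeff \<psi> j) * (T ^^ j) f)"
  unfolding op_poly_def by (rule sum.mono_neutral_left) (auto simp: coeff_eq_0)

lemma constf_mult: "constf (a * b) = constf a * constf b"
  unfolding to_fract_mult[symmetric] by simp

lemma to_fract_smult: "to_fract (smult a u) = constf a * to_fract u"
  unfolding to_fract_mult[symmetric] by simp

lemma constf_diff: "constf (a - b) = constf a - constf b"
  unfolding to_fract_diff[symmetric] by simp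

lemma constf_add: "constf (a + b) = constf a + constf b"
  unfolding to_fract_add[symmetric] by simp

lemma op_poly_root_mult:
  assumes "dop T"
  shows "op_poly ([:- l, 1:] * \<psi>) T f = op_poly \<psi> T (T f - constf l * f)"
proof -
  have Tj: "dop (T ^^ j)" for j using assms by (rule dop_funpow)
  have deg: "degree ([:- l, 1:] * \<psi>) \<le> Suc (degree \<psi>)"
    using degree_mult_le[of "[:- l, 1:]" \<psi>] by simp
  have co: "coeff ([:- l, 1:] * \<psi>) j = coeff (pCons 0 \<psi>) j - l * coeff \<psi> j" for j
    by simp
  have "op_poly ([:- l, 1:] * \<psi>) T f
     = (\<Sum>j\<le>Suc (degree \<psi>). constf (coeff (pCons 0 \<psi>) j) * (T ^^ j) f)
      - (\<Sum>j\<le>Suc (degree \<psi>). constf l * constf (coeff \<psi> j) * (T ^^ j) f)"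
    unfolding op_poly_le[OF deg] co constf_diff constf_mult left_diff_distrib sum_subtractf ..
  also have "(\<Sum>j\<le>Suc (degree \<psi>). constf (coeff (pCons 0 \<psi>) j) * (T ^^ j) f)
    = (\<Sum>j\<le>degree \<psi>. constf (coeff \<psi> j) * (T ^^ j) (T f))"
    by (simp only: sum.atMost_Suc_shift) (simp add: funpow_swap1)
  also have "(\<Sum>j\<le>Suc (degree \<psi>). constf l * constf (coeff \<psi> j) * (T ^^ j) f)
     = (\<Sum>j\<le>degree \<psi>. constf (coeff \<psi> j) * (T ^^ j) (constf l * f))"
    by (simp add: coeff_eq_0 dop_cmult[OF Tj]) (simp add: mult_ac)
  finally show ?thesis
    by (simp add: op_poly_def dop_minus[OF Tj] right_diff_distrib sum_subtractf)
qed

lemma dop_op_poly: "dop T \<Longrightarrow> dop (op_poly \<psi> T)"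
  unfolding op_poly_def[abs_def] by (intro dop_sum_op dop_mult dop_funpow)

text \<open>The relation \<open>X (T - l) = Y L\<close> with \<open>X\<close> of lower order than \<open>L\<close> expresses that
  \<open>L\<close> and \<open>T - l\<close> are not right coprime.\<close>

lemma intertwiner_common_multiple:
  fixes L :: "complex diffop"
  assumes L: "L \<in> Diff n" and n: "n > 0" and T: "dop T" and S: "dop S"
    and LT: "\<And>f. L (T f) = S (L f)"
  obtains l X Y where "dop Y" "ordlt n X" "X \<noteq> (\<lambda>f. 0)"
    "\<And>f. X (T f - constf l * f) = Y (L f)"
proof -
  \<comment> \<open>The polynomials in \<open>T\<close> that are left multiples of \<open>L\<close>;
    an element of least degree acts as a minimal polynomial.\<close>
  define P where "P \<psi> \<longleftrightarrow> \<psi> \<noteq> 0 \<and> (\<exists>Y. dop Y \<and> (\<forall>f. op_poly \<psi> T f = Y (L f)))" for \<psi>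
  have dL: "dop L" using L by (rule Diff_imp_dop)
  obtain J c Y0 where c: "c J = 1" "dop Y0" "\<And>f. (\<Sum>j\<le>J. constf (c j) * (T ^^ j) f) = Y0 (L f)"
    by (rule intertwiner_annihilator[OF L T S LT]) (rule that)
  define \<psi>0 where "\<psi>0 = (\<Sum>j\<le>J. monom (c j) j)"
  have co: "coeff \<psi>0 j = (if j \<le> J then c j else 0)" for j
    by (simp add: \<psi>0_def coeff_sum)
  have deg: "degree \<psi>0 \<le> J" by (rule degree_le) (simp add: co)
  have "op_poly \<psi>0 T f = Y0 (L f)" for f
    unfolding op_poly_le[OF deg] c(3)[symmetric] by (rule sum.cong) (auto simp: co)
  moreover have "\<psi>0 \<noteq> 0" using c(1) co[of J] by auto
  ultimately have "P \<psi>0" using c(2) by (auto simp: P_def)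
  then obtain \<psi> where \<psi>: "P \<psi>" "\<And>\<phi>. P \<phi> \<Longrightarrow> degree \<psi> \<le> degree \<phi>"
    using ex_has_least_nat[of P \<psi>0 degree] by blast
  have "degree \<psi> \<noteq> 0"
  proof
    assume "degree \<psi> = 0"
    then obtain a where a: "\<psi> = [:a:]" by (meson degree_eq_zeroE)
    with \<psi>(1) obtain Y where Y: "a \<noteq> 0" "dop Y" "\<And>f. constf a * f = Y (L f)"
      by (auto simp: P_def op_poly_def)
    have "(\<lambda>f. constf a * f) \<in> Diff 0"
      using Y(1) by (intro mult_in_Diff_0) simp
    then have "n \<le> 0" by (rule Diff_quotient(1)[OF _ L Y(2)]) (simp add: Y(3))
    with n show False by simp
  qed
  \<comment> \<open>Algebraic closedness is used here. By minimality of \<open>\<psi>\<close>, the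
    cofactor \<open>\<phi>\<close> is not in \<open>P\<close>, so its remainder \<open>X\<close>
    modulo \<open>L\<close> is nonzero.\<close>
  then obtain l where "poly \<psi> l = 0"
    using fundamental_theorem_of_algebra[of \<psi>] constant_degree[of \<psi>] by auto
  then obtain \<phi> where \<phi>: "\<psi> = [:- l, 1:] * \<phi>" by (metis dvdE poly_eq_0_iff_dvd)
  with \<psi>(1) have "\<phi> \<noteq> 0" unfolding P_def by force
  then have "degree \<psi> = Suc (degree \<phi>)" unfolding \<phi> by (subst degree_mult_eq) auto
  then have "\<not> P \<phi>" using \<psi>(2) by fastforce
  obtain Q X where Q: "dop Q" "ordlt n X" "\<And>f. op_poly \<phi> T f = Q (L f) + X f"
    by (rule op_division[OF L dop_op_poly[OF T]]) (rule that)
  have X0: "X \<noteq> (\<lambda>f. 0)"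
  proof
    assume "X = (\<lambda>f. 0)"
    with Q have "P \<phi>" using \<open>\<phi> \<noteq> 0\<close> by (auto simp: P_def)
    with \<open>\<not> P \<phi>\<close> show False by simp
  qed
  obtain Y where Y: "dop Y" "\<And>f. op_poly \<psi> T f = Y (L f)" using \<psi>(1) by (auto simp: P_def)
  \<comment> \<open>Multiplying \<open>\<phi>(T) = Q L + X\<close> by \<open>T - l\<close> on the
    right gives \<open>\<psi>(T) = Y L\<close>, and \<open>L (T - l) = (S - l) L\<close> turns the
    quotient part into a left multiple of \<open>L\<close>.\<close>
  let ?Y = "\<lambda>u. Y u - (Q (S u) - constf l * Q u)"
  have "X (T f - constf l * f) = ?Y (L f)" for f
  proof -
    have "op_poly \<psi> T f = Q (L (T f - constf l * f)) + X (T f - constf l * f)"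
      unfolding \<phi> op_poly_root_mult[OF T] by (rule Q(3))
    moreover have "Q (L (T f - constf l * f)) = Q (S (L f)) - constf l * Q (L f)"
      by (simp add: dop_minus[OF dL] dop_cmult[OF dL] dop_minus[OF Q(1)] dop_cmult[OF Q(1)] LT)
    ultimately show ?thesis by (simp add: Y(2) algebra_simps)
  qed
  moreover have "dop ?Y" by (intro dop_diff dop_mult dop_comp[OF Q(1) S] Y Q)
  ultimately show ?thesis using that[of ?Y X l] Q(2) X0 by blast
qed

lemma ordlt_Diff_less: "ordlt m T \<Longrightarrow> T \<in> Diff n \<Longrightarrow> n < m"
proof (rule ccontr)
  assume *: "ordlt m T" "T \<in> Diff n" "\<not> n < m"
  from * obtain x where x: "x \<noteq> 0" "oplead n x T" by (auto simp: Diff_iff_oplead)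
  have "oplead n 0 T" using ordlt_less[OF *(1), of n] *(3) by simp
  then have "oplead n (x - 0) (\<lambda>f. T f - T f)" by (rule oplead_diff[OF x(2)])
  then show False using x(1) oplead_zero_imp by force
qed

lemma Diff_shift:
  assumes "T \<in> Diff n" "n > 0" shows "(\<lambda>f. T f + g * f) \<in> Diff n"
proof -
  from assms obtain x where x: "x \<noteq> 0" "oplead n x T" by (auto simp: Diff_iff_oplead)
  have "oplead n (x + 0) (\<lambda>f. T f + g * f)"
    by (rule oplead_add[OF x(2) oplead_less[OF oplead_0I assms(2)]])
  with x(1) show ?thesis by (auto simp: Diff_iff_oplead)
qed

section \<open>Darboux transformations and descent on the order of an intertwiner\<close>

lemma rational_darboux_sym: "rational_darboux T S \<Longrightarrow> rational_darboux S T"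
  unfolding rational_darboux_def by blast

lemma rational_darboux_Diff:
  assumes "rational_darboux T S" shows "T \<in> Diff 2" "S \<in> Diff 2"
proof -
  have "T \<in> Diff 2" if "rational_darboux T S" for T S
  proof -
    from that obtain A B l where AB: "A \<in> Diff 1" "B \<in> Diff 1" "T = (\<lambda>f. B (A f) + constf l * f)"
      by (auto simp: rational_darboux_def)
    show ?thesis unfolding AB(3)
      using Diff_shift[OF Diff_comp[OF AB(2,1)]] by (simp add: numeral_2_eq_2)
  qed
  with assms rational_darboux_sym show "T \<in> Diff 2" "S \<in> Diff 2" by blast+
qed

text \<open>Replacing the factors by \<open>inverse g * B\<close> and \<open>A g\<close> leaves
  \<open>A B\<close> unchanged but conjugates \<open>B A\<close> by \<open>g\<close>. Thus a gauge
  transformation of \<open>S\<close> is two Darboux steps, through \<open>S'\<close>.\<close>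

lemma rational_darboux_gauge:
  assumes "rational_darboux S S'" "g \<noteq> 0"
  shows "rational_darboux S' (\<lambda>f. inverse g * S (g * f))"
proof -
  from assms(1) obtain A B l where AB: "A \<in> Diff 1" "B \<in> Diff 1"
    "S = (\<lambda>f. B (A f) + constf l * f)" "S' = (\<lambda>f. A (B f) + constf l * f)"
    by (auto simp: rational_darboux_def)
  have "(\<lambda>f. inverse g * B f) \<in> Diff 1" using Diff_comp[OF mult_in_Diff_0 AB(2)] assms(2) by simp
  moreover have "(\<lambda>f. A (g * f)) \<in> Diff 1" using Diff_comp[OF AB(1) mult_in_Diff_0] assms(2) by simp
  moreover have "S' = (\<lambda>f. A (g * (inverse g * B f)) + constf l * f)"
    using assms(2) by (simp add: AB(4) flip: mult.assoc)
  moreover have "(\<lambda>f. inverse g * S (g * f)) = (\<lambda>f. inverse g * B (A (g * f)) + constf l * f)"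
    using assms(2) by (auto simp: AB(3) field_simps)
  ultimately show ?thesis unfolding rational_darboux_def by (intro bexI exI conjI)
qed

text \<open>Induction on the order of \<open>L\<close>. The partner \<open>S'\<close> serves order
  0: there \<open>L\<close> is multiplication by some \<open>g\<close>, \<open>T\<close> is a gauge
  transform of \<open>S\<close>, and the path runs from \<open>T\<close> through \<open>S'\<close>
  to \<open>S\<close>.\<close>

theorem intertwined_imp_darboux_connected:
  fixes L :: "complex diffop"
  assumes "L \<in> Diff n" "T \<in> Diff 2" "\<And>f. L (T f) = S (L f)" "rational_darboux S S'"
  shows "rational_darboux\<^sup>*\<^sup>* T S"
  using assms(1-3)
proof (induction n arbitrary: L T rule: less_induct)
  case (less n L T)
  have S: "S \<in> Diff 2" using assms(4) by (rule rational_darboux_Diff)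
  have dT: "dop T" "dop S" "dop L" using less.prems S by (auto intro: Diff_imp_dop)
  show ?case
  proof (cases "n = 0")
    case True
    with less.prems(1) obtain g where g: "g \<noteq> 0" "L = (\<lambda>f. g * f)"
      by (auto simp: Diff_iff_oplead dest: oplead_0D)
    have "T f = inverse g * S (g * f)" for f
      using less.prems(3)[of f] g by (simp add: field_simps)
    then have T: "T = (\<lambda>f. inverse g * S (g * f))" by (rule ext)
    have "rational_darboux S' T" unfolding T using assms(4) g(1) by (rule rational_darboux_gauge)
    then have "rational_darboux T S'" "rational_darboux S' S" using assms(4) by (auto intro: rational_darboux_sym)
    then show ?thesis by (auto intro: converse_rtranclp_into_rtranclp)
  next
    case False
    obtain l X Y where XY: "dop Y" "ordlt n X" "X \<noteq> (\<lambda>f. 0)" "\<And>f. X (T f - constf l * f) = Y (L f)"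
      by (rule intertwiner_common_multiple[OF less.prems(1) _ dT(1,2) less.prems(3)])
        (use False in simp, rule that)
    define Tl where "Tl = (\<lambda>f. T f - constf l * f)"
    have Tl: "Tl \<in> Diff 2" using Diff_shift[OF less.prems(2), of "- constf l"] by (simp add: Tl_def)
    have dTl: "dop Tl" using Tl by (rule Diff_imp_dop)
    have dX: "dop X" using XY(2) by (auto simp: dop_def)
    obtain k where k: "X \<in> Diff k" using dX XY(3) by (auto elim: dop_cases)
    have kn: "k < n" using XY(2) k by (rule ordlt_Diff_less)
    have "(\<lambda>f. X (Tl f)) \<in> Diff (k + 2)" using k Tl by (rule Diff_comp)
    from Diff_quotient[OF this less.prems(1) XY(1)]
    have Y: "n \<le> k + 2" "Y \<in> Diff (k + 2 - n)" by (auto simp: Tl_def XY(4))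
    \<comment> \<open>The remainder \<open>R\<close> turns out to be either zero or the common right
      factor of order 1.\<close>
    obtain Q R where QR: "dop Q" "ordlt 2 R" "\<And>f. L f = Q (Tl f) + R f"
      by (rule op_division[OF Tl dT(3)]) (rule that)
    have dR: "dop R" using QR(2) by (auto simp: dop_def)
    from dR show ?thesis
    proof (cases rule: dop_cases)
      case 1
      have LQ: "L = (\<lambda>f. Q (Tl f))" using QR(3) 1 by auto
      from Diff_quotient[OF less.prems(1) Tl QR(1) this]
      have "2 \<le> n" "Q \<in> Diff (n - 2)" by auto
      have "(\<lambda>f. Q (T f) - S (Q f)) = (\<lambda>f. 0)"
      proof (rule dop_cancel[OF _ Tl])
        show "dop (\<lambda>f. Q (T f) - S (Q f))" by (intro dop_diff dop_comp[OF QR(1) dT(1)] dop_comp[OF dT(2) QR(1)])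
        fix f
        have "T (Tl f) = Tl (T f)" by (simp add: Tl_def dop_minus[OF dT(1)] dop_cmult[OF dT(1)])
        then show "Q (T (Tl f)) - S (Q (Tl f)) = 0" using less.prems(3)[of f] by (simp add: LQ)
      qed
      then have "Q (T f) = S (Q f)" for f by (metis eq_iff_diff_eq_0)
      then show ?thesis using less.IH[OF _ \<open>Q \<in> Diff (n - 2)\<close> less.prems(2)] \<open>2 \<le> n\<close> by simp
    next
      case (2 i)
      \<comment> \<open>Inserting \<open>L = Q Tl + R\<close> into \<open>X Tl = Y L\<close> gives
        \<open>(X - Y Q) Tl = Y R\<close>.\<close>
      let ?h = "\<lambda>f. X f - Y (Q f)"
      have h: "?h (Tl f) = Y (R f)" for f
        using XY(4)[of f] by (simp add: QR(3) dop_plus[OF XY(1)] flip: Tl_def)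
          (simp add: Tl_def)
      have "dop ?h" by (intro dop_diff dX dop_comp[OF XY(1) QR(1)])
      from Diff_quotient[OF Diff_comp[OF Y(2) 2] Tl this]
      have hd: "2 \<le> k + 2 - n + i" "?h \<in> Diff (k + 2 - n + i - 2)" by (auto simp: h)
      have "i < 2" using QR(2) 2 by (rule ordlt_Diff_less)
      \<comment> \<open>\<open>Y\<close> and \<open>R\<close> have order at most 1, while
        \<open>Y R\<close> is a nonzero left multiple of the second-order \<open>Tl\<close>. So both
        have order exactly 1 and \<open>?h\<close> is multiplication by a function.\<close>
      with hd(1) kn Y(1) have i: "i = 1" "k + 2 - n = 1" by auto
      with hd(2) obtain g where g: "g \<noteq> 0" "\<And>f. ?h f = g * f"
        by (auto simp: Diff_iff_oplead fun_eq_iff dest!: oplead_0D)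
      define B where "B = (\<lambda>f. inverse g * Y f)"
      have R1: "R \<in> Diff 1" using 2 i by simp
      have "(\<lambda>f. inverse g * f) \<in> Diff 0"
        using g by (intro mult_in_Diff_0) simp
      from Diff_comp[OF this Y(2)] have B: "B \<in> Diff 1" using i by (simp add: B_def)
      have dB: "dop B" using B by (rule Diff_imp_dop)
      have TlB: "Tl f = B (R f)" for f using h[of f] g by (simp add: B_def field_simps)
      define T1 where "T1 = (\<lambda>f. R (B f) + constf l * f)"
      have TB: "T = (\<lambda>f. B (R f) + constf l * f)" using TlB by (auto simp: Tl_def fun_eq_iff algebra_simps)
      have darb: "rational_darboux T T1"
        unfolding rational_darboux_def T1_def using TB R1 B by blast
      \<comment> \<open>With \<open>Tl = B R\<close>, the operator \<open>L = Q B R + R\<close>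
        factors as \<open>M R\<close>; the left factor has order \<open>n - 1\<close> and
        intertwines \<open>T1\<close> with \<open>S\<close>.\<close>
      define M where "M = (\<lambda>f. Q (B f) + f)"
      have dM: "dop M" unfolding M_def by (intro dop_add dop_comp[OF QR(1) dB] dop_id)
      have LM: "L = (\<lambda>f. M (R f))" by (auto simp: M_def QR(3) TlB)
      have M: "1 \<le> n" "M \<in> Diff (n - 1)" using Diff_quotient[OF less.prems(1) R1 dM LM] by auto
      have dT1: "dop T1" using rational_darboux_Diff(2)[OF darb] by (rule Diff_imp_dop)
      have "(\<lambda>f. M (T1 f) - S (M f)) = (\<lambda>f. 0)"
      proof (rule dop_cancel[OF _ R1])
        show "dop (\<lambda>f. M (T1 f) - S (M f))"
          by (intro dop_diff dop_comp[OF dM dT1] dop_comp[OF dT(2) dM])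
        fix f
        have "T1 (R f) = R (T f)" by (simp add: T1_def TB dop_plus[OF dR] dop_cmult[OF dR])
        then show "M (T1 (R f)) - S (M (R f)) = 0" using less.prems(3)[of f] by (simp add: LM)
      qed
      then have "M (T1 f) = S (M f)" for f by (metis eq_iff_diff_eq_0)
      then have "rational_darboux\<^sup>*\<^sup>* T1 S"
        using less.IH[OF _ M(2) rational_darboux_Diff(2)[OF darb]] M(1) by simp
      with darb show ?thesis by (rule converse_rtranclp_into_rtranclp)
    qed
  qed
qed

lemma darboux_connected_sym: "rational_darboux\<^sup>*\<^sup>* T S \<Longrightarrow> rational_darboux\<^sup>*\<^sup>* S T"
  by (induction rule: rtranclp_induct)
    (auto intro: converse_rtranclp_into_rtranclp rational_darboux_sym)

lemma factorization_chainI: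
  assumes "rational_darboux\<^sup>*\<^sup>* T S" "T \<in> Diff 2"
  shows "factorization_chain T S"
  using assms(1)
proof (induction rule: rtranclp_induct)
  case base
  then show ?case unfolding factorization_chain_def using assms(2)
    by (intro exI[of _ 0] exI[of _ "\<lambda>_. T"]) auto
next
  case (step S S')
  then obtain n Ts where Ts: "Ts 0 = T" "Ts n = S" "\<forall>i\<le>n. Ts i \<in> Diff 2"
    "\<forall>i<n. rational_darboux (Ts i) (Ts (Suc i))"
    unfolding factorization_chain_def by blast
  show ?case unfolding factorization_chain_def
    by (rule exI[of _ "Suc n"], rule exI[of _ "Ts(Suc n := S')"])
      (use Ts step.hyps(2) rational_darboux_Diff in \<open>auto simp: less_Suc_eq le_Suc_eq\<close>)
qed

section \<open>Behaviour at infinity\<close>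

lemma coeff_mult_le:
  fixes u v :: "'a::idom poly"
  assumes "degree u \<le> a" "degree v \<le> b"
  shows "coeff (u * v) (a + b) = coeff u a * coeff v b"
proof (cases "degree u = a \<and> degree v = b")
  case True
  then show ?thesis using coeff_mult_degree_sum[of u v] by simp
next
  case False
  then have "degree (u * v) < a + b" using assms degree_mult_le[of u v] by linarith
  moreover have "coeff u a = 0 \<or> coeff v b = 0" using False assms by (auto intro: coeff_eq_0)
  ultimately show ?thesis by (auto simp: coeff_eq_0)
qed

text \<open>The falling factorial \<open>x (x - 1) ... (x - i + 1)\<close>, with factors in
  increasing order to match \<open>pochhammer\<close>.\<close>

definition ffact_poly :: "nat \<Rightarrow> 'a::field_char_0 poly" where
  "ffact_poly i = (\<Prod>j<i. [:1 - of_nat i + of_nat j, 1:])"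

lemma degree_ffact_poly: "degree (ffact_poly i) = i"
  unfolding ffact_poly_def by (subst degree_prod_eq_sum_degree) auto

lemma coeff_higher_pderiv_lead:
  fixes u :: "'a::field_char_0 poly"
  assumes "i \<le> degree u"
  shows "coeff ((pderiv ^^ i) u) (degree u - i) = lead_coeff u * poly (ffact_poly i) (of_nat (degree u))"
proof -
  have "pochhammer (of_nat (Suc (degree u - i))) i = poly (ffact_poly i) (of_nat (degree u) :: 'a)"
    unfolding ffact_poly_def poly_prod pochhammer_prod lessThan_atLeast0
    using assms by (intro prod.cong) (auto simp: of_nat_diff algebra_simps)
  then show ?thesis using assms by (simp add: coeff_higher_pderiv)
qed

definition poly_op :: "nat \<Rightarrow> (nat \<Rightarrow> 'a::field_char_0 poly) \<Rightarrow> 'a poly \<Rightarrow> 'a poly" where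
  "poly_op n c u = (\<Sum>i\<le>n. c i * (pderiv ^^ i) u)"

text \<open>The hypothesis bounds the degree shift of each term by \<open>s - n\<close>. The factor
  of \<open>lead_coeff u\<close> is the indicial polynomial at infinity; the case distinction avoids
  truncated subtraction in indices where \<open>c i\<close> vanishes.\<close>

lemma coeff_poly_op:
  fixes c :: "nat \<Rightarrow> 'a::field_char_0 poly"
  assumes c: "\<And>i. i \<le> n \<Longrightarrow> c i \<noteq> 0 \<Longrightarrow> degree (c i) + n \<le> s + i" and u: "n \<le> degree u"
  shows "coeff (poly_op n c u) (degree u + s - n) = lead_coeff u *
    (\<Sum>i\<le>n. (if n \<le> s + i then coeff (c i) (s + i - n) else 0) * poly (ffact_poly i) (of_nat (degree u)))"
  unfolding poly_op_def coeff_sum sum_distrib_left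
proof (rule sum.cong)
  fix i assume "i \<in> {..n}"
  then have i: "i \<le> n" by simp
  show "coeff (c i * (pderiv ^^ i) u) (degree u + s - n) = lead_coeff u *
    ((if n \<le> s + i then coeff (c i) (s + i - n) else 0) * poly (ffact_poly i) (of_nat (degree u)))"
  proof (cases "n \<le> s + i")
    case True
    then have e: "degree u + s - n = (s + i - n) + (degree u - i)" using i u by simp
    have "degree (c i) \<le> s + i - n" using c[OF i] True by (cases "c i = 0") auto
    then have "coeff (c i * (pderiv ^^ i) u) (degree u + s - n)
      = coeff (c i) (s + i - n) * coeff ((pderiv ^^ i) u) (degree u - i)"
      unfolding e by (rule coeff_mult_le) (simp add: degree_higher_pderiv)
    then show ?thesis using True i u by (simp add: coeff_higher_pderiv_lead)
  next
    case False
    then have "c i = 0" using c[OF i] by linarith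
    with False show ?thesis by simp
  qed
qed simp

lemma poly_eq_0_of_nat:
  fixes P :: "'a::field_char_0 poly"
  assumes "infinite A" "\<And>k. k \<in> A \<Longrightarrow> poly P (of_nat k) = 0"
  shows "P = 0"
proof (rule ccontr)
  assume "P \<noteq> 0"
  then have "finite {x. poly P x = 0}" by (rule poly_roots_finite)
  then have "finite (of_nat ` A :: 'a set)" by (rule finite_subset[rotated]) (use assms(2) in auto)
  then show False using assms(1) by (simp add: finite_image_iff inj_on_def)
qed

text \<open>Falling factorials have pairwise distinct degrees, hence are linearly independent, and a
  polynomial with infinitely many roots is zero.\<close>

lemma ffact_combination_zero:
  fixes a :: "nat \<Rightarrow> 'a::field_char_0"
  assumes "infinite A" "\<And>k. k \<in> A \<Longrightarrow> (\<Sum>i\<le>n. a i * poly (ffact_poly i) (of_nat k)) = 0" "i \<le> n"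
  shows "a i = 0"
proof (rule ccontr)
  assume ai: "a i \<noteq> 0"
  let ?P = "\<Sum>i\<le>n. smult (a i) (ffact_poly i)"
  define m where "m = Max {i\<in>{..n}. a i \<noteq> 0}"
  have m: "m \<in> {i\<in>{..n}. a i \<noteq> 0}" unfolding m_def by (rule Max_in) (use ai assms(3) in auto)
  have mmax: "a j = 0" if "j \<le> n" "j > m" for j
    using Max_ge[of "{i\<in>{..n}. a i \<noteq> 0}" j] that by (fold m_def) auto
  have "coeff ?P m = (\<Sum>i\<le>n. if i = m then a m else 0)"
    unfolding coeff_sum
  proof (rule sum.cong)
    fix i assume "i \<in> {..n}"
    have lc: "coeff (ffact_poly m :: 'a poly) m = 1"
      using lead_coeff_prod[of "\<lambda>j. [:1 - of_nat m + of_nat j, 1:] :: 'a poly" "{..<m}"]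
      by (simp add: degree_ffact_poly flip: ffact_poly_def)
    show "coeff (smult (a i) (ffact_poly i)) m = (if i = m then a m else 0)"
      using mmax[of i] \<open>i \<in> {..n}\<close> lc
      by (cases i m rule: linorder_cases) (auto simp: coeff_eq_0 degree_ffact_poly)
  qed simp
  also have "\<dots> \<noteq> 0" using m by simp
  finally have "?P \<noteq> 0" by auto
  moreover have "?P = 0"
    by (rule poly_eq_0_of_nat[OF assms(1)]) (use assms(2) in \<open>simp add: poly_sum\<close>)
  ultimately show False by simp
qed

lemma to_fract_den_mult: "to_fract (den f) * f = to_fract (num f)" for f :: "'a::field_gcd poly fract"
proof -
  have "to_fract (num f) / to_fract (den f) = f"
    by (metis Fract_conv_to_fract Fract_quot_of_fract)
  then show ?thesis by (simp add: nonzero_divide_eq_eq mult.commute)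
qed

lemma smult_sum_right: "smult a (\<Sum>i\<in>A. f i) = (\<Sum>i\<in>A. smult a (f i))"
  by (induction A rule: infinite_finite_induct) (simp_all add: smult_add_right)

lemma common_denominator:
  fixes x :: "nat \<Rightarrow> 'a::field_gcd poly fract"
  obtains g c where "g \<noteq> 0" "\<And>i. i \<le> n \<Longrightarrow> to_fract g * x i = to_fract (c i)"
proof (rule that[of "\<Prod>i\<le>n. den (x i)" "\<lambda>i. num (x i) * (\<Prod>j\<in>{..n} - {i}. den (x j))"])
  let ?g = "\<Prod>i\<le>n. den (x i)"
  show "?g \<noteq> 0" by simp
  fix i assume i: "i \<le> n"
  have "?g = den (x i) * (\<Prod>j\<in>{..n} - {i}. den (x j))" using i by (simp add: prod.remove)
  then show "to_fract ?g * x i = to_fract (num (x i) * (\<Prod>j\<in>{..n} - {i}. den (x j)))"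
    by (simp only: to_fract_mult flip: to_fract_den_mult) (simp only: mult_ac)
qed

text \<open>After clearing denominators, the indicial polynomial at infinity for the largest degree
  shift would vanish at every large \<open>k\<close> in \<open>A\<close>. All its coefficients would
  then be zero, although the term \<open>m\<close> attaining the shift contributes a leading
  coefficient.\<close>

lemma dop_vanishing_infinite:
  fixes T :: "'a::{field_char_0,field_gcd} diffop"
  assumes T: "dop T" and "infinite A"
    and y: "\<And>k. k \<in> A \<Longrightarrow> degree (y k) = k" "\<And>k. k \<in> A \<Longrightarrow> y k \<noteq> 0"
    and Ty: "\<And>k. k \<in> A \<Longrightarrow> T (to_fract (y k)) = 0"
  shows "T = (\<lambda>f. 0)"
proof -
  obtain n where "ordlt n T" using T by (auto simp: dop_def)
  then have "oplead n 0 T" by (simp add: ordlt_iff_oplead_0)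
  then obtain x where x: "T = (\<lambda>f. \<Sum>i\<le>n. x i * (fract_deriv ^^ i) f)" by (auto simp: oplead_def)
  obtain g c where g: "g \<noteq> 0" "\<And>i. i \<le> n \<Longrightarrow> to_fract g * x i = to_fract (c i)"
    by (rule common_denominator[where n = n and x = x]) (rule that)
  have Tu: "to_fract g * T (to_fract u) = to_fract (poly_op n c u)" for u
    unfolding x poly_op_def sum_distrib_left to_fract_sum
    by (rule sum.cong) (auto simp: funpow_fract_deriv_to_fract g(2) simp flip: mult.assoc)
  have op0: "poly_op n c (y k) = 0" if "k \<in> A" for k
    using Tu[of "y k"] Ty[OF that] by simp
  have "c i = 0" if i: "i \<le> n" for i
  proof (rule ccontr)
    assume ci: "c i \<noteq> 0"
    let ?S = "(\<lambda>i. degree (c i) + (n - i)) ` {i\<in>{..n}. c i \<noteq> 0}"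
    define s where "s = Max ?S"
    have "s \<in> ?S" unfolding s_def by (rule Max_in) (use ci i in auto)
    then obtain m where m: "m \<le> n" "c m \<noteq> 0" "s = degree (c m) + (n - m)" by auto
    have s: "degree (c j) + n \<le> s + j" if "j \<le> n" "c j \<noteq> 0" for j
      using Max_ge[of ?S "degree (c j) + (n - j)"] that by (fold s_def) auto
    define a where "a i = (if n \<le> s + i then coeff (c i) (s + i - n) else 0)" for i
    have "a m = 0"
    proof (rule ffact_combination_zero[where A = "A - {..<n}" and a = a and i = m])
      show "infinite (A - {..<n})" using assms(2) by simp
      fix k assume k: "k \<in> A - {..<n}"
      then have yk: "degree (y k) = k" "lead_coeff (y k) \<noteq> 0" "n \<le> degree (y k)"
        using y[of k] by (auto simp del: leading_coeff_0_iff simp: leading_coeff_0_iff[symmetric])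
      have "lead_coeff (y k) * (\<Sum>i\<le>n. a i * poly (ffact_poly i) (of_nat (degree (y k)))) = 0"
        using coeff_poly_op[of n c s "y k", OF s yk(3)] op0[of k] k by (simp add: a_def)
      then show "(\<Sum>i\<le>n. a i * poly (ffact_poly i) (of_nat k)) = 0"
        using yk by simp
    qed (rule m)
    then show False using m by (auto simp: m(3) a_def)
  qed
  then have "T (to_fract u) = 0" for u using Tu[of u] g(1) by (simp add: poly_op_def)
  then show ?thesis using T by (intro dop_eq_0I)
qed

section \<open>Eigenpolynomial systems with finitely many missing degrees\<close>

text \<open>The field is arbitrary of characteristic 0 so that the results apply both to the real
  system and to its complexification.\<close>

locale eigensystem =
  fixes p q r :: "'a::{field_char_0,field_gcd} poly fract" and K :: "nat set"
    and y :: "nat \<Rightarrow> 'a poly" and ev :: "nat \<Rightarrow> 'a"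
  assumes p_nz: "p \<noteq> 0" and finite_K: "finite K"
    and deg_y: "\<And>k. k \<notin> K \<Longrightarrow> degree (y k) = k"
    and y_nz: "\<And>k. k \<notin> K \<Longrightarrow> y k \<noteq> 0"
    and eigen: "\<And>k. k \<notin> K \<Longrightarrow> diffop2 p q r (to_fract (y k)) = constf (ev k) * to_fract (y k)"
begin

abbreviation "T \<equiv> diffop2 p q r"

lemma dop_T: "dop T" by (rule dop_diffop2)

definition U :: "'a poly set" where
  "U = {w. \<exists>n b. w = (\<Sum>i\<in>{..n} - K. smult (b i) (y i))}"

lemma U_extend:
  assumes "n \<le> m"
  shows "\<exists>b'. (\<Sum>i\<in>{..n} - K. smult (b i) (y i)) = (\<Sum>i\<in>{..m} - K. smult (b' i) (y i))"
  by (rule exI[of _ "\<lambda>i. if i \<le> n then b i else 0"], rule sum.mono_neutral_cong_left)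
    (use assms in auto)

lemma U_add: assumes "u \<in> U" "v \<in> U" shows "u + v \<in> U"
proof -
  from assms obtain n b m c where u: "u = (\<Sum>i\<in>{..n} - K. smult (b i) (y i))"
    and v: "v = (\<Sum>i\<in>{..m} - K. smult (c i) (y i))" by (auto simp: U_def)
  obtain b' c' where "u = (\<Sum>i\<in>{..max n m} - K. smult (b' i) (y i))"
    "v = (\<Sum>i\<in>{..max n m} - K. smult (c' i) (y i))"
    unfolding u v using U_extend[of n "max n m" b] U_extend[of m "max n m" c] by auto
  then have "u + v = (\<Sum>i\<in>{..max n m} - K. smult (b' i + c' i) (y i))"
    by (simp add: sum.distrib smult_add_left)
  then show ?thesis unfolding U_def mem_Collect_eq by (intro exI)
qed

lemma U_smult: assumes "u \<in> U" shows "smult a u \<in> U"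
proof -
  from assms obtain n b where u: "u = (\<Sum>i\<in>{..n} - K. smult (b i) (y i))" by (auto simp: U_def)
  have "smult a u = (\<Sum>i\<in>{..n} - K. smult (a * b i) (y i))" by (simp add: u smult_sum_right)
  then show ?thesis unfolding U_def mem_Collect_eq by (intro exI)
qed

lemma U_0: "0 \<in> U"
  unfolding U_def by (auto intro!: exI[of _ "\<lambda>_. 0"])

lemma U_sum: "(\<And>i. i \<in> A \<Longrightarrow> w i \<in> U) \<Longrightarrow> (\<Sum>i\<in>A. w i) \<in> U"
  by (induction A rule: infinite_finite_induct) (auto intro: U_0 U_add)

lemma y_in_U: assumes "k \<notin> K" shows "y k \<in> U"
proof -
  have "(\<Sum>i\<in>{..k} - K. smult (if i = k then 1 else 0) (y i)) = (\<Sum>i\<in>{..k} - K. if i = k then y k else 0)"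
    by (rule sum.cong) auto
  also have "\<dots> = y k" using assms by simp
  finally show ?thesis unfolding U_def mem_Collect_eq by (intro exI) (rule sym)
qed

text \<open>The \<open>y i\<close> have distinct degrees, so top terms of a combination cannot
  cancel and coefficients beyond the degree are zero.\<close>

lemma U_truncate:
  assumes "w \<in> U" "degree w \<le> m"
  obtains b where "w = (\<Sum>i\<in>{..m} - K. smult (b i) (y i))"
proof -
  from assms(1) obtain n b where "w = (\<Sum>i\<in>{..n} - K. smult (b i) (y i))" by (auto simp: U_def)
  then have "\<exists>b. w = (\<Sum>i\<in>{..m} - K. smult (b i) (y i))"
  proof (induction n arbitrary: b)
    case 0
    then show ?case using U_extend[of 0 m b] by simp
  next
    case (Suc n)
    show ?case
    proof (cases "Suc n \<le> m")
      case True
      then show ?thesis using Suc.prems U_extend[of "Suc n" m b] by simp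
    next
      case False
      have *: "(\<Sum>i\<in>{..Suc n} - K. smult (b i) (y i))
        = (if Suc n \<in> K then 0 else smult (b (Suc n)) (y (Suc n))) + (\<Sum>i\<in>{..n} - K. smult (b i) (y i))"
        by (auto simp: atMost_Suc insert_Diff_if)
      have "b (Suc n) = 0" if "Suc n \<notin> K"
      proof -
        have "coeff (\<Sum>i\<in>{..n} - K. smult (b i) (y i)) (Suc n) = 0"
          unfolding coeff_sum by (rule sum.neutral) (auto simp: deg_y coeff_eq_0)
        moreover have "coeff w (Suc n) = 0" using False assms(2) by (intro coeff_eq_0) simp
        ultimately have "b (Suc n) * coeff (y (Suc n)) (Suc n) = 0" using Suc.prems * that by simp
        then show ?thesis using y_nz[OF that] deg_y[OF that] by (metis leading_coeff_0_iff mult_eq_0_iff)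
      qed
      then show ?thesis using Suc * by simp
    qed
  qed
  then show ?thesis using that by blast
qed

text \<open>Leading terms are removed by \<open>y n\<close>, or by a monomial when the degree
  \<open>n\<close> is missing. This bounds the codimension of \<open>U\<close> by
  \<open>card K\<close>.\<close>

lemma U_decomp: "\<exists>u\<in>U. \<exists>c. w = u + (\<Sum>i\<in>K. smult (c i) (monom 1 i))"
proof (induction "degree w" arbitrary: w rule: less_induct)
  case less
  show ?case
  proof (cases "degree w = 0 \<and> w = 0")
    case True
    then show ?thesis using U_0 by (intro bexI[of _ 0] exI[of _ "\<lambda>_. 0"]) auto
  next
    case False
    let ?n = "degree w"
    define v where "v = (if ?n \<in> K then monom 1 ?n else y ?n)"
    have v: "degree v = ?n" "v \<noteq> 0" by (auto simp: v_def degree_monom_eq deg_y y_nz)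
    define a where "a = lead_coeff w / lead_coeff v"
    define w' where "w' = w - smult a v"
    have w: "w = w' + smult a v" by (simp add: w'_def)
    have "coeff w' ?n = 0" using v by (simp add: w'_def a_def) (metis leading_coeff_0_iff v(2) v(1))
    moreover have "degree w' \<le> ?n" unfolding w'_def by (rule degree_diff_le) (auto simp: v degree_smult_le)
    ultimately have "degree w' < ?n \<or> w' = 0" by (metis eq_zero_or_degree_less)
    then have "\<exists>u\<in>U. \<exists>c. w' = u + (\<Sum>i\<in>K. smult (c i) (monom 1 i))"
    proof
      assume "w' = 0"
      then show ?thesis using U_0 by (intro bexI[of _ 0] exI[of _ "\<lambda>_. 0"]) auto
    qed (rule less)
    then obtain u c where u: "u \<in> U" "w' = u + (\<Sum>i\<in>K. smult (c i) (monom 1 i))" by blast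
    show ?thesis
    proof (cases "?n \<in> K")
      case True
      have "(\<Sum>i\<in>K. smult (if i = ?n then a else 0) (monom 1 i)) = (\<Sum>i\<in>K. if i = ?n then smult a v else 0)"
        by (rule sum.cong) (auto simp: v_def True)
      also have "\<dots> = smult a v" using True finite_K by simp
      finally have "w = u + (\<Sum>i\<in>K. smult (c i + (if i = ?n then a else 0)) (monom 1 i))"
        unfolding smult_add_left sum.distrib by (simp add: w u)
      then show ?thesis using u(1) by (intro bexI[of _ u] exI)
    next
      case False
      then have "u + smult a v \<in> U" unfolding v_def by (auto intro!: U_add U_smult y_in_U u)
      moreover have "w = (u + smult a v) + (\<Sum>i\<in>K. smult (c i) (monom 1 i))" by (simp add: w u)
      ultimately show ?thesis by blast
    qed
  qed
qed

text \<open>Modulo \<open>U\<close> only the \<open>card K\<close> coordinates on the monomials of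
  missing degree remain, so linear elimination applies.\<close>

lemma U_relation:
  fixes w :: "'j \<Rightarrow> 'a poly"
  assumes "finite J" "card K < card J"
  obtains a where "\<exists>j\<in>J. a j \<noteq> 0" "(\<Sum>j\<in>J. smult (a j) (w j)) \<in> U"
proof -
  have "\<forall>j. \<exists>u c. u \<in> U \<and> w j = u + (\<Sum>i\<in>K. smult (c i) (monom 1 i))" using U_decomp by blast
  then obtain u c where u: "\<And>j. u j \<in> U" and w: "\<And>j. w j = u j + (\<Sum>i\<in>K. smult (c j i) (monom 1 i))"
    unfolding choice_iff by blast
  obtain a where a: "\<exists>j\<in>J. a j \<noteq> 0" "\<forall>i\<in>K. (\<Sum>j\<in>J. a j * c j i) = 0"
    using nontrivial_relation[OF finite_K assms, of c] by blast
  have "(\<Sum>j\<in>J. smult (a j) (w j)) = (\<Sum>j\<in>J. smult (a j) (u j))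
      + (\<Sum>j\<in>J. \<Sum>i\<in>K. smult (a j * c j i) (monom 1 i))"
    by (simp add: w smult_add_right sum.distrib smult_sum_right)
  also have "(\<Sum>j\<in>J. \<Sum>i\<in>K. smult (a j * c j i) (monom 1 i)) = (\<Sum>i\<in>K. smult (\<Sum>j\<in>J. a j * c j i) (monom 1 i))"
    by (subst sum.swap) (simp add: smult_sum)
  also have "\<dots> = 0" using a(2) by simp
  finally have "(\<Sum>j\<in>J. smult (a j) (w j)) \<in> U" by (auto intro!: U_sum U_smult u)
  with a(1) show ?thesis by (rule that)
qed

lemma T_U: assumes "u \<in> U" obtains v where "v \<in> U" "T (to_fract u) = to_fract v"
proof -
  from assms obtain n b where u: "u = (\<Sum>i\<in>{..n} - K. smult (b i) (y i))" by (auto simp: U_def)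
  have "T (to_fract u) = (\<Sum>i\<in>{..n} - K. T (constf (b i) * to_fract (y i)))"
    by (simp add: u dop_sum[OF dop_T] to_fract_smult)
  also have "\<dots> = to_fract (\<Sum>i\<in>{..n} - K. smult (b i * ev i) (y i))"
    unfolding to_fract_sum by (rule sum.cong) (auto simp: dop_cmult[OF dop_T] eigen to_fract_smult constf_mult)
  finally show ?thesis by (rule that[rotated]) (auto intro!: U_sum U_smult y_in_U)
qed

lemma infinite_degrees: "infinite (- K - {..<n})"
  using finite_K by (simp add: Diff_infinite_finite)

end

context eigensystem
begin

lemma cleared_denominators:
  obtains g P Q R where "g \<noteq> 0" "to_fract g * p = to_fract P" "to_fract g * q = to_fract Q"
    "to_fract g * r = to_fract R"
proof -
  let ?x = "\<lambda>i::nat. if i = 0 then r else if i = 1 then q else p"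
  obtain g c where g: "g \<noteq> 0" "\<And>i. i \<le> 2 \<Longrightarrow> to_fract g * ?x i = to_fract (c i)"
    by (rule common_denominator[where n = 2 and x = ?x]) (rule that)
  show ?thesis using that[of g "c 2" "c 1" "c 0"] g(1) g(2)[of 0] g(2)[of 1] g(2)[of 2] by simp
qed

end

locale cleared_eigensystem = eigensystem p q r K y ev
  for p q r :: "'a::{field_char_0,field_gcd} poly fract" and K y ev +
  fixes g P Q R :: "'a poly"
  assumes g_nz: "g \<noteq> 0"
    and gp: "to_fract g * p = to_fract P" and gq: "to_fract g * q = to_fract Q"
    and gr: "to_fract g * r = to_fract R"
begin

definition Op :: "'a poly \<Rightarrow> 'a poly" where
  "Op u = P * pderiv (pderiv u) + Q * pderiv u + R * u"

lemma P_nz: "P \<noteq> 0"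
  using gp g_nz p_nz by (metis mult_eq_0_iff to_fract_eq_0_iff)

lemma T_to_fract: "to_fract g * T (to_fract u) = to_fract (Op u)"
  by (simp add: diffop2_def Op_def distrib_left gp[symmetric] gq[symmetric] gr[symmetric] mult.assoc)

lemma T_to_fract_poly: "T (to_fract u) = to_fract v \<Longrightarrow> g * v = Op u"
  using T_to_fract[of u] by (metis to_fract_eq_iff to_fract_mult)

lemma Op_y: assumes "k \<notin> K" shows "Op (y k) = smult (ev k) (g * y k)"
  using T_to_fract_poly[of "y k" "smult (ev k) (y k)"] eigen[OF assms] by (simp add: to_fract_smult)

text \<open>The eigenvalue equation limits \<open>Op (y k)\<close> to degree
  \<open>degree g + k\<close>. A larger shift would make the indicial polynomial at infinity vanish
  at infinitely many \<open>k\<close>; at the permitted shift its value is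
  \<open>lead_coeff g * ev k\<close>.\<close>

lemma at_infinity:
  shows "degree P \<le> degree g + 2" "degree Q \<le> degree g + 1" "degree R \<le> degree g"
    and "\<And>k. k \<notin> K \<Longrightarrow> k \<ge> 2 \<Longrightarrow> lead_coeff g * ev k = coeff P (degree g + 2) * (of_nat k * (of_nat k - 1))
      + coeff Q (degree g + 1) * of_nat k + coeff R (degree g)"
proof -
  define c where "c i = (if i = 0 then R else if i = 1 then Q else P)" for i :: nat
  have op: "poly_op 2 c u = Op u" for u
    by (simp add: poly_op_def Op_def c_def eval_nat_numeral algebra_simps)
  let ?S = "(\<lambda>i. degree (c i) + (2 - i)) ` {i\<in>{..2}. c i \<noteq> 0}"
  define s where "s = Max ?S"
  have ne: "2 \<in> {i\<in>{..2}. c i \<noteq> 0}" using P_nz by (simp add: c_def)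
  have "s \<in> ?S" unfolding s_def by (rule Max_in) (use ne in auto)
  then obtain m where m: "m \<le> 2" "c m \<noteq> 0" "s = degree (c m) + (2 - m)" by auto
  have s: "degree (c j) + 2 \<le> s + j" if "j \<le> 2" "c j \<noteq> 0" for j
    using Max_ge[of ?S "degree (c j) + (2 - j)"] that by (fold s_def) auto
  have "s \<le> degree g + 2"
  proof (rule ccontr)
    assume gs: "\<not> s \<le> degree g + 2"
    define a where "a i = (if 2 \<le> s + i then coeff (c i) (s + i - 2) else 0)" for i
    have "a m = 0"
    proof (rule ffact_combination_zero[where A = "- K - {..<2}" and a = a and i = m])
      show "infinite (- K - {..<2})" by (rule infinite_degrees)
      fix k assume k: "k \<in> - K - {..<2}"
      then have yk: "degree (y k) = k" "y k \<noteq> 0" "2 \<le> degree (y k)"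
        using deg_y[of k] y_nz[of k] by auto
      have "degree (Op (y k)) \<le> degree g + k"
        using Op_y[of k] k yk degree_mult_le[of g "y k"] by (simp add: degree_smult_eq)
      then have "coeff (Op (y k)) (degree (y k) + s - 2) = 0" using gs yk by (intro coeff_eq_0) simp
      then have "lead_coeff (y k) * (\<Sum>i\<le>2. a i * poly (ffact_poly i) (of_nat (degree (y k)))) = 0"
        using coeff_poly_op[of 2 c s "y k", OF s yk(3)] by (simp add: a_def op)
      then show "(\<Sum>i\<le>2. a i * poly (ffact_poly i) (of_nat k)) = 0"
        using yk(2) leading_coeff_0_iff[of "y k"] by (metis mult_eq_0_iff yk(1))
    qed (rule m)
    then show False using m by (auto simp: m(3) a_def)
  qed
  then have d: "degree (c j) \<le> degree g + j" if "j \<le> 2" for j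
    using s[OF that] by (cases "c j = 0") auto
  show "degree P \<le> degree g + 2" "degree Q \<le> degree g + 1" "degree R \<le> degree g"
    using d[of 2] d[of 1] d[of 0] by (simp_all add: c_def)
  fix k assume k: "k \<notin> K" "k \<ge> 2"
  then have yk: "degree (y k) = k" "y k \<noteq> 0" "2 \<le> degree (y k)"
    using deg_y[of k] y_nz[of k] by auto
  have f2: "poly (ffact_poly 2) (of_nat k) = (of_nat k * (of_nat k - 1) :: 'a)"
    by (simp add: ffact_poly_def eval_nat_numeral algebra_simps)
  have f1: "poly (ffact_poly 1) (of_nat k) = (of_nat k :: 'a)" by (simp add: ffact_poly_def)
  have f0: "poly (ffact_poly 0) (of_nat k) = (1 :: 'a)" by (simp add: ffact_poly_def)
  have "coeff (Op (y k)) (degree (y k) + (degree g + 2) - 2) = lead_coeff (y k) *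
     (\<Sum>i\<le>2. coeff (c i) (degree g + i) * poly (ffact_poly i) (of_nat (degree (y k))))"
    using coeff_poly_op[of 2 c "degree g + 2" "y k", OF _ yk(3)] d by (simp add: op add.commute)
  also have "(\<Sum>i\<le>2. coeff (c i) (degree g + i) * poly (ffact_poly i) (of_nat (degree (y k))))
     = coeff P (degree g + 2) * (of_nat k * (of_nat k - 1))
      + coeff Q (degree g + 1) * of_nat k + coeff R (degree g)"
    using f1 by (simp add: yk(1) c_def numeral_2_eq_2 f0 f2[unfolded numeral_2_eq_2])
  also have "coeff (Op (y k)) (degree (y k) + (degree g + 2) - 2) = ev k * (lead_coeff g * lead_coeff (y k))"
    using coeff_mult_degree_sum[of g "y k"] by (simp add: Op_y[OF k(1)] add.commute)
  finally have "lead_coeff (y k) * (lead_coeff g * ev k) = lead_coeff (y k) * (coeff P (degree g + 2) * (of_nat k * (of_nat k - 1))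
      + coeff Q (degree g + 1) * of_nat k + coeff R (degree g))" by (simp add: mult_ac)
  then show "lead_coeff g * ev k = coeff P (degree g + 2) * (of_nat k * (of_nat k - 1))
      + coeff Q (degree g + 1) * of_nat k + coeff R (degree g)" using yk(2) by simp
qed

end

section \<open>Local analysis at a point\<close>

text \<open>To leading order \<open>(z - c) D\<close> multiplies a function of order
  \<open>s\<close> at \<open>c\<close> by \<open>s\<close>; this is the source of the indicial
  polynomial.\<close>

lemma euler_power_mult:
  fixes u :: "'a::field_char_0 poly"
  shows "[:-c, 1:] * pderiv ([:-c, 1:] ^ s * u) = [:-c, 1:] ^ s * (of_nat s * u + [:-c, 1:] * pderiv u)"
proof (cases s)
  case (Suc n)
  have "pderiv [:-c, 1:] = 1" by (simp add: pderiv_pCons)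
  then have "pderiv ([:-c, 1:] ^ Suc n) = of_nat (Suc n) * [:-c, 1:] ^ n"
    by (simp only: pderiv_power_Suc) (simp add: of_nat_poly)
  then show ?thesis unfolding Suc pderiv_mult by (simp only: power_Suc) (simp only: algebra_simps)
qed simp

lemma order_power_mult:
  fixes u :: "'a::field_char_0 poly"
  assumes "poly u c \<noteq> 0" shows "order c ([:-c, 1:] ^ n * u) = n"
proof -
  have "u \<noteq> 0" using assms by auto
  then have "order c ([:-c, 1:] ^ n * u) = n + order c u"
    by (subst order_mult) (auto simp: order_power_n_n)
  then show ?thesis using assms by (simp add: order_0I)
qed

lemma order_decomp':
  fixes u :: "'a::field_char_0 poly"
  assumes "u \<noteq> 0" obtains v where "u = [:-c, 1:] ^ order c u * v" "poly v c \<noteq> 0"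
  using order_decomp[OF assms, of c] by (auto simp: poly_eq_0_iff_dvd)

context cleared_eigensystem
begin

text \<open>The quadratic polynomial in the order of vanishing at \<open>c\<close> is the indicial polynomial. Unless the
  order is one of its roots, \<open>T\<close> lowers the order by \<open>order c g + 2 - t\<close>.\<close>

lemma local_drop:
  obtains t P0 Q0 R0 where "P = [:-c, 1:] ^ t * P0" "[:-c, 1:] * Q = [:-c, 1:] ^ t * Q0"
    "\<not> (poly P0 c = 0 \<and> poly Q0 c = 0 \<and> poly R0 c = 0)"
    "\<And>u. u \<in> U \<Longrightarrow> u \<noteq> 0 \<Longrightarrow> poly P0 c * (of_nat (order c u) ^ 2 - of_nat (order c u))
        + poly Q0 c * of_nat (order c u) + poly R0 c \<noteq> 0
      \<Longrightarrow> \<exists>v\<in>U. v \<noteq> 0 \<and> order c v + order c g + 2 = order c u + t"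
proof -
  let ?h = "[:-c, 1:]"
  \<comment> \<open>Weights in the Euler form
    \<open>h^2 Op = P (h^2 D^2) + (h Q) (h D) + h^2 R\<close>; the maximal \<open>t\<close> is the
    exact power of \<open>h\<close> common to the three coefficients.\<close>
  define A where "A t \<longleftrightarrow> ?h ^ t dvd P \<and> ?h ^ t dvd ?h * Q \<and> ?h ^ t dvd ?h ^ 2 * R" for t
  have "A 0" by (simp add: A_def)
  moreover have bound: "t \<le> order c P" if "A t" for t
    using that P_nz by (simp add: A_def order_divides)
  ultimately have A: "A (Greatest A)" by (rule GreatestI_nat[of A 0 "order c P"]) (use bound in auto)
  define t where "t = Greatest A"
  have nA: "\<not> A (Suc t)"
    using Greatest_le_nat[of A "Suc t" "order c P"] bound unfolding t_def by auto
  from A obtain P0 Q0 R0 where P0: "P = ?h ^ t * P0" and Q0: "?h * Q = ?h ^ t * Q0"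
    and R0: "?h ^ 2 * R = ?h ^ t * R0" unfolding A_def t_def dvd_def by blast
  have nz: "\<not> (poly P0 c = 0 \<and> poly Q0 c = 0 \<and> poly R0 c = 0)"
  proof
    assume "poly P0 c = 0 \<and> poly Q0 c = 0 \<and> poly R0 c = 0"
    then have "?h dvd P0" "?h dvd Q0" "?h dvd R0" by (simp_all only: poly_eq_0_iff_dvd)
    then have "A (Suc t)" unfolding A_def P0 Q0 R0 power_Suc2 by (intro conjI mult_dvd_mono dvd_refl)
    with nA show False by simp
  qed
  show ?thesis
  proof (rule that[OF P0 Q0 nz])
    fix u assume u: "u \<in> U" "u \<noteq> 0"
      and ind: "poly P0 c * (of_nat (order c u) ^ 2 - of_nat (order c u))
        + poly Q0 c * of_nat (order c u) + poly R0 c \<noteq> 0"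
    define s where "s = order c u"
    obtain u1 where u1: "u = ?h ^ s * u1" "poly u1 c \<noteq> 0"
      using order_decomp'[OF u(2)] unfolding s_def by blast
    define v1 where "v1 = of_nat s * u1 + ?h * pderiv u1"
    have d1: "?h * pderiv u = ?h ^ s * v1" unfolding u1(1) v1_def by (rule euler_power_mult)
    have "?h * pderiv (?h * pderiv u) = ?h ^ s * (of_nat s * v1 + ?h * pderiv v1)"
      unfolding d1 by (rule euler_power_mult)
    moreover have "?h * pderiv (?h * pderiv u) = ?h * pderiv u + ?h ^ 2 * pderiv (pderiv u)"
    proof -
      have "pderiv ?h = 1" by (simp add: pderiv_pCons)
      then show ?thesis
        by (simp only: pderiv_mult power2_eq_square distrib_left mult_ac add_ac mult_1_left mult_1_right)
    qed
    ultimately have "?h ^ 2 * pderiv (pderiv u) = ?h ^ s * (of_nat s * v1 + ?h * pderiv v1) - ?h * pderiv u"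
      by (simp only: eq_diff_eq add_ac)
    then have d2: "?h ^ 2 * pderiv (pderiv u) = ?h ^ s * (of_nat s * v1 + ?h * pderiv v1 - v1)"
      unfolding d1 by (simp only: right_diff_distrib)
    \<comment> \<open>The cofactor of \<open>h ^ (s + t)\<close> in \<open>h^2 Op u\<close>; at
      \<open>c\<close> it equals \<open>poly u1 c\<close> times the indicial polynomial at
      \<open>s\<close>.\<close>
    define B where "B = P0 * (of_nat s * v1 + ?h * pderiv v1 - v1) + Q0 * v1 + R0 * u1"
    have "?h ^ 2 * Op u = P * (?h ^ 2 * pderiv (pderiv u)) + (?h * Q) * (?h * pderiv u) + (?h ^ 2 * R) * u"
      by (simp only: Op_def power2_eq_square distrib_left mult_ac)
    also have "\<dots> = ?h ^ (s + t) * B"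
      unfolding d1 d2 Q0 R0 by (subst P0, subst u1(1)) (simp only: B_def power_add distrib_left mult_ac)
    finally have hOp: "?h ^ 2 * Op u = ?h ^ (s + t) * B" .
    have v1c: "poly v1 c = of_nat s * poly u1 c" by (simp add: v1_def)
    have "poly B c = poly u1 c * (poly P0 c * (of_nat s ^ 2 - of_nat s) + poly Q0 c * of_nat s + poly R0 c)"
      by (simp add: B_def v1c) (simp add: algebra_simps power2_eq_square)
    with ind u1(2) have Bc: "poly B c \<noteq> 0" by (simp add: s_def)
    obtain v where v: "v \<in> U" "T (to_fract u) = to_fract v" using T_U[OF u(1)] by blast
    have gv: "g * v = Op u" using v(2) by (rule T_to_fract_poly)
    have "B \<noteq> 0" using Bc by auto
    with hOp gv have v0: "v \<noteq> 0" by auto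
    have "order c (?h ^ 2 * (g * v)) = 2 + (order c g + order c v)"
      using g_nz v0 by (simp only: order_mult[of "?h ^ 2" "g * v"] order_mult[of g v]
        mult_eq_0_iff power_eq_0_iff pCons_eq_0_iff order_power_n_n simp_thms one_neq_zero)
    moreover have "order c (?h ^ 2 * (g * v)) = s + t"
      unfolding gv hOp using Bc by (rule order_power_mult)
    ultimately show "\<exists>v\<in>U. v \<noteq> 0 \<and> order c v + order c g + 2 = order c u + t"
      using v(1) v0 by (intro bexI[of _ v]) (auto simp: s_def)
  qed
qed

text \<open>Among the \<open>card K + 1\<close> powers \<open>(z - c) ^ (e + d * j)\<close> some
  combination lies in \<open>U\<close>, and its order is the exponent of its lowest surviving
  term.\<close>

lemma order_residue_class:
  assumes "d > 0"
  obtains u i where "u \<in> U" "u \<noteq> 0" "order c u = e + d * i"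
proof -
  let ?h = "[:-c, 1:]"
  obtain a where a: "\<exists>j\<in>{..card K}. a j \<noteq> 0" "(\<Sum>j\<le>card K. smult (a j) (?h ^ (e + d * j))) \<in> U"
    by (rule U_relation[of "{..card K}" "\<lambda>j. ?h ^ (e + d * j)"]) (simp, simp, rule that)
  define j0 where "j0 = (LEAST j. j \<le> card K \<and> a j \<noteq> 0)"
  have j0: "j0 \<le> card K" "a j0 \<noteq> 0"
    using LeastI_ex[of "\<lambda>j. j \<le> card K \<and> a j \<noteq> 0"] a(1) unfolding j0_def by auto
  have less: "a j = 0" if "j < j0" for j
    using not_less_Least[of j "\<lambda>j. j \<le> card K \<and> a j \<noteq> 0"] that j0(1) unfolding j0_def by auto
  define w where "w = (\<Sum>j\<in>{j0..card K}. smult (a j) (?h ^ (d * (j - j0))))"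
  have "(\<Sum>j\<le>card K. smult (a j) (?h ^ (e + d * j))) = (\<Sum>j\<in>{j0..card K}. smult (a j) (?h ^ (e + d * j)))"
    by (rule sum.mono_neutral_right) (auto simp: less)
  also have "\<dots> = ?h ^ (e + d * j0) * w"
    unfolding w_def sum_distrib_left
  proof (rule sum.cong)
    fix j assume "j \<in> {j0..card K}"
    then have "e + d * j = (e + d * j0) + d * (j - j0)"
      unfolding add.assoc add_mult_distrib2[symmetric] by simp
    then show "smult (a j) (?h ^ (e + d * j)) = ?h ^ (e + d * j0) * smult (a j) (?h ^ (d * (j - j0)))"
      by (simp only: power_add mult_smult_right)
  qed simp
  finally have e: "(\<Sum>j\<le>card K. smult (a j) (?h ^ (e + d * j))) = ?h ^ (e + d * j0) * w" .
  have "poly w c = (\<Sum>j\<in>{j0..card K}. if j = j0 then a j0 else 0)"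
    unfolding w_def poly_sum by (rule sum.cong) (use assms in auto)
  also have "\<dots> = a j0" using j0(1) by simp
  finally have wc: "poly w c \<noteq> 0" using j0(2) by simp
  then have "w \<noteq> 0" by auto
  then have "?h ^ (e + d * j0) * w \<noteq> 0" by simp
  then show ?thesis using that[of "?h ^ (e + d * j0) * w" j0] a(2) order_power_mult[OF wc] unfolding e by simp
qed

text \<open>If \<open>T\<close> lowers orders by \<open>d > 0\<close>, the least order occurring in each residue class modulo \<open>d\<close> is a
  root of the indicial polynomial. Hence \<open>d \<le> 2\<close>, and for \<open>d = 2\<close> the two roots have different
  parity, so that the residue of \<open>q / p\<close> is an even integer \<open>- 2 \<nu>\<close>.\<close>

lemma local_structure:
  shows "[:-c, 1:] ^ order c g dvd P"
    and "\<exists>\<nu>::nat. [:-c, 1:] ^ (order c g + 1) dvd [:-c, 1:] * Q + of_nat (2 * \<nu>) * P"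
    and "order c g = 0 \<Longrightarrow> [:-c, 1:] ^ (order c g + 1) dvd [:-c, 1:] * Q"
proof -
  let ?h = "[:-c, 1:]"
  obtain t P0 Q0 R0 where P0: "P = ?h ^ t * P0" and Q0: "?h * Q = ?h ^ t * Q0"
    and nz: "\<not> (poly P0 c = 0 \<and> poly Q0 c = 0 \<and> poly R0 c = 0)"
    and drop: "\<And>u. u \<in> U \<Longrightarrow> u \<noteq> 0 \<Longrightarrow> poly P0 c * (of_nat (order c u) ^ 2 - of_nat (order c u))
        + poly Q0 c * of_nat (order c u) + poly R0 c \<noteq> 0
      \<Longrightarrow> \<exists>v\<in>U. v \<noteq> 0 \<and> order c v + order c g + 2 = order c u + t"
    by (rule local_drop) (rule that)
  define ind where "ind = [:poly R0 c, poly Q0 c - poly P0 c, poly P0 c:]"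
  have ind_nz: "ind \<noteq> 0" using nz by (auto simp: ind_def)
  have ind_eq: "poly ind (of_nat e) = poly P0 c * (of_nat e ^ 2 - of_nat e) + poly Q0 c * of_nat e + poly R0 c" for e
    by (simp add: ind_def algebra_simps power2_eq_square)
  have root: "\<exists>i. poly ind (of_nat (\<rho> + d * i)) = 0" if d: "\<rho> < d" "d + t = order c g + 2" for d \<rho>
  proof -
    define X where "X i \<longleftrightarrow> (\<exists>u\<in>U. u \<noteq> 0 \<and> order c u = \<rho> + d * i)" for i
    have "d > 0" using d(1) by simp
    then obtain u i where "u \<in> U" "u \<noteq> 0" "order c u = \<rho> + d * i"
      by (rule order_residue_class) (rule that)
    then have "X i" by (auto simp: X_def)
    define m where "m = (LEAST i. X i)"
    have "X m" unfolding m_def by (rule LeastI) (rule \<open>X i\<close>)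
    then obtain w where w: "w \<in> U" "w \<noteq> 0" "order c w = \<rho> + d * m" by (auto simp: X_def)
    show ?thesis
    proof (rule exI[of _ m], rule ccontr)
      assume "poly ind (of_nat (\<rho> + d * m)) \<noteq> 0"
      then obtain v where v: "v \<in> U" "v \<noteq> 0" "order c v + order c g + 2 = order c w + t"
        using drop[OF w(1,2)] unfolding ind_eq w(3) by blast
      then have e: "order c v + d = \<rho> + d * m" using d(2) w(3) by linarith
      show False
      proof (cases m)
        case 0
        with e d(1) show False by simp
      next
        case (Suc n)
        with e have "order c v = \<rho> + d * n" by simp
        with v have "X n" by (auto simp: X_def)
        then have "m \<le> n" unfolding m_def by (rule Least_le)
        with Suc show False by simp
      qed
    qed
  qed
  \<comment> \<open>Otherwise \<open>d\<close> is at least 3, and the residue classes of 0, 1 and 2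
    give three distinct roots of a nonzero polynomial of degree at most 2.\<close>
  have t: "order c g \<le> t"
  proof (rule ccontr)
    assume t: "\<not> order c g \<le> t"
    define d where "d = order c g + 2 - t"
    have d: "d + t = order c g + 2" "3 \<le> d" using t by (auto simp: d_def)
    obtain i0 i1 i2 where i: "poly ind (of_nat (0 + d * i0)) = 0" "poly ind (of_nat (1 + d * i1)) = 0"
      "poly ind (of_nat (2 + d * i2)) = 0"
      using root[of 0 d] root[of 1 d] root[of 2 d] d by auto
    define x0 x1 x2 where x: "x0 = 0 + d * i0" "x1 = 1 + d * i1" "x2 = 2 + d * i2"
    have "(k + d * i) mod d = k" if "k < 3" for k i using d(2) that by simp
    from this[of 0 i0] this[of 1 i1] this[of 2 i2]
    have "x0 mod d = 0" "x1 mod d = 1" "x2 mod d = 2" unfolding x by simp_all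
    then have "x0 \<noteq> x1" "x0 \<noteq> x2" "x1 \<noteq> x2" by auto
    then have "card {x0, x1, x2} = 3" by simp
    then have "card (of_nat ` {x0, x1, x2} :: 'a set) = 3"
      by (subst card_image) (auto simp: inj_on_def)
    moreover have "of_nat ` {x0, x1, x2} \<subseteq> {x. poly ind x = 0}"
      using i unfolding x[symmetric] by auto
    ultimately have "3 \<le> card {x. poly ind x = 0}"
      by (metis card_mono ind_nz poly_roots_finite)
    also have "\<dots> \<le> degree ind" using ind_nz by (rule card_poly_roots_bound)
    also have "\<dots> \<le> 2" by (simp add: ind_def)
    finally show False by simp
  qed
  show "?h ^ order c g dvd P" unfolding P0 using t by (intro dvd_mult2 le_imp_power_dvd)
  have big: "?h ^ (order c g + 1) dvd ?h * Q" "?h ^ (order c g + 1) dvd P" if "order c g + 1 \<le> t"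
    unfolding Q0 unfolding P0 using that by (intro dvd_mult2 le_imp_power_dvd; simp)+
  have small: "\<exists>\<nu>::nat. poly Q0 c + of_nat (2 * \<nu>) * poly P0 c = 0" "poly P0 c \<noteq> 0" if "t = order c g"
  proof -
    obtain i j where ij: "poly ind (of_nat (0 + 2 * i)) = 0" "poly ind (of_nat (1 + 2 * j)) = 0"
      using root[of 0 2] root[of 1 2] \<open>t = order c g\<close> by auto
    define x z where "x = (of_nat (0 + 2 * i) :: 'a)" and "z = (of_nat (1 + 2 * j) :: 'a)"
    have "x \<noteq> z" unfolding x_def z_def of_nat_eq_iff by presburger
    \<comment> \<open>Subtracting the indicial equations at two roots of opposite parity eliminates
      \<open>R0\<close> and leaves \<open>Q0(c) = - (x + z - 1) P0(c)\<close>, where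
      \<open>x + z - 1\<close> is even.\<close>
    have "(x - z) * (poly P0 c * (x + z - 1) + poly Q0 c)
      = (poly P0 c * (x ^ 2 - x) + poly Q0 c * x + poly R0 c) - (poly P0 c * (z ^ 2 - z) + poly Q0 c * z + poly R0 c)"
      by (simp add: algebra_simps power2_eq_square)
    also have "\<dots> = 0" using ij[unfolded ind_eq, folded x_def z_def] by (simp only: diff_self)
    finally have "(x - z) * (poly P0 c * (x + z - 1) + poly Q0 c) = 0" .
    then have e: "poly P0 c * (x + z - 1) + poly Q0 c = 0"
      using \<open>x \<noteq> z\<close> by (metis mult_eq_0_iff right_minus_eq)
    have xz: "x + z - 1 = of_nat (2 * (i + j))" unfolding x_def z_def by simp
    show "\<exists>\<nu>::nat. poly Q0 c + of_nat (2 * \<nu>) * poly P0 c = 0"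
      using e unfolding xz by (intro exI[of _ "i + j"]) (simp only: add.commute mult.commute)
    show "poly P0 c \<noteq> 0"
    proof
      assume "poly P0 c = 0"
      moreover from this have "poly Q0 c = 0" using e by simp
      moreover have "poly R0 c = 0" using ij(1) calculation unfolding ind_eq by simp
      ultimately show False using nz by simp
    qed
  qed
  show "\<exists>\<nu>::nat. ?h ^ (order c g + 1) dvd ?h * Q + of_nat (2 * \<nu>) * P"
  proof (cases "t = order c g")
    case True
    then obtain \<nu> where "poly (Q0 + of_nat (2 * \<nu>) * P0) c = 0" using small(1) by auto
    then have "?h dvd Q0 + of_nat (2 * \<nu>) * P0" by (simp only: poly_eq_0_iff_dvd)
    then have "?h ^ t * ?h dvd ?h ^ t * (Q0 + of_nat (2 * \<nu>) * P0)" by (intro mult_dvd_mono dvd_refl)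
    also have "?h ^ t * (Q0 + of_nat (2 * \<nu>) * P0) = ?h * Q + of_nat (2 * \<nu>) * P"
      unfolding Q0 by (subst P0) (simp only: distrib_left mult_ac)
    finally show ?thesis unfolding True by (intro exI[of _ \<nu>]) (simp only: power_add power_one_right)
  next
    case False
    \<comment> \<open>For \<open>t > order c g\<close> both \<open>h Q\<close> and \<open>P\<close>
      are divisible already, so the exponent 0 works.\<close>
    then show ?thesis using big t by (intro exI[of _ 0]) simp
  qed
  show "?h ^ (order c g + 1) dvd ?h * Q" if "order c g = 0"
  proof (cases "t = order c g")
    case True
    then have "poly (?h * Q) c = poly Q0 c" using that by (simp only: Q0) simp
    then show ?thesis using that by (simp only: poly_eq_0_iff_dvd power_0 add_0 power_one_right dvd_triv_left)
  next
    case False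
    then show ?thesis using big t by simp
  qed
qed

end

text \<open>Over the complex numbers a root can be split off from both sides until \<open>u\<close>
  is constant.\<close>

lemma poly_dvd_by_roots:
  fixes u v :: "complex poly"
  assumes "u \<noteq> 0" "\<And>c n. [:-c, 1:] ^ n dvd u \<Longrightarrow> [:-c, 1:] ^ n dvd v"
  shows "u dvd v"
  using assms
proof (induction "degree u" arbitrary: u v)
  case 0
  then show ?case by (metis is_unit_iff_degree unit_imp_dvd)
next
  case (Suc d)
  then obtain c where "poly u c = 0"
    using fundamental_theorem_of_algebra[of u] constant_degree[of u] by auto
  then obtain u1 where u1: "u = [:-c, 1:] * u1" by (metis dvdE poly_eq_0_iff_dvd)
  with Suc.prems have u10: "u1 \<noteq> 0" by auto
  then have "degree u = Suc (degree u1)" unfolding u1 by (subst degree_mult_eq) auto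
  have "[:-c, 1:] dvd v" using Suc.prems(2)[of c 1] u1 by (simp only: power_one_right dvd_triv_left)
  then obtain v1 where v1: "v = [:-c, 1:] * v1" by (elim dvdE)
  have "u1 dvd v1"
  proof (rule Suc.hyps(1)[OF _ u10])
    show "d = degree u1" using Suc.hyps(2) \<open>degree u = Suc (degree u1)\<close> by simp
    fix b n assume n: "[:-b, 1:] ^ n dvd u1"
    show "[:-b, 1:] ^ n dvd v1"
    proof (cases "v1 = 0")
      case False
      \<comment> \<open>The term \<open>order b [:-c, 1:]\<close> is 1 or 0 according to whether
        \<open>b = c\<close>, which treats both cases together.\<close>
      have "[:-b, 1:] ^ (n + order b [:-c, 1:]) dvd u"
        unfolding power_add u1 mult.commute[of "[:-c, 1:]"] by (intro mult_dvd_mono n order_1)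
      then have "[:-b, 1:] ^ (n + order b [:-c, 1:]) dvd v" by (rule Suc.prems(2))
      then have "n + order b [:-c, 1:] \<le> order b v" using False by (auto simp: order_divides v1 simp del: mult_pCons_left)
      also have "order b v = order b [:-c, 1:] + order b v1" unfolding v1 using False by (intro order_mult) (simp del: mult_pCons_left)
      finally show ?thesis by (simp add: order_divides)
    qed simp
  qed
  then show ?case unfolding u1 v1 by (intro mult_dvd_mono dvd_refl)
qed

section \<open>Complexification\<close>

lemma map_poly_hom_add:
  assumes "f 0 = 0" "\<And>a b. f (a + b) = f a + f b"
  shows "map_poly f (u + v) = map_poly f u + map_poly f v"
  by (rule poly_eqI) (simp add: coeff_map_poly assms)

lemma map_poly_hom_mult:
  fixes f :: "'a::comm_ring_1 \<Rightarrow> 'b::comm_ring_1"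
  assumes "f 0 = 0" "\<And>a b. f (a + b) = f a + f b" "\<And>a b. f (a * b) = f a * f b"
  shows "map_poly f (u * v) = map_poly f u * map_poly f v"
proof (rule poly_eqI)
  fix n
  have "f (sum g A) = (\<Sum>i\<in>A. f (g i))" for g and A :: "nat set"
    by (induction A rule: infinite_finite_induct) (simp_all add: assms)
  then show "coeff (map_poly f (u * v)) n = coeff (map_poly f u * map_poly f v) n"
    by (simp add: coeff_map_poly coeff_mult assms)
qed

abbreviation cpoly :: "real poly \<Rightarrow> complex poly" where "cpoly \<equiv> map_poly complex_of_real"

lemma cpoly_add [simp]: "cpoly (u + v) = cpoly u + cpoly v"
  by (rule map_poly_hom_add) simp_all

lemma cpoly_mult [simp]: "cpoly (u * v) = cpoly u * cpoly v"
  by (rule map_poly_hom_mult) simp_all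

lemma cpoly_diff [simp]: "cpoly (u - v) = cpoly u - cpoly v"
  by (rule poly_eqI) (simp add: coeff_map_poly)

lemma cpoly_pCons [simp]: "cpoly (pCons c u) = pCons (complex_of_real c) (cpoly u)"
  by (rule poly_eqI) (simp add: coeff_map_poly coeff_pCons split: nat.splits)

lemma cpoly_numeral [simp]: "cpoly (numeral n) = numeral n"
  by (simp add: numeral_poly)

lemma cpoly_pderiv [simp]: "cpoly (pderiv u) = pderiv (cpoly u)"
  by (rule poly_eqI) (simp add: coeff_map_poly coeff_pderiv)

lemma cpoly_eq_iff [simp]: "cpoly u = cpoly v \<longleftrightarrow> u = v"
  by (auto simp: poly_eq_iff coeff_map_poly)

lemma cpoly_eq_0_iff [simp]: "cpoly u = 0 \<longleftrightarrow> u = 0"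
  by (auto simp: poly_eq_iff coeff_map_poly)

lemma degree_cpoly [simp]: "degree (cpoly u) = degree u"
  by (rule degree_map_poly) simp

text \<open>Division with remainder over the reals persists over the complex numbers, and a
  remainder of smaller degree is divisible only if it is zero.\<close>

lemma cpoly_dvd_iff:
  assumes "u \<noteq> 0" shows "cpoly u dvd cpoly v \<longleftrightarrow> u dvd v"
proof
  assume "cpoly u dvd cpoly v"
  moreover have "cpoly v = cpoly u * cpoly (v div u) + cpoly (v mod u)"
    unfolding cpoly_mult[symmetric] cpoly_add[symmetric] by simp
  ultimately have d: "cpoly u dvd cpoly (v mod u)" by (metis dvd_add_right_iff dvd_triv_left)
  have "v mod u = 0"
  proof (rule ccontr)
    assume *: "v mod u \<noteq> 0"
    with d have "degree u \<le> degree (v mod u)" using dvd_imp_degree_le[OF d] by simp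
    with * show False using degree_mod_less[OF assms, of v] by simp
  qed
  then show "u dvd v" by (simp add: dvd_eq_mod_eq_0)
qed (auto elim!: dvdE)

lemma complexify_quotient:
  assumes "b \<noteq> 0"
  shows "complexify (to_fract a / to_fract b) = to_fract (cpoly a) / to_fract (cpoly b)"
proof -
  define f where "f = to_fract a / to_fract b"
  have "to_fract (num f) / to_fract (den f) = f"
    by (metis Fract_conv_to_fract Fract_quot_of_fract)
  then have "to_fract (num f * b) = to_fract (a * den f)"
    using assms by (simp add: f_def field_simps)
  then have "cpoly (num f * b) = cpoly (a * den f)" by (simp only: to_fract_eq_iff)
  then have "to_fract (cpoly (num f)) * to_fract (cpoly b) = to_fract (cpoly a) * to_fract (cpoly (den f))"
    by (simp flip: to_fract_mult)
  then show ?thesis using assms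
    by (simp add: complexify_def Fract_conv_to_fract field_simps flip: f_def)
qed

lemma complexify_to_fract [simp]: "complexify (to_fract a) = to_fract (cpoly a)"
  using complexify_quotient[of 1 a] by simp

lemma complexify_add [simp]: "complexify (f + g) = complexify f + complexify g"
proof -
  obtain a b where b: "b \<noteq> 0" and f: "f = to_fract a / to_fract b" by (rule fract_cases)
  obtain c d where d: "d \<noteq> 0" and g: "g = to_fract c / to_fract d" by (rule fract_cases)
  have "f + g = to_fract (a * d + c * b) / to_fract (b * d)"
    using b d by (simp add: f g field_simps)
  then have "complexify (f + g) = to_fract (cpoly (a * d + c * b)) / to_fract (cpoly (b * d))"
    using b d complexify_quotient[of "b * d" "a * d + c * b"] by simp
  also have "\<dots> = complexify f + complexify g"
    using b d by (simp add: f g complexify_quotient field_simps)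
  finally show ?thesis .
qed

lemma complexify_mult [simp]: "complexify (f * g) = complexify f * complexify g"
proof -
  obtain a b where b: "b \<noteq> 0" and f: "f = to_fract a / to_fract b" by (rule fract_cases)
  obtain c d where d: "d \<noteq> 0" and g: "g = to_fract c / to_fract d" by (rule fract_cases)
  have "f * g = to_fract (a * c) / to_fract (b * d)"
    using b d by (simp add: f g field_simps)
  then have "complexify (f * g) = to_fract (cpoly (a * c)) / to_fract (cpoly (b * d))"
    using b d complexify_quotient[of "b * d" "a * c"] by simp
  also have "\<dots> = complexify f * complexify g"
    using b d by (simp add: f g complexify_quotient)
  finally show ?thesis .
qed

lemma complexify_deriv: "complexify (fract_deriv f) = fract_deriv (complexify f)"
proof -
  obtain a b where b: "b \<noteq> 0" and f: "f = to_fract a / to_fract b" by (rule fract_cases)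
  have "complexify (fract_deriv f)
      = to_fract (cpoly (pderiv a * b - a * pderiv b)) / to_fract (cpoly (b * b))"
    unfolding f fract_deriv_Fract[OF b] by (rule complexify_quotient) (use b in simp)
  also have "\<dots> = fract_deriv (to_fract (cpoly a) / to_fract (cpoly b))"
    using b by (subst fract_deriv_Fract) simp_all
  finally show ?thesis using b by (simp add: f complexify_quotient)
qed

lemma complexify_0 [simp]: "complexify 0 = 0"
  using complexify_to_fract[of 0] by simp

lemma complexify_eq_0_iff [simp]: "complexify f = 0 \<longleftrightarrow> f = 0"
proof -
  obtain a b where "b \<noteq> 0" "f = to_fract a / to_fract b" by (rule fract_cases)
  then show ?thesis by (simp add: complexify_quotient)
qed

lemma complexify_sum: "complexify (\<Sum>i\<in>A. f i) = (\<Sum>i\<in>A. complexify (f i))"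
  by (induction A rule: infinite_finite_induct) simp_all

lemma complexify_diffop2:
  "complexify (diffop2 p q r f) = diffop2 (complexify p) (complexify q) (complexify r) (complexify f)"
  by (simp add: diffop2_def complexify_deriv)

lemma complexify_dop:
  assumes "dop L" obtains M where "dop M" "\<And>f. M (complexify f) = complexify (L f)"
proof -
  from assms obtain n c where c: "L = (\<lambda>f. \<Sum>i<n. c i * (fract_deriv ^^ i) f)"
    by (auto simp: dop_def ordlt_def)
  have D: "complexify ((fract_deriv ^^ i) f) = (fract_deriv ^^ i) (complexify f)" for i f
    by (induction i) (simp_all add: complexify_deriv)
  let ?M = "\<lambda>f. \<Sum>i<n. complexify (c i) * (fract_deriv ^^ i) f"
  have "dop ?M" unfolding dop_def ordlt_def by (intro exI[of _ n] exI[of _ "\<lambda>i. complexify (c i)"] refl)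
  then show ?thesis by (rule that) (simp add: c complexify_sum D)
qed

text \<open>The real monomials already form an infinite family with distinct degrees, on which
  \<open>dop_vanishing_infinite\<close> applies to the difference.\<close>

lemma dop_eq_on_real:
  assumes "dop T" "dop S" "\<And>u. T (to_fract (cpoly u)) = S (to_fract (cpoly u))"
  shows "T = S"
proof -
  have "(\<lambda>f. T f - S f) = (\<lambda>f. 0)"
  proof (rule dop_vanishing_infinite[OF dop_diff[OF assms(1,2)], of UNIV "\<lambda>k. cpoly (monom 1 k)"])
    show "infinite (UNIV :: nat set)" by (rule infinite_UNIV_nat)
    fix k :: nat
    show "degree (cpoly (monom 1 k)) = k" by (simp add: degree_monom_eq)
    show "cpoly (monom 1 k) \<noteq> 0" by simp
    show "T (to_fract (cpoly (monom 1 k))) - S (to_fract (cpoly (monom 1 k))) = 0"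
      unfolding assms(3) by (rule diff_self)
  qed
  then show ?thesis by (metis eq_iff_diff_eq_0 ext)
qed

section \<open>The natural form of the first-order coefficient\<close>

text \<open>Near \<open>c\<close> the quotient \<open>2 P \<eta>' / \<eta>\<close> contributes
  \<open>2 \<nu> P / (z - c)\<close>, which combines with \<open>Q\<close> to an expression
  divisible by the full power of \<open>z - c\<close> in \<open>g\<close>. The divisibility can be
  checked point by point.\<close>

lemma gauge_polynomial_dvd:
  fixes g P Q :: "complex poly" and \<nu> :: "complex \<Rightarrow> nat"
  assumes g: "g \<noteq> 0" and P: "\<And>c. [:-c, 1:] ^ order c g dvd P"
    and Q: "\<And>c. [:-c, 1:] ^ (order c g + 1) dvd [:-c, 1:] * Q + of_nat (2 * \<nu> c) * P"
    and \<nu>: "\<And>c. poly g c \<noteq> 0 \<Longrightarrow> \<nu> c = 0"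
    and \<eta>: "\<eta> = (\<Prod>c\<in>{c. poly g c = 0}. [:-c, 1:] ^ \<nu> c)"
  shows "g * \<eta> dvd \<eta> * Q + 2 * P * pderiv \<eta>"
proof (rule poly_dvd_by_roots)
  have fin: "finite {c. poly g c = 0}" using g by (rule poly_roots_finite)
  have \<eta>0: "\<eta> \<noteq> 0" unfolding \<eta> using fin by simp
  then show "g * \<eta> \<noteq> 0" using g by simp
  fix c n assume n: "[:-c, 1:] ^ n dvd g * \<eta>"
  let ?h = "[:-c, 1:]"
  let ?\<eta>1 = "\<Prod>b\<in>{b. poly g b = 0} - {c}. [:-b, 1:] ^ \<nu> b"
  have 1: "\<eta> = ?h ^ \<nu> c * ?\<eta>1"
  proof (cases "poly g c = 0")
    case True
    then show ?thesis unfolding \<eta> using fin by (subst prod.remove[of _ c]) auto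
  next
    case False
    then have "{b. poly g b = 0} - {c} = {b. poly g b = 0}" by auto
    then show ?thesis unfolding \<eta> using \<nu>[OF False] by simp
  qed
  have "poly ?\<eta>1 c \<noteq> 0" using fin by (simp add: poly_prod)
  then have o: "order c \<eta> = \<nu> c" by (subst 1) (rule order_power_mult)
  have "n \<le> order c (g * \<eta>)" using n g \<eta>0 by (simp add: order_divides)
  also have "\<dots> = order c g + \<nu> c" using g \<eta>0 by (simp add: order_mult o)
  finally have le: "n \<le> order c g + \<nu> c" .
  have "?h * pderiv \<eta> = ?h ^ \<nu> c * (of_nat (\<nu> c) * ?\<eta>1 + ?h * pderiv ?\<eta>1)"
    by (subst 1) (rule euler_power_mult)
  note h\<eta> = this
  have "?h * (\<eta> * Q + 2 * P * pderiv \<eta>) = \<eta> * (?h * Q) + 2 * P * (?h * pderiv \<eta>)"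
    by (simp only: distrib_left mult_ac)
  also have "\<dots> = \<eta> * (?h * Q) + 2 * P * (?h ^ \<nu> c * (of_nat (\<nu> c) * ?\<eta>1 + ?h * pderiv ?\<eta>1))"
    unfolding h\<eta> ..
  \<comment> \<open>Splitting off \<open>h ^ \<nu>\<close> exhibits the combination controlled by
    hypothesis \<open>Q\<close>; the other summand carries the extra factor
    \<open>h P\<close>.\<close>
  also have "\<dots> = ?h ^ \<nu> c * (?\<eta>1 * (?h * Q + of_nat (2 * \<nu> c) * P) + 2 * (?h * P) * pderiv ?\<eta>1)"
    by (subst 1) (simp only: of_nat_mult of_nat_numeral distrib_left distrib_right mult_ac add_ac)
  finally have e: "?h * (\<eta> * Q + 2 * P * pderiv \<eta>)
     = ?h ^ \<nu> c * (?\<eta>1 * (?h * Q + of_nat (2 * \<nu> c) * P) + 2 * (?h * P) * pderiv ?\<eta>1)" .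
  have "?h ^ (order c g + 1) dvd ?h * P"
    unfolding power_add power_one_right mult.commute[of _ ?h] by (intro mult_dvd_mono dvd_refl P)
  then have "?h ^ (order c g + 1) dvd ?\<eta>1 * (?h * Q + of_nat (2 * \<nu> c) * P) + 2 * (?h * P) * pderiv ?\<eta>1"
    by (intro dvd_add[OF dvd_mult[OF Q] dvd_mult2[OF dvd_mult]])
  then have "?h ^ \<nu> c * ?h ^ (order c g + 1) dvd ?h * (\<eta> * Q + 2 * P * pderiv \<eta>)"
    unfolding e by (intro mult_dvd_mono dvd_refl)
  moreover have "?h ^ \<nu> c * ?h ^ (order c g + 1) = ?h * ?h ^ (order c g + \<nu> c)"
    by (simp only: power_add power_one_right mult_ac)
  ultimately have "?h * ?h ^ (order c g + \<nu> c) dvd ?h * (\<eta> * Q + 2 * P * pderiv \<eta>)" by simp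
  then have "?h ^ (order c g + \<nu> c) dvd \<eta> * Q + 2 * P * pderiv \<eta>"
    by (subst (asm) dvd_mult_cancel_left) simp
  then show "?h ^ n dvd \<eta> * Q + 2 * P * pderiv \<eta>" using le by (meson dvd_trans le_imp_power_dvd)
qed

abbreviation cnjpoly :: "complex poly \<Rightarrow> complex poly" where "cnjpoly \<equiv> map_poly cnj"

lemma cnjpoly_mult: "cnjpoly (u * v) = cnjpoly u * cnjpoly v"
  by (rule map_poly_hom_mult) simp_all

lemma cnjpoly_add: "cnjpoly (u + v) = cnjpoly u + cnjpoly v"
  by (rule map_poly_hom_add) simp_all

lemma cnjpoly_power: "cnjpoly (u ^ n) = cnjpoly u ^ n"
  by (induction n) (simp_all add: cnjpoly_mult)

lemma cnjpoly_prod: "cnjpoly (\<Prod>i\<in>A. f i) = (\<Prod>i\<in>A. cnjpoly (f i))"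
  by (induction A rule: infinite_finite_induct) (simp_all add: cnjpoly_mult)

lemma cnjpoly_cpoly: "cnjpoly (cpoly u) = cpoly u"
  by (rule poly_eqI) (simp add: coeff_map_poly)

lemma cnjpoly_linear: "cnjpoly [:-c, 1:] = [:-cnj c, 1:]"
  by (rule poly_eqI) (simp add: coeff_map_poly coeff_pCons split: nat.splits)

lemma cnjpoly_of_nat: "cnjpoly (of_nat n) = of_nat n"
  by (rule poly_eqI) (simp add: coeff_map_poly of_nat_poly coeff_pCons split: nat.splits)

lemma cnjpoly_dvd: "u dvd v \<Longrightarrow> cnjpoly u dvd cnjpoly v"
  by (auto elim!: dvdE simp: cnjpoly_mult)

lemma cnj_power_dvd:
  assumes "cnjpoly v = v" shows "[:-cnj c, 1:] ^ n dvd v \<longleftrightarrow> [:-c, 1:] ^ n dvd v"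
  using cnjpoly_dvd[of "[:-cnj c, 1:] ^ n" v] cnjpoly_dvd[of "[:-c, 1:] ^ n" v] assms
  by (auto simp: cnjpoly_power cnjpoly_linear)

lemma order_cnj:
  assumes "cnjpoly v = v" "v \<noteq> 0" shows "order (cnj c) v = order c v"
  using cnj_power_dvd[OF assms(1)] assms(2) by (metis order_1 order_divides dual_order.antisym)

lemma cnjpoly_fixed_imp_real:
  assumes "cnjpoly u = u" obtains v where "u = cpoly v"
proof
  have "coeff u i = complex_of_real (Re (coeff u i))" for i
    using arg_cong[OF assms, of "\<lambda>u. coeff u i"] by (simp add: coeff_map_poly complex_eq_iff)
  then show "u = cpoly (map_poly Re u)" by (intro poly_eqI) (simp add: coeff_map_poly)
qed

text \<open>The exponents belong to complex points, while \<open>\<eta>\<close> must be real to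
  enter the functional of the weight. The local conditions are invariant under conjugation, so
  conjugate points can be given equal exponents.\<close>

theorem natural_gauge:
  fixes p q r :: "real poly fract"
  assumes "cleared_eigensystem p q r K y ev g P Q R"
  obtains pp \<eta> where "P = g * pp" "\<eta> \<noteq> 0" "g * \<eta> dvd \<eta> * Q + 2 * P * pderiv \<eta>"
proof -
  interpret cleared_eigensystem p q r K y ev g P Q R by fact
  interpret C: cleared_eigensystem "complexify p" "complexify q" "complexify r" K "\<lambda>k. cpoly (y k)"
    "\<lambda>k. complex_of_real (ev k)" "cpoly g" "cpoly P" "cpoly Q" "cpoly R"
  proof
    show "complexify p \<noteq> 0" using p_nz by simp
    show "finite K" by (rule finite_K)
    show "degree (cpoly (y k)) = k" "cpoly (y k) \<noteq> 0" if "k \<notin> K" for k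
      using deg_y[OF that] y_nz[OF that] by simp_all
    show "diffop2 (complexify p) (complexify q) (complexify r) (to_fract (cpoly (y k)))
      = constf (complex_of_real (ev k)) * to_fract (cpoly (y k))" if "k \<notin> K" for k
      using arg_cong[OF eigen[OF that], of complexify] by (simp add: complexify_diffop2)
    show "cpoly g \<noteq> 0" using g_nz by simp
    show "to_fract (cpoly g) * complexify p = to_fract (cpoly P)"
      using arg_cong[OF gp, of complexify] by simp
    show "to_fract (cpoly g) * complexify q = to_fract (cpoly Q)"
      using arg_cong[OF gq, of complexify] by simp
    show "to_fract (cpoly g) * complexify r = to_fract (cpoly R)"
      using arg_cong[OF gr, of complexify] by simp
  qed
  define good where "good c n \<longleftrightarrow> [:-c, 1:] ^ (order c (cpoly g) + 1) dvd
    [:-c, 1:] * cpoly Q + of_nat (2 * n) * cpoly P" for c and n :: nat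
  \<comment> \<open>Taking the least admissible exponent makes the choice canonical, hence
    conjugation-invariant, and gives 0 off the zeros of \<open>g\<close>.\<close>
  define \<nu> where "\<nu> c = (LEAST n. good c n)" for c
  have good: "good c (\<nu> c)" for c
    unfolding \<nu>_def by (rule LeastI_ex) (unfold good_def, rule C.local_structure(2))
  have \<nu>0: "\<nu> c = 0" if "poly (cpoly g) c \<noteq> 0" for c
  proof -
    have "good c 0" using C.local_structure(3)[OF order_0I[OF that]] unfolding good_def
      by (simp only: mult_0_right of_nat_0 mult_zero_left add_0_right)
    then show ?thesis unfolding \<nu>_def by (rule Least_eq_0)
  qed
  have good_cnj: "good (cnj c) n" if "good c n" for c n
    using cnjpoly_dvd[OF that[unfolded good_def]] order_cnj[OF cnjpoly_cpoly, of g c] g_nz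
    unfolding good_def
    by (simp only: cnjpoly_power cnjpoly_mult cnjpoly_add cnjpoly_of_nat cnjpoly_linear cnjpoly_cpoly
        cpoly_eq_0_iff simp_thms)
  have "good (cnj c) n \<longleftrightarrow> good c n" for c n
    using good_cnj[of c n] good_cnj[of "cnj c" n] by auto
  then have \<nu>_cnj: "\<nu> (cnj c) = \<nu> c" for c by (simp add: \<nu>_def)
  define Z where "Z = {c. poly (cpoly g) c = 0}"
  have Z_cnj: "cnj c \<in> Z" if "c \<in> Z" for c
    using that poly_cnj[of "cpoly g" c] by (simp add: Z_def cnjpoly_cpoly)
  define \<eta> where "\<eta> = (\<Prod>c\<in>Z. [:-c, 1:] ^ \<nu> c)"
  have "cnjpoly \<eta> = (\<Prod>c\<in>Z. [:-cnj c, 1:] ^ \<nu> (cnj c))"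
    unfolding \<eta>_def cnjpoly_prod cnjpoly_power cnjpoly_linear \<nu>_cnj ..
  also have "\<dots> = \<eta>"
    unfolding \<eta>_def by (rule prod.reindex_bij_witness[of _ cnj cnj]) (auto simp: Z_cnj)
  finally obtain \<eta>r where \<eta>r: "\<eta> = cpoly \<eta>r" by (rule cnjpoly_fixed_imp_real)
  have "finite Z" unfolding Z_def by (rule poly_roots_finite) (use g_nz in simp)
  then have "\<eta> \<noteq> 0" by (simp add: \<eta>_def)
  then have \<eta>r0: "\<eta>r \<noteq> 0" using \<eta>r by simp
  have "cpoly g * \<eta> dvd \<eta> * cpoly Q + 2 * cpoly P * pderiv \<eta>"
    by (rule gauge_polynomial_dvd[OF _ C.local_structure(1) good[unfolded good_def] \<nu>0 \<eta>_def[unfolded Z_def]])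
      (use g_nz in simp_all)
  then have "cpoly (g * \<eta>r) dvd cpoly (\<eta>r * Q + 2 * P * pderiv \<eta>r)"
    by (simp add: \<eta>r)
  then have 1: "g * \<eta>r dvd \<eta>r * Q + 2 * P * pderiv \<eta>r"
    using g_nz \<eta>r0 by (subst (asm) cpoly_dvd_iff) simp_all
  have "cpoly g dvd cpoly P"
  proof (rule poly_dvd_by_roots)
    fix c n assume "[:-c, 1:] ^ n dvd cpoly g"
    then have "n \<le> order c (cpoly g)" using g_nz by (simp add: order_divides)
    then show "[:-c, 1:] ^ n dvd cpoly P"
      using C.local_structure(1)[of c] by (meson dvd_trans le_imp_power_dvd)
  qed (use g_nz in simp)
  then have "g dvd P" using g_nz by (simp add: cpoly_dvd_iff)
  then obtain pp where "P = g * pp" by (elim dvdE)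
  then show ?thesis using \<eta>r0 1 by (rule that)
qed

section \<open>The functional of the weight\<close>

text \<open>L'Hopital's rule for the difference quotient; it carries the derivative of
  \<open>h p W\<close> across the isolated points where the weight formula is not imposed.\<close>

lemma has_derivative_removable:
  fixes f f' :: "real \<Rightarrow> real"
  assumes "isCont f x" "isCont f' x"
    and "eventually (\<lambda>y. (f has_real_derivative f' y) (at y)) (at x)"
  shows "(f has_real_derivative f' x) (at x)"
proof -
  have "((\<lambda>y. (f y - f x) / (y - x)) \<longlongrightarrow> f' x) (at x)"
  proof (rule lhopital[where f' = f' and g' = "\<lambda>_. 1"])
    show "((\<lambda>y. f y - f x) \<longlongrightarrow> 0) (at x)" using assms(1) by (simp add: isCont_def LIM_zero_iff)
    show "((\<lambda>y. y - x) \<longlongrightarrow> 0) (at x)" by (simp add: LIM_zero_iff)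
    show "eventually (\<lambda>y. y - x \<noteq> 0) (at x)" by (simp add: eventually_at_filter)
    show "eventually (\<lambda>y. ((\<lambda>y. f y - f x) has_real_derivative f' y) (at y)) (at x)"
      using assms(3) by eventually_elim (auto intro!: derivative_eq_intros)
    show "eventually (\<lambda>y. ((\<lambda>y. y - x) has_real_derivative 1) (at y)) (at x)"
      by (intro always_eventually allI) (auto intro!: derivative_eq_intros)
    show "((\<lambda>y. f' y / 1) \<longlongrightarrow> f' x) (at x)" using assms(2) by (simp add: isCont_def)
  qed simp
  then show ?thesis by (simp add: has_field_derivative_iff)
qed

lemma poly_num_den:
  fixes a b :: "'a::field_gcd poly"
  assumes "b \<noteq> 0" shows "num (to_fract a / to_fract b) * b = a * den (to_fract a / to_fract b)"
proof -
  define f where "f = to_fract a / to_fract b"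
  have "to_fract (den f) * f * to_fract b = to_fract (num f) * to_fract b" by (simp only: to_fract_den_mult)
  moreover have "f * to_fract b = to_fract a" using assms by (simp add: f_def)
  ultimately have "to_fract (num f * b) = to_fract (a * den f)"
    by (simp only: to_fract_mult mult.assoc) (simp only: mult.commute)
  then show ?thesis by (simp only: to_fract_eq_iff f_def)
qed

lemma fract_eval_to_fract: "fract_eval (to_fract u) x = poly u x"
  by (simp add: fract_eval_def)

locale weight =
  fixes p q :: "real poly fract" and pp :: "real poly" and a b :: ereal and W :: "real \<Rightarrow> real"
  assumes p: "p = to_fract pp" "pp \<noteq> 0" and ab: "a < b" and W: "sl_weight p q a b W"
    and moments: "\<And>j. set_integrable lborel (einterval a b) (\<lambda>x. x ^ j * W x)"
    and boundary: "\<And>u. ((\<lambda>e. let x = real_of_ereal e in poly u x * fract_eval p x * W x) \<longlongrightarrow> 0) (at_right a)"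
      "\<And>u. ((\<lambda>e. let x = real_of_ereal e in poly u x * fract_eval p x * W x) \<longlongrightarrow> 0) (at_left b)"
begin

abbreviation "I \<equiv> einterval a b"

definition bad :: "real set" where "bad = poles (q / p) \<union> poles (1 / p)"

lemma finite_bad: "finite bad"
  unfolding bad_def poles_def by (simp add: poly_roots_finite)

lemma W_pos: "x \<in> I \<Longrightarrow> W x > 0"
  using W by (simp add: sl_weight_def)

lemma W_cont: "x \<in> I \<Longrightarrow> isCont W x"
  using W open_einterval[of a b] by (simp add: sl_weight_def continuous_on_eq_continuous_at)

lemma pp_nonzero: assumes "x \<notin> bad" shows "poly pp x \<noteq> 0"
proof
  assume "poly pp x = 0"
  have "num (to_fract 1 / to_fract pp) * pp = 1 * den (to_fract 1 / to_fract pp)"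
    using p(2) by (rule poly_num_den)
  then have "num (1 / p) * pp = den (1 / p)" by (simp add: p)
  then have "poly (den (1 / p)) x = 0" using \<open>poly pp x = 0\<close> by (metis mult_zero_right poly_mult)
  then show False using assms by (simp add: bad_def poles_def)
qed

text \<open>Near \<open>x\<close> the weight formula gives \<open>pp * W = C * exp F\<close>.
  Differentiating \<open>h * C * exp F\<close> yields \<open>(h' + (q / p) h) pp W\<close>, which is
  \<open>s W\<close>.\<close>

lemma deriv_good_point:
  assumes x: "x \<in> I" "x \<notin> bad" and h: "to_fract s = p * to_fract (pderiv h) + q * to_fract h"
  shows "((\<lambda>x. poly h x * poly pp x * W x) has_real_derivative poly s x * W x) (at x)"
proof -
  have "open (I - bad)" using finite_bad by (intro open_Diff open_einterval finite_imp_closed)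
  then obtain e where e: "e > 0" "\<And>y. dist y x < e \<Longrightarrow> y \<in> I - bad"
    using x unfolding open_dist by blast
  have sub: "einterval (ereal (x - e)) (ereal (x + e)) \<subseteq> I - bad"
  proof
    fix y assume "y \<in> einterval (ereal (x - e)) (ereal (x + e))"
    then have "dist y x < e" by (auto simp: dist_real_def)
    then show "y \<in> I - bad" by (rule e(2))
  qed
  have "{x - e<..<x + e} \<subseteq> I" using sub by auto
  \<comment> \<open>If the left end of the neighbourhood lay below \<open>a\<close>, a point between
    the two would belong to the neighbourhood but not to \<open>I\<close>.\<close>
  have "a \<le> ereal (x - e)"
  proof (rule ccontr)
    assume "\<not> a \<le> ereal (x - e)"
    then have "ereal (x - e) < a" by simp
    then obtain z where z: "ereal (x - e) < ereal z" "ereal z < a" using ereal_dense2 by blast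
    have "a < ereal x" using x(1) by (simp add: einterval_iff)
    then have "z < x" using z(2) by (metis less_ereal.simps(1) less_trans)
    then have "z \<in> I" using z(1) \<open>{x - e<..<x + e} \<subseteq> I\<close> e(1) by auto
    then show False using z(2) by (auto simp: einterval_iff dest: less_asym)
  qed
  moreover have "ereal (x + e) \<le> b"
  proof (rule ccontr)
    assume "\<not> ereal (x + e) \<le> b"
    then have "b < ereal (x + e)" by simp
    then obtain z where z: "b < ereal z" "ereal z < ereal (x + e)" using ereal_dense2 by blast
    have "ereal x < b" using x(1) by (simp add: einterval_iff)
    then have "x < z" using z(1) by (metis less_ereal.simps(1) less_trans)
    then have "z \<in> I" using z(2) \<open>{x - e<..<x + e} \<subseteq> I\<close> e(1) by auto
    then show False using z(1) by (auto simp: einterval_iff dest: less_asym)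
  qed
  moreover have "einterval (ereal (x - e)) (ereal (x + e)) \<inter> (poles (q / p) \<union> poles (1 / p)) = {}"
    using sub by (auto simp: bad_def)
  ultimately obtain C F where CF: "\<And>y. y \<in> einterval (ereal (x - e)) (ereal (x + e)) \<Longrightarrow>
      (F has_real_derivative fract_eval (q / p) y) (at y) \<and> W y = C * (fract_eval (1 / p) y * exp (F y))"
    using W unfolding sl_weight_def by metis
  have pW: "poly pp y * W y = C * exp (F y)" if y: "y \<in> {x - e<..<x + e}" for y
  proof -
    have "y \<notin> bad" using sub y by auto
    then have n: "poly pp y \<noteq> 0" by (rule pp_nonzero)
    have "num (to_fract 1 / to_fract pp) * pp = 1 * den (to_fract 1 / to_fract pp)"
      using p(2) by (rule poly_num_den)
    then have "num (1 / p) * pp = den (1 / p)" by (simp add: p)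
    then have "poly (num (1 / p)) y * poly pp y = poly (den (1 / p)) y" by (metis poly_mult)
    moreover have "poly (den (1 / p)) y \<noteq> 0" using \<open>y \<notin> bad\<close> by (simp add: bad_def poles_def)
    ultimately have "poly pp y * fract_eval (1 / p) y = 1" by (simp add: fract_eval_def mult.commute)
    moreover have "W y = C * (fract_eval (1 / p) y * exp (F y))" using CF[of y] y by simp
    ultimately show ?thesis by (metis mult.commute mult.left_commute mult_1)
  qed
  define Q where "Q = fract_eval (q / p) x"
  have "((\<lambda>y. poly h y * (C * exp (F y))) has_real_derivative
      poly (pderiv h) x * (C * exp (F x)) + poly h x * (C * (exp (F x) * Q))) (at x)"
    using CF[of x] e(1) by (auto intro!: derivative_eq_intros simp: Q_def)
  moreover have "poly (pderiv h) x * (C * exp (F x)) + poly h x * (C * (exp (F x) * Q)) = poly s x * W x"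
  proof -
    define n d where "n = num (q / p)" and "d = den (q / p)"
    have pn: "p \<noteq> 0" by (simp add: p)
    have "to_fract d * (q / p) = to_fract n" unfolding n_def d_def by (rule to_fract_den_mult)
    then have qd: "to_fract d * q = to_fract n * p" using pn by (simp add: field_simps)
    have "to_fract (d * s) = p * to_fract (d * pderiv h) + (to_fract d * q) * to_fract h"
      using h by (simp add: algebra_simps)
    also have "\<dots> = to_fract (pp * (d * pderiv h + n * h))"
      unfolding qd by (simp add: p algebra_simps)
    finally have "d * s = pp * (d * pderiv h + n * h)" by (simp only: to_fract_eq_iff)
    then have ds: "poly d x * poly s x = poly pp x * (poly d x * poly (pderiv h) x + poly n x * poly h x)"
      by (metis poly_add poly_mult)
    have d0: "poly d x \<noteq> 0" using x(2) by (simp add: bad_def poles_def d_def)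
    have nQ: "poly n x = Q * poly d x" using d0 by (simp add: Q_def fract_eval_def n_def[symmetric] d_def[symmetric])
    have "poly d x * poly s x = poly d x * (poly pp x * (poly (pderiv h) x + Q * poly h x))"
      unfolding ds nQ by (simp only: distrib_left mult_ac)
    then have s: "poly s x = poly pp x * (poly (pderiv h) x + Q * poly h x)" using d0 by simp
    have "poly (pderiv h) x * (C * exp (F x)) + poly h x * (C * (exp (F x) * Q))
      = (C * exp (F x)) * (poly (pderiv h) x + Q * poly h x)" by (simp add: algebra_simps)
    also have "\<dots> = poly s x * W x" unfolding s using pW[of x] e(1) by simp
    finally show ?thesis .
  qed
  ultimately have D: "((\<lambda>y. poly h y * (C * exp (F y))) has_real_derivative poly s x * W x) (at x)" by simp
  show ?thesis
  proof (rule has_field_derivative_transform_within_open[OF D])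
    show "open {x - e<..<x + e}" "x \<in> {x - e<..<x + e}" using e(1) by auto
    show "poly h y * (C * exp (F y)) = poly h y * poly pp y * W y" if "y \<in> {x - e<..<x + e}" for y
      using pW[OF that] by (simp add: mult.assoc)
  qed
qed

text \<open>The constant \<open>C\<close> may differ on the two sides of a point of
  \<open>bad\<close>, but the derivative \<open>s W\<close> does not involve it, so the formula
  extends by continuity.\<close>

lemma deriv_point:
  assumes x: "x \<in> I" and h: "to_fract s = p * to_fract (pderiv h) + q * to_fract h"
  shows "((\<lambda>x. poly h x * poly pp x * W x) has_real_derivative poly s x * W x) (at x)"
proof (rule has_derivative_removable)
  show "isCont (\<lambda>x. poly h x * poly pp x * W x) x" "isCont (\<lambda>x. poly s x * W x) x"
    using W_cont[OF x] by (auto intro!: continuous_intros)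
  have "eventually (\<lambda>y. y \<in> I) (at x)"
    using x by (intro eventually_at_in_open') auto
  moreover have "eventually (\<lambda>y. y \<notin> bad) (at x)"
  proof -
    have "open (- (bad - {x}))" using finite_bad by (intro open_Compl finite_imp_closed) simp
    then have "eventually (\<lambda>y. y \<in> - (bad - {x}) - {x}) (at x)"
      by (rule eventually_at_in_open) simp
    then show ?thesis by eventually_elim auto
  qed
  ultimately show "eventually (\<lambda>y. ((\<lambda>x. poly h x * poly pp x * W x) has_real_derivative poly s y * W y) (at y)) (at x)"
    by eventually_elim (rule deriv_good_point[OF _ _ h])
qed

lemma poly_integrable: "set_integrable lborel I (\<lambda>x. poly f x * W x)"
proof -
  have "set_integrable lborel I (\<lambda>x. x ^ j * poly f x * W x)" for j
  proof (induction f arbitrary: j)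
    case (pCons c f)
    have "set_integrable lborel I (\<lambda>x. c * (x ^ j * W x) + x ^ Suc j * poly f x * W x)"
      by (intro set_integral_add(1) set_integrable_mult_right pCons.IH impI moments)
    then show ?case by (simp add: algebra_simps)
  qed (simp add: set_integrable_def)
  from this[of 0] show ?thesis by simp
qed

definition Lf :: "real poly \<Rightarrow> real" where "Lf f = (LINT x:I|lborel. poly f x * W x)"

lemma Lf_add: "Lf (f + g) = Lf f + Lf g"
  unfolding Lf_def by (simp add: distrib_right set_integral_add(2)[OF poly_integrable poly_integrable])

lemma Lf_smult: "Lf (smult c f) = c * Lf f"
  unfolding Lf_def by (simp add: mult.assoc)

text \<open>The integrand is the derivative of \<open>h p W\<close>, which tends to 0 at both ends
  of the interval.\<close>

lemma Lf_pearson: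
  assumes h: "to_fract s = p * to_fract (pderiv h) + q * to_fract h" shows "Lf s = 0"
proof -
  have "(LBINT x=a..b. poly s x * W x) = 0 - 0"
  proof (rule interval_integral_FTC_integrable[OF ab])
    fix x assume "a < ereal x" "ereal x < b"
    then have x: "x \<in> I" by (simp add: einterval_iff)
    show "((\<lambda>x. poly h x * poly pp x * W x) has_vector_derivative poly s x * W x) (at x)"
      using deriv_point[OF x h] by (simp add: has_real_derivative_iff_has_vector_derivative)
    show "isCont (\<lambda>x. poly s x * W x) x" using W_cont[OF x] by (auto intro!: continuous_intros)
  next
    show "set_integrable lborel I (\<lambda>x. poly s x * W x)" by (rule poly_integrable)
    show "(((\<lambda>x. poly h x * poly pp x * W x) \<circ> real_of_ereal) \<longlongrightarrow> 0) (at_right a)"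
      "(((\<lambda>x. poly h x * poly pp x * W x) \<circ> real_of_ereal) \<longlongrightarrow> 0) (at_left b)"
      using boundary[of h] by (simp_all add: Let_def p(1) fract_eval_to_fract comp_def)
  qed
  then show ?thesis using ab by (simp add: Lf_def interval_lebesgue_integral_le_eq)
qed

text \<open>A zero integral would make \<open>I\<close> a null set, since \<open>W > 0\<close> there
  and \<open>f\<close> has finitely many roots; but \<open>I\<close> contains a ball.\<close>

lemma Lf_pos: assumes "f \<noteq> 0" shows "Lf (f * f) > 0"
proof -
  let ?g = "\<lambda>x. indicator I x *\<^sub>R (poly (f * f) x * W x)"
  have nn: "?g x \<ge> 0" for x using W_pos[of x] by (auto simp: indicator_def)
  have int: "integrable lborel ?g" using poly_integrable[of "f * f"] by (simp add: set_integrable_def)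
  have Lg: "Lf (f * f) = (LINT x|lborel. ?g x)" by (simp add: Lf_def set_lebesgue_integral_def)
  have "(LINT x|lborel. ?g x) \<noteq> 0"
  proof
    assume "(LINT x|lborel. ?g x) = 0"
    then have "AE x in lborel. ?g x = 0"
      using integral_nonneg_eq_0_iff_AE[OF int] nn by simp
    moreover have "AE x in lborel. x \<notin> {x. poly f x = 0}"
      using poly_roots_finite[OF assms]
      by (intro AE_not_in countable_imp_null_set_lborel countable_finite)
    ultimately have AE: "AE x in lborel. x \<notin> I"
    proof eventually_elim
      case (elim x)
      then show ?case using W_pos[of x] by (auto simp: indicator_def)
    qed
    obtain x0 where "x0 \<in> I" using einterval_nonempty[OF ab] by blast
    then obtain e where e: "e > 0" "ball x0 e \<subseteq> I" using open_einterval[of a b] by (meson openE)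
    then have "AE x in lborel. x \<notin> {x0 - e<..<x0 + e}"
      using AE by (auto simp: ball_eq_greaterThanLessThan elim!: eventually_mono)
    then have "{x0 - e<..<x0 + e} \<in> null_sets lborel" by (simp add: AE_iff_null_sets)
    then have "emeasure lborel {x0 - e<..<x0 + e} = 0" by blast
    then show False using e(1) by simp
  qed
  moreover have "(LINT x|lborel. ?g x) \<ge> 0" using nn by (intro integral_nonneg_AE) simp
  ultimately show ?thesis unfolding Lg by linarith
qed

end

section \<open>Positive functionals satisfying a Pearson equation\<close>

text \<open>In the application \<open>M f\<close> is the integral of \<open>\<eta>^2 f W\<close> and
  \<open>M_pearson\<close> is integration by parts. The weight never has to be computed: test
  polynomials settle the possible shapes of \<open>pp\<close> and \<open>qt\<close>.\<close>

locale pearson_functional =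
  fixes M :: "real poly \<Rightarrow> real" and pp qt :: "real poly"
  assumes M_add: "\<And>f g. M (f + g) = M f + M g" and M_smult: "\<And>c f. M (smult c f) = c * M f"
    and M_pos: "\<And>f. f \<noteq> 0 \<Longrightarrow> M (f * f) > 0"
    and M_pearson: "\<And>w. M (pp * pderiv w + qt * w) = 0"
    and pp_nz: "pp \<noteq> 0" and deg_pp: "degree pp \<le> 2" and deg_qt: "degree qt \<le> 1"
begin

lemma qt_eq: "qt = [:coeff qt 0, coeff qt 1:]"
  using deg_qt by (intro poly_eqI) (auto simp: coeff_pCons coeff_eq_0 split: nat.splits)

lemma M_one_pos: "M 1 > 0"
  using M_pos[of 1] by simp

text \<open>The test polynomial \<open>w = qt\<close> gives
  \<open>p0 * coeff qt 1 * M 1 = - M (qt * qt)\<close>; if \<open>qt = 0\<close>, the choice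
  \<open>w = z\<close> gives \<open>p0 * M 1 = 0\<close>, which is impossible.\<close>

lemma degree_0_case:
  assumes "pp = [:p0:]" shows "p0 * coeff qt 1 < 0"
proof (cases "qt = 0")
  case True
  then have "p0 * M 1 = 0" using M_pearson[of "[:0, 1:]"] assms M_smult[of p0 1] by (simp add: pderiv_pCons)
  then show ?thesis using M_one_pos pp_nz assms by simp
next
  case False
  have "pderiv qt = [:coeff qt 1:]" by (subst qt_eq) (simp add: pderiv_pCons)
  then have "pp * pderiv qt = smult (p0 * coeff qt 1) 1" using assms by (simp add: mult.commute)
  then have "p0 * coeff qt 1 * M 1 + M (qt * qt) = 0" using M_pearson[of qt] by (simp only: M_add M_smult)
  then have "p0 * coeff qt 1 * M 1 < 0" using M_pos[OF False] by linarith
  then show ?thesis using M_one_pos by (simp add: mult_less_0_iff)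
qed

text \<open>If \<open>qt\<close> were constant, \<open>w = 1\<close> would force
  \<open>qt = 0\<close>, and then \<open>w = pp * pp\<close> would give
  \<open>M (pp * pp) = 0\<close>.\<close>

lemma degree_1_case:
  assumes "degree pp = 1" shows "coeff qt 1 \<noteq> 0"
proof
  assume B: "coeff qt 1 = 0"
  have pp: "pp = [:coeff pp 0, coeff pp 1:]"
    using assms by (intro poly_eqI) (auto simp: coeff_pCons coeff_eq_0 split: nat.splits)
  define p1 where "p1 = coeff pp 1"
  have p1: "p1 \<noteq> 0" using assms pp_nz by (metis leading_coeff_0_iff p1_def)
  have d: "pderiv pp = [:p1:]" by (subst pp) (simp add: pderiv_pCons p1_def)
  have qt: "qt = [:coeff qt 0:]" using qt_eq B by simp
  have "coeff qt 0 * M 1 = 0"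
    using M_pearson[of 1] M_smult[of "coeff qt 0" 1] qt by simp
  then have "qt = 0" using M_one_pos qt by simp
  have "pderiv (pp * pp) = smult p1 pp + smult p1 pp" by (simp add: pderiv_mult d)
  then have "pderiv (pp * pp) = smult (2 * p1) pp" by (simp only: mult_2 smult_add_left)
  then have "M (smult (2 * p1) (pp * pp)) = 0"
    using M_pearson[of "pp * pp"] \<open>qt = 0\<close> by simp
  then show False using M_pos[OF pp_nz] p1 by (simp only: M_smult mult_eq_0_iff) simp
qed

text \<open>Completing the square writes \<open>pp = A (x^2 + w)\<close>. For \<open>w >= 0\<close>
  the test polynomials \<open>x ^ (n + 1)\<close> give a three-term moment recurrence that
  contradicts Cauchy-Schwarz for large \<open>n\<close>, so \<open>w < 0\<close> and the roots are
  real and distinct.\<close>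

lemma degree_2_case:
  assumes "degree pp = 2"
  obtains x1 x2 where "x1 < x2" "pp = smult (coeff pp 2) ([:-x1, 1:] * [:-x2, 1:])"
proof -
  define A where "A = coeff pp 2"
  have A: "A \<noteq> 0" using assms pp_nz by (metis A_def leading_coeff_0_iff)
  have pp: "pp = [:coeff pp 0, coeff pp 1, A:]"
    using assms by (intro poly_eqI) (auto simp: A_def coeff_pCons coeff_eq_0 numeral_2_eq_2 split: nat.splits)
  define z where "z = - coeff pp 1 / (2 * A)"
  define w where "w = coeff pp 0 / A - z\<^sup>2"
  define x where "x = [:-z, 1:]"
  have ppx: "pp = smult A (x * x + [:w:])"
    using A by (subst pp) (simp add: x_def w_def z_def power2_eq_square field_simps)
  show ?thesis
  proof (cases "w < 0")
    case True
    define s where "s = sqrt (- w)"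
    have s: "s > 0" "s * s = - w" using True by (simp_all add: s_def)
    have "[:-(z - s), 1:] * [:-(z + s), 1:] = [:z * z - s * s, - 2 * z, 1:]"
      by (simp add: algebra_simps)
    also have "\<dots> = x * x + [:w:]" unfolding s(2) by (simp add: x_def)
    finally have "pp = smult (coeff pp 2) ([:-(z - s), 1:] * [:-(z + s), 1:])"
      using ppx by (simp only: A_def)
    then show ?thesis using s(1) by (intro that[of "z - s" "z + s"]) auto
  next
    case False
    define b c where "b = coeff qt 1 / A" and "c = (coeff qt 0 + coeff qt 1 * z) / A"
    have qtx: "qt = smult A (smult b x + [:c:])"
      using A by (subst qt_eq) (simp add: x_def b_def c_def flip: diff_divide_distrib)
    have dx: "pderiv x = 1" by (simp add: x_def pderiv_pCons)
    define m where "m n = M (x ^ n)" for n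
    have rec: "(real (Suc n) + b) * m (Suc (Suc n)) + real (Suc n) * w * m n + c * m (Suc n) = 0" for n
    proof -
      have "pderiv (x ^ Suc n) = smult (real (Suc n)) (x ^ n)"
        unfolding pderiv_power_Suc dx by simp
      then have "pp * pderiv (x ^ Suc n) + qt * x ^ Suc n =
        smult A (smult (real (Suc n) + b) (x ^ Suc (Suc n)) + smult (real (Suc n) * w) (x ^ n) + smult c (x ^ Suc n))"
        by (simp add: ppx qtx algebra_simps smult_add_left smult_add_right)
      then show ?thesis using M_pearson[of "x ^ Suc n"] A by (simp add: M_add M_smult m_def del: power_Suc)
    qed
    have x0: "x ^ n \<noteq> 0" for n by (simp add: x_def)
    have pos: "m (2 * k) > 0" for k
      using M_pos[OF x0[of k]] by (simp add: m_def mult_2 power_add)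
    \<comment> \<open>Here \<open>t\<close> minimises \<open>M\<close> of the square of
      \<open>x ^ k (x - t)\<close>; positivity of the minimum is the strict Cauchy-Schwarz
      inequality.\<close>
    have CS: "(m (2 * k + 1))\<^sup>2 < m (2 * k) * m (2 * k + 2)" for k
    proof -
      define t where "t = m (2 * k + 1) / m (2 * k)"
      have "x - [:t:] \<noteq> 0" by (simp add: x_def)
      then have "x ^ k * (x - [:t:]) \<noteq> 0" using x0 by simp
      note M_pos[OF this]
      moreover have "x ^ k * (x - [:t:]) * (x ^ k * (x - [:t:]))
        = x ^ (2 * k + 2) + smult (- 2 * t) (x ^ (2 * k + 1)) + smult (t\<^sup>2) (x ^ (2 * k))"
      proof -
        have "(x - [:t:]) * (x - [:t:]) = x * x + smult (- 2 * t) x + smult (t\<^sup>2) 1"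
          by (simp add: x_def power2_eq_square algebra_simps)
        then have "x ^ k * (x - [:t:]) * (x ^ k * (x - [:t:]))
          = (x ^ k * x ^ k) * (x * x + smult (- 2 * t) x + smult (t\<^sup>2) 1)"
          by (metis mult.assoc mult.left_commute)
        also have "\<dots> = x ^ (2 * k + 2) + smult (- 2 * t) (x ^ (2 * k + 1)) + smult (t\<^sup>2) (x ^ (2 * k))"
        proof -
          have "x ^ k * x ^ k = x ^ (2 * k)" by (simp add: mult_2 power_add)
          then show ?thesis
            by (simp only: distrib_left mult_smult_right mult_1_right power_add power2_eq_square
                power_one_right mult_ac mult_smult_left mult_1_left)
        qed
        finally show ?thesis .
      qed
      ultimately have "M (x ^ (2 * k + 2) + smult (- 2 * t) (x ^ (2 * k + 1)) + smult (t\<^sup>2) (x ^ (2 * k))) > 0"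
        by simp
      then have "m (2 * k + 2) - 2 * t * m (2 * k + 1) + t\<^sup>2 * m (2 * k) > 0"
        by (simp only: M_add M_smult m_def)
      then have "m (2 * k) * (m (2 * k + 2) - 2 * t * m (2 * k + 1) + t\<^sup>2 * m (2 * k)) > 0"
        using pos[of k] by (rule mult_pos_pos[rotated])
      moreover have tm: "t * m (2 * k) = m (2 * k + 1)" using pos[of k] by (simp add: t_def)
      moreover have "m (2 * k) * (m (2 * k + 2) - 2 * t * m (2 * k + 1) + t\<^sup>2 * m (2 * k))
        = m (2 * k) * m (2 * k + 2) - 2 * (t * m (2 * k)) * m (2 * k + 1) + (t * m (2 * k))\<^sup>2"
        by (simp add: algebra_simps power2_eq_square)
      ultimately show ?thesis by (simp add: power2_eq_square)
    qed
    \<comment> \<open>The first bound makes \<open>2 k + 1 + b\<close> at least \<open>k\<close>;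
      the second lets the term with \<open>w\<close> outweigh \<open>c^2\<close>.\<close>
    obtain k :: nat where k: "real k > \<bar>b\<bar> + 1" "real k * w > c\<^sup>2 \<or> w = 0"
    proof -
      obtain k :: nat where "real k > max (\<bar>b\<bar> + 1) (c\<^sup>2 / w)" using reals_Archimedean2 by blast
      then show ?thesis using that[of k] False by (cases "w = 0") (auto simp: field_simps)
    qed
    let ?X = "m (2 * k + 2)" and ?Y = "m (2 * k)" and ?m = "m (2 * k + 1)"
    let ?n = "real (2 * k + 1)"
    have X: "?X > 0" using pos[of "k + 1"] by simp
    have Y: "?Y > 0" by (rule pos)
    have r1: "(?n + b) * ?X + ?n * w * ?Y = - c * ?m" using rec[of "2 * k"] by simp
    have nb: "?n + b \<ge> real k" "?n \<ge> 1" using k by auto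
    have False
    proof (cases "w = 0")
      case True
      have "\<exists>n. 2 * k = Suc n" using k by (cases k) auto
      then obtain n where n: "2 * k = Suc n" by blast
      \<comment> \<open>Two consecutive recurrences eliminate \<open>c\<close>, leaving
        \<open>(2 k + 1 + b) X Y = (2 k + b) m^2\<close>, against \<open>m^2 < X Y\<close>.\<close>
      have r2: "(real (2 * k) + b) * ?m = - c * ?Y" using rec[of n] True by (simp add: n)
      have "(?n + b) * ?X = - c * ?m" using r1 True by simp
      then have "(?n + b) * (?X * ?Y) = (- c * ?m) * ?Y" by (simp only: mult.assoc[symmetric])
      also have "\<dots> = ?m * (- c * ?Y)" by simp
      also have "\<dots> = (real (2 * k) + b) * ?m\<^sup>2" unfolding r2[symmetric] by (simp add: power2_eq_square)
      also have "\<dots> \<le> (real (2 * k) + b) * (?X * ?Y)"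
        using CS[of k] k by (intro mult_left_mono) (auto simp: mult.commute)
      finally have "?X * ?Y \<le> 0" by (simp add: algebra_simps)
      then show False using X Y by (simp add: mult_le_0_iff)
    next
      case w: False
      then have w: "w > 0" using False by simp
      \<comment> \<open>For \<open>w > 0\<close> the arithmetic-geometric inequality bounds the
        product of the two left-hand terms of \<open>r1\<close> by \<open>c^2 m^2 / 4\<close>, and
        \<open>m^2 < X Y\<close> then forces \<open>4 (n + b) n w <= c^2\<close>.\<close>
      have "4 * u * v \<le> (u + v)\<^sup>2" for u v :: real
        using sum_squares_bound[of u v] by (simp add: power2_sum)
      then have "4 * ((?n + b) * ?X) * (?n * w * ?Y) \<le> ((?n + b) * ?X + ?n * w * ?Y)\<^sup>2" .
      also have "\<dots> = c\<^sup>2 * ?m\<^sup>2" unfolding r1 by (simp add: power_mult_distrib)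
      also have "\<dots> \<le> c\<^sup>2 * (?Y * ?X)" using CS[of k] by (intro mult_left_mono) auto
      finally have "(4 * (?n + b) * ?n * w) * (?X * ?Y) \<le> c\<^sup>2 * (?X * ?Y)" by (simp only: mult_ac)
      then have "4 * (?n + b) * ?n * w \<le> c\<^sup>2" using X Y by simp
      moreover have "real k * w \<le> 4 * (?n + b) * ?n * w"
      proof (rule mult_right_mono)
        have "real k * 1 \<le> (?n + b) * ?n" using nb k by (intro mult_mono) auto
        also have "\<dots> \<le> 4 * ((?n + b) * ?n)" using nb k by simp
        finally show "real k \<le> 4 * (?n + b) * ?n" by (simp only: mult.assoc)
      qed (use w in simp)
      ultimately show False using k w by linarith
    qed
    then show ?thesis ..
  qed
qed

end

section \<open>Orthogonality of the eigenpolynomials\<close>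

locale natural_system = cleared_eigensystem p q r K y ev g P Q R
  for p q r :: "real poly fract" and K y ev g P Q R +
  fixes pp \<eta> qt :: "real poly" and Lf :: "real poly \<Rightarrow> real"
  assumes P_eq: "P = g * pp" and eta_nz: "\<eta> \<noteq> 0"
    and qt: "\<eta> * Q + 2 * P * pderiv \<eta> = g * \<eta> * qt"
    and Lf_add: "\<And>f h. Lf (f + h) = Lf f + Lf h" and Lf_smult: "\<And>c f. Lf (smult c f) = c * Lf f"
    and Lf_pos: "\<And>f. f \<noteq> 0 \<Longrightarrow> Lf (f * f) > 0"
    and Lf_pearson: "\<And>h s. to_fract s = p * to_fract (pderiv h) + q * to_fract h \<Longrightarrow> Lf s = 0"
begin

lemma p_eq: "p = to_fract pp"
proof -
  have "to_fract g * p = to_fract g * to_fract pp" using gp by (simp add: P_eq)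
  then show ?thesis using g_nz by simp
qed

lemma pp_nz: "pp \<noteq> 0"
  using P_nz P_eq by auto

lemma eta_q: "to_fract \<eta> * q = to_fract (\<eta> * qt - 2 * pp * pderiv \<eta>)"
proof -
  have "g * (\<eta> * qt - 2 * pp * pderiv \<eta>) = \<eta> * Q"
    using qt by (simp add: P_eq algebra_simps)
  then have "to_fract g * to_fract (\<eta> * qt - 2 * pp * pderiv \<eta>) = to_fract \<eta> * to_fract Q"
    by (simp only: to_fract_mult[symmetric])
  also have "\<dots> = to_fract g * (to_fract \<eta> * q)" by (simp add: gq[symmetric] mult_ac)
  finally show ?thesis using g_nz by simp
qed

text \<open>\<open>Lf\<close> stands for integration against \<open>W\<close>, and \<open>\<eta>\<^sup>2 W\<close> is the weight of
  \<open>pp D\<^sub>z\<^sub>z + qt D\<^sub>z\<close>.\<close>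

definition Lc :: "real poly \<Rightarrow> real poly \<Rightarrow> real" where "Lc f h = Lf (\<eta> * \<eta> * (f * h))"

lemma Lf_0: "Lf 0 = 0"
  using Lf_smult[of 0 0] by simp

lemma Lf_diff: "Lf (f - h) = Lf f - Lf h"
  using Lf_add[of f "smult (-1) h"] Lf_smult[of "-1" h] by simp

lemma Lf_sum: "Lf (\<Sum>i\<in>A. f i) = (\<Sum>i\<in>A. Lf (f i))"
  by (induction A rule: infinite_finite_induct) (simp_all add: Lf_0 Lf_add)

lemma Lc_pos: "f \<noteq> 0 \<Longrightarrow> Lc f f > 0"
  using Lf_pos[of "\<eta> * f"] eta_nz by (simp add: Lc_def mult_ac)

lemma Lc_add_left: "Lc (f + f') h = Lc f h + Lc f' h"
  by (simp add: Lc_def distrib_left distrib_right Lf_add)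

lemma Lc_smult_left: "Lc (smult c f) h = c * Lc f h"
  by (simp add: Lc_def Lf_smult)

lemma Lc_commute: "Lc f h = Lc h f"
  by (simp add: Lc_def mult.commute)

lemma Lc_add_right: "Lc f (h + h') = Lc f h + Lc f h'"
  by (simp add: Lc_commute[of f] Lc_add_left)

lemma Lc_smult_right: "Lc f (smult c h) = c * Lc f h"
  by (simp add: Lc_commute[of f] Lc_smult_left)

lemma Lc_0_right: "Lc f 0 = 0"
  using Lc_smult_right[of f 0 0] by simp

lemma Lc_mult: "Lc (u * f) h = Lc f (u * h)"
  by (simp add: Lc_def mult_ac)

lemma pearson_natural: "Lf (\<eta> * \<eta> * (pp * pderiv w + qt * w)) = 0"
proof (rule Lf_pearson[of _ "\<eta> * \<eta> * w"])
  have "q * to_fract (\<eta> * \<eta> * w) = (to_fract \<eta> * q) * to_fract (\<eta> * w)"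
    by (simp add: mult_ac)
  then have "q * to_fract (\<eta> * \<eta> * w) = to_fract ((\<eta> * qt - 2 * pp * pderiv \<eta>) * (\<eta> * w))"
    unfolding eta_q to_fract_mult[symmetric] .
  moreover have "p * to_fract (pderiv (\<eta> * \<eta> * w)) = to_fract (pp * pderiv (\<eta> * \<eta> * w))"
    by (simp add: p_eq)
  moreover have "\<eta> * \<eta> * (pp * pderiv w + qt * w)
      = pp * pderiv (\<eta> * \<eta> * w) + (\<eta> * qt - 2 * pp * pderiv \<eta>) * (\<eta> * w)"
    by (simp add: pderiv_mult algebra_simps)
  ultimately show "to_fract (\<eta> * \<eta> * (pp * pderiv w + qt * w))
      = p * to_fract (pderiv (\<eta> * \<eta> * w)) + q * to_fract (\<eta> * \<eta> * w)"
    by (simp only: to_fract_add)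
qed

lemma degree_pp: "degree pp \<le> 2"
  using at_infinity(1) g_nz pp_nz by (simp add: P_eq degree_mult_eq)

lemma degree_qt: "degree qt \<le> 1"
proof (cases "qt = 0")
  case False
  have "degree (\<eta> * Q) \<le> degree \<eta> + (degree g + 1)"
    using degree_mult_le[of \<eta> Q] at_infinity(2) by linarith
  moreover have "degree (2 * P * pderiv \<eta>) \<le> degree \<eta> + (degree g + 1)"
  proof (cases "degree \<eta> = 0")
    case True
    then have "pderiv \<eta> = 0" by (simp add: pderiv_eq_0_iff)
    then show ?thesis by simp
  next
    case False
    have "degree (2 * P) = degree P" by (simp add: numeral_poly)
    then show ?thesis
      using degree_mult_le[of "2 * P" "pderiv \<eta>"] at_infinity(1) False by (simp add: degree_pderiv)
  qed
  ultimately have "degree (g * \<eta> * qt) \<le> degree \<eta> + (degree g + 1)"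
    unfolding qt[symmetric] by (rule degree_add_le)
  then show ?thesis using g_nz eta_nz False by (simp add: degree_mult_eq)
qed simp

sublocale pearson_functional "\<lambda>f. Lf (\<eta> * \<eta> * f)" pp qt
proof
  show "Lf (\<eta> * \<eta> * (f * f)) > 0" if "f \<noteq> 0" for f
    using Lc_pos[OF that] by (simp add: Lc_def)
  show "Lf (\<eta> * \<eta> * (pp * pderiv w + qt * w)) = 0" for w by (rule pearson_natural)
  show "degree qt \<le> 1" by (rule degree_qt)
qed (simp_all add: distrib_left Lf_add Lf_smult pp_nz degree_pp)

section \<open>Eigenvalues as a quadratic function of the degree\<close>

definition A :: real where "A = coeff pp 2"
definition B :: real where "B = coeff qt 1"
definition d :: nat where "d = degree \<eta>"
text \<open>Chosen so that \<open>lam k\<close>, the factor by which \<open>S\<close> multiplies a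
  leading term of degree \<open>k - d\<close>, equals the eigenvalue of \<open>T\<close> at degree
  \<open>k\<close>.\<close>

definition \<mu> :: real where "\<mu> = coeff R (degree g) / lead_coeff g - A * (real d * real d + real d) + B * real d"
definition lam :: "real \<Rightarrow> real" where
  "lam x = A * ((x - real d) * (x - real d - 1)) + B * (x - real d) + \<mu>"

text \<open>Comparison of top coefficients in \<open>qt\<close>; the correction \<open>2 A d\<close>
  comes from the term with \<open>pderiv \<eta>\<close>.\<close>

lemma coeff_Q: "coeff Q (degree g + 1) = lead_coeff g * (B - 2 * A * real d)"
proof -
  let ?n = "degree \<eta> + (degree g + 1)"
  have lg: "lead_coeff g \<noteq> 0" "lead_coeff \<eta> \<noteq> 0" using g_nz eta_nz by simp_all
  have "coeff (g * \<eta> * qt) (degree (g * \<eta>) + 1) = coeff (g * \<eta>) (degree (g * \<eta>)) * coeff qt 1"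
    by (rule coeff_mult_le) (simp_all add: degree_qt[simplified])
  then have 1: "coeff (g * \<eta> * qt) ?n = lead_coeff g * lead_coeff \<eta> * B"
    using g_nz eta_nz coeff_mult_degree_sum[of g \<eta>] by (simp add: degree_mult_eq B_def add_ac)
  have 2: "coeff (\<eta> * Q) ?n = lead_coeff \<eta> * coeff Q (degree g + 1)"
    by (rule coeff_mult_le[OF order_refl at_infinity(2)])
  have 3: "coeff (2 * P * pderiv \<eta>) ?n = 2 * (lead_coeff g * A) * (real d * lead_coeff \<eta>)"
  proof (cases "degree \<eta> = 0")
    case True
    then have "pderiv \<eta> = 0" by (simp add: pderiv_eq_0_iff)
    then show ?thesis by (simp add: d_def True)
  next
    case False
    then obtain m where m: "degree \<eta> = Suc m" by (cases "degree \<eta>") auto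
    have "coeff P (degree g + 2) = lead_coeff g * A"
      unfolding P_eq A_def by (rule coeff_mult_le[OF order_refl degree_pp])
    moreover have "coeff (P * pderiv \<eta>) ((degree g + 2) + m) = coeff P (degree g + 2) * coeff (pderiv \<eta>) m"
      by (rule coeff_mult_le[OF at_infinity(1)]) (simp add: degree_pderiv m)
    moreover have "coeff (pderiv \<eta>) m = real d * lead_coeff \<eta>" by (simp add: coeff_pderiv m d_def)
    moreover have "2 * P * pderiv \<eta> = smult 2 (P * pderiv \<eta>)" by (simp add: numeral_poly)
    ultimately show ?thesis by (simp add: m add.commute mult_ac)
  qed
  have "coeff (\<eta> * Q + 2 * P * pderiv \<eta>) ?n = coeff (g * \<eta> * qt) ?n" unfolding qt ..
  then have "lead_coeff \<eta> * coeff Q (degree g + 1) + 2 * (lead_coeff g * A) * (real d * lead_coeff \<eta>)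
      = lead_coeff g * lead_coeff \<eta> * B" by (simp only: coeff_add 1 2 3)
  then have "lead_coeff \<eta> * coeff Q (degree g + 1) = lead_coeff \<eta> * (lead_coeff g * (B - 2 * A * real d))"
    by (simp add: algebra_simps)
  then show ?thesis using lg by simp
qed

lemma ev_eq: assumes "k \<notin> K" "k \<ge> 2" shows "ev k = lam (real k)"
proof -
  have "coeff P (degree g + 2) = lead_coeff g * A"
    unfolding P_eq A_def by (rule coeff_mult_le[OF order_refl degree_pp])
  then have "lead_coeff g * ev k = lead_coeff g * (A * (real k * (real k - 1)) + (B - 2 * A * real d) * real k)
      + coeff R (degree g)"
    using at_infinity(4)[OF assms] by (simp add: coeff_Q[simplified] algebra_simps)
  also have "\<dots> = lead_coeff g * lam (real k)"
    using g_nz by (simp add: lam_def \<mu>_def field_simps)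
  finally show ?thesis using g_nz by simp
qed

text \<open>The three case lemmas for positive functionals exclude a constant
  \<open>lam\<close>.\<close>

lemma A_B_nz: "A \<noteq> 0 \<or> B \<noteq> 0"
proof -
  consider "degree pp = 0" | "degree pp = 1" | "degree pp = 2" using degree_pp by linarith
  then show ?thesis
  proof cases
    case 1
    then obtain p0 where "pp = [:p0:]" by (rule degree_eq_zeroE)
    from degree_0_case[OF this] show ?thesis by (auto simp: B_def)
  next
    case 2
    from degree_1_case[OF this] show ?thesis by (simp add: B_def)
  next
    case 3
    then have "A \<noteq> 0" unfolding A_def using pp_nz by (metis leading_coeff_0_iff)
    then show ?thesis ..
  qed
qed

text \<open>For \<open>A \<noteq> 0\<close>, distinct arguments share a value of \<open>lam\<close>
  exactly when their sum is \<open>2 d + 1 - B / A\<close>. For \<open>A = 0\<close> the quotient is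
  0 and \<open>lam\<close> is affine with nonzero slope.\<close>

definition bnd :: real where "bnd = 2 * real d + 1 + \<bar>B / A\<bar>"

lemma lam_inj: assumes "x \<noteq> z" "x + z > bnd" shows "lam x \<noteq> lam z"
proof
  assume "lam x = lam z"
  then have "(x - z) * (A * (x + z - 2 * real d - 1) + B) = 0" by (simp add: lam_def algebra_simps)
  then have e: "A * (x + z - 2 * real d - 1) + B = 0" using assms(1) by simp
  then have "A \<noteq> 0" using A_B_nz by auto
  then have "x + z - 2 * real d - 1 = - (B / A)" using e by (simp add: field_simps)
  then show False using assms(2) abs_ge_minus_self[of "B / A"] unfolding bnd_def by linarith
qed

lemma lam_avoids: "\<exists>k1. \<forall>k\<ge>k1. lam (real k) \<noteq> v"
proof (cases "\<exists>j. lam (real j) = v")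
  case True
  then obtain j where j: "lam (real j) = v" by blast
  obtain k1 :: nat where k1: "real k1 > max (real j) bnd" using reals_Archimedean2 by blast
  show ?thesis
  proof (intro exI[of _ k1] allI impI)
    fix k :: nat assume "k \<ge> k1"
    then have "real k > real j" "real k + real j > bnd" using k1 by auto
    then show "lam (real k) \<noteq> v" using lam_inj[of "real k" "real j"] j by auto
  qed
qed blast

text \<open>Lagrange's identity: \<open>(T u) v - u (T v) = p h' + q h\<close> for the Wronskian
  \<open>h = u' v - u v'\<close>, which the functional annihilates.\<close>

lemma T_symmetric:
  assumes "T (to_fract u) = to_fract u1" "T (to_fract v) = to_fract v1"
  shows "Lf (u1 * v) = Lf (u * v1)"
proof -
  let ?h = "pderiv u * v - u * pderiv v"
  have "to_fract (u1 * v - u * v1) = T (to_fract u) * to_fract v - to_fract u * T (to_fract v)"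
    by (simp add: assms)
  also have "\<dots> = p * to_fract (pderiv (pderiv u) * v - u * pderiv (pderiv v)) + q * to_fract ?h"
    by (simp add: diffop2_def algebra_simps)
  also have "pderiv (pderiv u) * v - u * pderiv (pderiv v) = pderiv ?h"
    by (simp add: pderiv_mult pderiv_diff)
  finally have "Lf (u1 * v - u * v1) = 0" by (rule Lf_pearson)
  then show ?thesis by (simp add: Lf_diff)
qed

lemma y_orthogonal: "\<exists>k1. \<forall>k\<ge>k1. k \<notin> K \<longrightarrow> (\<forall>j. j \<notin> K \<longrightarrow> j \<noteq> k \<longrightarrow> Lf (y k * y j) = 0)"
proof -
  \<comment> \<open>The formula \<open>ev_eq\<close> starts at degree 2, so collisions with
    \<open>ev 0\<close> and \<open>ev 1\<close> are excluded separately.\<close>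
  obtain a b where a: "\<And>k. k \<ge> a \<Longrightarrow> lam (real k) \<noteq> ev 0" and b: "\<And>k. k \<ge> b \<Longrightarrow> lam (real k) \<noteq> ev 1"
    using lam_avoids[of "ev 0"] lam_avoids[of "ev 1"] by blast
  obtain c :: nat where c: "real c > bnd" using reals_Archimedean2 by blast
  show ?thesis
  proof (intro exI[of _ "Max {a, b, c, 2}"] allI impI)
    fix k j assume k: "k \<ge> Max {a, b, c, 2}" "k \<notin> K" and j: "j \<notin> K" "j \<noteq> k"
    then have k': "k \<ge> a" "k \<ge> b" "k \<ge> c" "k \<ge> 2" by auto
    have evk: "ev k = lam (real k)" using k(2) k'(4) by (rule ev_eq)
    have "ev k \<noteq> ev j"
    proof (cases "j \<ge> 2")
      case True
      then have "ev j = lam (real j)" using j(1) by (intro ev_eq)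
      then show ?thesis using lam_inj[of "real k" "real j"] j(2) k'(3) c unfolding evk by auto
    next
      case False
      then have "j = 0 \<or> j = 1" by auto
      then show ?thesis unfolding evk using a[OF k'(1)] b[OF k'(2)] by auto
    qed
    moreover have "Lf (smult (ev k) (y k) * y j) = Lf (y k * smult (ev j) (y j))"
      by (rule T_symmetric) (simp_all add: eigen k(2) j(1) to_fract_smult)
    then have "(ev k - ev j) * Lf (y k * y j) = 0" by (simp add: Lf_smult algebra_simps)
    ultimately show "Lf (y k * y j) = 0" by simp
  qed
qed

text \<open>By \<open>U_truncate\<close> only the \<open>y i\<close> with \<open>i < k\<close> occur
  in \<open>w\<close>, so a single threshold serves every \<open>w\<close>.\<close>

lemma U_orthogonal: "\<exists>k1. \<forall>k\<ge>k1. k \<notin> K \<longrightarrow> (\<forall>w\<in>U. degree w < k \<longrightarrow> Lf (y k * w) = 0)"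
proof -
  obtain k1 where k1: "\<And>k j. k \<ge> k1 \<Longrightarrow> k \<notin> K \<Longrightarrow> j \<notin> K \<Longrightarrow> j \<noteq> k \<Longrightarrow> Lf (y k * y j) = 0"
    using y_orthogonal by blast
  show ?thesis
  proof (intro exI[of _ k1] allI impI ballI)
    fix k w assume k: "k \<ge> k1" "k \<notin> K" and w: "w \<in> U" "degree w < k"
    from w(2) have "degree w \<le> k - 1" by simp
    with w(1) obtain b where b: "w = (\<Sum>i\<in>{..k - 1} - K. smult (b i) (y i))" by (rule U_truncate)
    have "Lf (y k * w) = (\<Sum>i\<in>{..k - 1} - K. b i * Lf (y k * y i))"
      by (simp add: b sum_distrib_left Lf_sum Lf_smult)
    also have "\<dots> = 0" using w(2) k1[OF k] by (intro sum.neutral) auto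
    finally show "Lf (y k * w) = 0" .
  qed
qed

section \<open>Orthogonality to multiples of a power of \<open>g\<close>\<close>

lemma pderiv_power_factor: "\<exists>x. pderiv (g ^ Suc n * v) = g ^ n * x"
  by (rule exI[of _ "of_nat (Suc n) * pderiv g * v + g * pderiv v"])
    (unfold pderiv_mult pderiv_power_Suc, simp add: of_nat_poly algebra_simps)

text \<open>Two derivatives cost two powers of \<open>g\<close>, and the denominator of
  \<open>T\<close> costs a third.\<close>

lemma T_power_factor: "\<exists>x. T (to_fract (g ^ (n + 3) * v)) = to_fract (g ^ n * x)"
proof -
  have e: "g ^ (n + 3) * v = g ^ Suc (Suc (Suc n)) * v" by (simp add: numeral_3_eq_3)
  obtain x1 where x1: "pderiv (g ^ (n + 3) * v) = g ^ Suc (Suc n) * x1" unfolding e using pderiv_power_factor by blast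
  obtain x2 where x2: "pderiv (g ^ Suc (Suc n) * x1) = g ^ Suc n * x2" using pderiv_power_factor by blast
  define z where "z = P * x2 + Q * (g * x1) + R * (g * (g * v))"
  have "Op (g ^ (n + 3) * v) = g * (g ^ n * z)"
    unfolding Op_def x1 x2 unfolding e z_def by (simp add: algebra_simps)
  then have "to_fract g * T (to_fract (g ^ (n + 3) * v)) = to_fract g * to_fract (g ^ n * z)"
    unfolding T_to_fract by (simp only: to_fract_mult)
  then have "T (to_fract (g ^ (n + 3) * v)) = to_fract (g ^ n * z)"
    using g_nz by (simp only: mult_cancel_left to_fract_eq_0_iff simp_thms)
  then show ?thesis by (rule exI)
qed

text \<open>The exponent keeps \<open>T ^^ j\<close> of a multiple of \<open>G\<close> polynomial
  for all \<open>j \<le> card K\<close>.\<close>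

definition G :: "real poly" where "G = g ^ (3 * card K)"

lemma G_nz: "G \<noteq> 0"
  using g_nz by (simp add: G_def)

lemma T_funpow_G:
  assumes "j \<le> card K" shows "\<exists>x. (T ^^ j) (to_fract (G * v)) = to_fract (g ^ (3 * (card K - j)) * x)"
  using assms
proof (induction j)
  case 0
  then show ?case by (auto simp: G_def)
next
  case (Suc j)
  then obtain x where x: "(T ^^ j) (to_fract (G * v)) = to_fract (g ^ (3 * (card K - j)) * x)" by auto
  have e: "3 * (card K - j) = 3 * (card K - Suc j) + 3" using Suc.prems by simp
  obtain x' where "T (to_fract (g ^ (3 * (card K - Suc j) + 3) * x)) = to_fract (g ^ (3 * (card K - Suc j)) * x')"
    using T_power_factor by blast
  then show ?case by (intro exI[of _ x']) (simp only: funpow.simps o_apply x e)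
qed

text \<open>The \<open>card K + 1\<close> polynomials \<open>T ^^ j\<close> of \<open>G * v\<close>
  have a combination \<open>s(T)(G v)\<close> in \<open>U\<close>. By symmetry its pairing with
  \<open>y k\<close> is \<open>s(ev k)\<close> times that of \<open>G * v\<close>; the former
  vanishes for large \<open>k\<close> and \<open>s(ev k)\<close> does not.\<close>

lemma G_multiple_orthogonal: "\<exists>k1. \<forall>k\<ge>k1. k \<notin> K \<longrightarrow> Lf (y k * (G * v)) = 0"
proof -
  have "\<forall>j. \<exists>x. j \<le> card K \<longrightarrow> (T ^^ j) (to_fract (G * v)) = to_fract x" using T_funpow_G by blast
  then obtain x where x: "\<And>j. j \<le> card K \<Longrightarrow> (T ^^ j) (to_fract (G * v)) = to_fract (x j)" by metis
  obtain a where a: "\<exists>j\<in>{..card K}. a j \<noteq> 0" "(\<Sum>j\<le>card K. smult (a j) (x j)) \<in> U"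
    by (rule U_relation[of "{..card K}" x]) (simp, simp, rule that)
  define u where "u = (\<Sum>j\<le>card K. smult (a j) (x j))"
  define s where "s = (\<Sum>j\<le>card K. monom (a j) j)"
  have s_coeff: "coeff s i = (if i \<le> card K then a i else 0)" for i
    by (simp add: s_def coeff_sum)
  have s0: "s \<noteq> 0" using a(1) s_coeff by (metis atMost_iff coeff_0)
  have "\<forall>v. \<exists>k1. \<forall>k\<ge>k1. lam (real k) \<noteq> v" using lam_avoids by blast
  then obtain N where N: "\<And>v k. k \<ge> N v \<Longrightarrow> lam (real k) \<noteq> v" by metis
  obtain k2 where k2: "\<And>k w. k \<ge> k2 \<Longrightarrow> k \<notin> K \<Longrightarrow> w \<in> U \<Longrightarrow> degree w < k \<Longrightarrow> Lf (y k * w) = 0"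
    using U_orthogonal by blast
  define k1 where "k1 = Max (insert k2 (insert (Suc (degree u)) (insert 2 (N ` {v. poly s v = 0}))))"
  have fin: "finite (insert k2 (insert (Suc (degree u)) (insert 2 (N ` {v. poly s v = 0}))))"
    using poly_roots_finite[OF s0] by simp
  show ?thesis
  proof (intro exI[of _ k1] allI impI)
    fix k assume k: "k \<ge> k1" "k \<notin> K"
    have ge: "k \<ge> i" if "i \<in> insert k2 (insert (Suc (degree u)) (insert 2 (N ` {v. poly s v = 0})))" for i
      using Max_ge[OF fin that] k(1) by (simp add: k1_def)
    have "poly s (lam (real k)) \<noteq> 0"
    proof
      assume "poly s (lam (real k)) = 0"
      then have "k \<ge> N (lam (real k))" by (intro ge) auto
      then show False using N by blast
    qed
    then have sk: "poly s (ev k) \<noteq> 0" using ev_eq[OF k(2)] ge[of 2] by simp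
    have xj: "Lf (y k * x j) = ev k ^ j * Lf (y k * (G * v))" if "j \<le> card K" for j
      using that
    proof (induction j)
      case 0
      then have "x 0 = G * v" using x[of 0] by (simp del: to_fract_mult)
      then show ?case by simp
    next
      case (Suc j)
      have "T (to_fract (x j)) = to_fract (x (Suc j))" using x[of j] x[of "Suc j"] Suc.prems by simp
      then have "Lf (smult (ev k) (y k) * x j) = Lf (y k * x (Suc j))"
        by (intro T_symmetric) (simp_all add: eigen k(2) to_fract_smult)
      then show ?case using Suc by (simp add: Lf_smult)
    qed
    have "0 = Lf (y k * u)"
      using k2[OF ge k(2), of u] a(2) ge[of "Suc (degree u)"] by (simp add: u_def)
    also have "\<dots> = (\<Sum>j\<le>card K. a j * (ev k ^ j * Lf (y k * (G * v))))"
      by (simp add: u_def sum_distrib_left Lf_sum Lf_smult xj)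
    also have "\<dots> = poly s (ev k) * Lf (y k * (G * v))"
      by (simp add: s_def poly_sum poly_monom sum_distrib_right mult.assoc)
    finally show "Lf (y k * (G * v)) = 0" using sk by simp
  qed
qed

text \<open>Modulo \<open>U\<close> the multiples of \<open>G\<close> span a finite-dimensional space, so finitely many of them
  suffice to make the threshold in the previous lemma uniform.\<close>

lemma G_orthogonal: "\<exists>k1. \<forall>k\<ge>k1. k \<notin> K \<longrightarrow> (\<forall>v. degree (G * v) < k \<longrightarrow> Lf (y k * (G * v)) = 0)"
proof -
  \<comment> \<open>Linear independence modulo \<open>U\<close>. A maximal independent family has at
    most \<open>card K\<close> members, so its finitely many thresholds and degrees have a
    maximum.\<close>
  define ind where "ind n ws \<longleftrightarrow> (\<forall>a. (\<Sum>i<n. smult (a i) (G * ws i)) \<in> U \<longrightarrow> (\<forall>i<n. a i = 0))"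
    for n and ws :: "nat \<Rightarrow> real poly"
  have bound: "n \<le> card K" if "ind n ws" for n ws
  proof (rule ccontr)
    assume "\<not> n \<le> card K"
    then obtain a where "\<exists>j\<in>{..<n}. a j \<noteq> 0" "(\<Sum>j<n. smult (a j) (G * ws j)) \<in> U"
      using U_relation[of "{..<n}" "\<lambda>j. G * ws j"] by auto
    with that show False by (auto simp: ind_def)
  qed
  have "\<exists>ws. ind (Greatest (\<lambda>n. \<exists>ws. ind n ws)) ws"
    by (rule GreatestI_nat[of "\<lambda>n. \<exists>ws. ind n ws" 0 "card K"]) (use bound in \<open>auto simp: ind_def\<close>)
  then obtain n ws where n: "n = Greatest (\<lambda>n. \<exists>ws. ind n ws)" "ind n ws" by blast
  have nind: "\<not> ind (Suc n) ws'" for ws'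
    using Greatest_le_nat[of "\<lambda>n. \<exists>ws. ind n ws" "Suc n" "card K"] bound n(1) by fastforce
  have "\<forall>v. \<exists>k1. \<forall>k\<ge>k1. k \<notin> K \<longrightarrow> Lf (y k * (G * v)) = 0" using G_multiple_orthogonal by blast
  then obtain N where N: "\<And>v k. k \<ge> N v \<Longrightarrow> k \<notin> K \<Longrightarrow> Lf (y k * (G * v)) = 0" by metis
  obtain k2 where k2: "\<And>k w. k \<ge> k2 \<Longrightarrow> k \<notin> K \<Longrightarrow> w \<in> U \<Longrightarrow> degree w < k \<Longrightarrow> Lf (y k * w) = 0"
    using U_orthogonal by blast
  let ?S = "insert k2 ((\<lambda>i. N (ws i)) ` {..<n} \<union> (\<lambda>i. Suc (degree (G * ws i))) ` {..<n})"
  show ?thesis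
  proof (intro exI[of _ "Max ?S"] allI impI)
    fix k v assume k: "k \<ge> Max ?S" "k \<notin> K" and v: "degree (G * v) < k"
    have "finite ?S" by simp
    have ge: "k \<ge> i" if "i \<in> ?S" for i by (rule order_trans[OF Max_ge[OF \<open>finite ?S\<close> that] k(1)])
    define ws' where "ws' = ws(n := v)"
    obtain a where a: "(\<Sum>i<Suc n. smult (a i) (G * ws' i)) \<in> U" "\<exists>i<Suc n. a i \<noteq> 0"
      using nind[of ws'] by (auto simp: ind_def)
    define u where "u = (\<Sum>i<Suc n. smult (a i) (G * ws' i))"
    have u: "u = (\<Sum>i<n. smult (a i) (G * ws i)) + smult (a n) (G * v)"
      by (simp add: u_def ws'_def)
    \<comment> \<open>Independence of the first \<open>n\<close> members makes the new polynomial
      \<open>v\<close> occur in the relation, so its pairing can be solved for.\<close>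
    have an: "a n \<noteq> 0"
    proof
      assume "a n = 0"
      then have "(\<Sum>i<n. smult (a i) (G * ws i)) \<in> U" using a(1) u unfolding u_def by simp
      then have "\<forall>i<n. a i = 0" using n(2) by (simp add: ind_def)
      then show False using a(2) \<open>a n = 0\<close> by (auto simp: less_Suc_eq)
    qed
    have "degree (smult (a i) (G * ws i)) < k" if "i < n" for i
      using ge[of "Suc (degree (G * ws i))"] that degree_smult_le[of "a i" "G * ws i"] by auto
    moreover have "degree (smult (a n) (G * v)) < k" using v degree_smult_le[of "a n" "G * v"] by simp
    moreover have "k > 0" using v by simp
    ultimately have "degree u < k" unfolding u by (intro degree_add_less degree_sum_less) auto
    then have "Lf (y k * u) = 0" using k2[OF ge k(2)] a(1) by (simp add: u_def)
    moreover have "Lf (y k * (G * ws i)) = 0" if "i < n" for i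
      using N[OF ge k(2)] that by auto
    then have "Lf (y k * u) = a n * Lf (y k * (G * v))"
      by (simp add: u distrib_left sum_distrib_left Lf_add Lf_sum Lf_smult)
    ultimately show "Lf (y k * (G * v)) = 0" using an by simp
  qed
qed

end

section \<open>The intertwining operator\<close>

text \<open>Reorders a band of factors so that the shifts \<open>i\<close> and \<open>- i\<close>
  stand together.\<close>

lemma prod_symmetric:
  fixes F :: "int \<Rightarrow> 'a::comm_ring_1"
  shows "(\<Prod>j<2 * M + 1. F (int M - int j)) = F 0 * (\<Prod>i<M. F (int i + 1) * F (- (int i + 1)))"
proof (induction M)
  case (Suc M)
  have "(\<Prod>j<2 * Suc M + 1. F (int (Suc M) - int j)) = (\<Prod>j<Suc (Suc (2 * M + 1)). F (int (Suc M) - int j))"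
    by simp
  also have "\<dots> = F (int M + 1) * (\<Prod>j<Suc (2 * M + 1). F (int M - int j))"
    by (subst prod.lessThan_Suc_shift) (simp add: add.commute)
  also have "\<dots> = F (int M + 1) * ((\<Prod>j<2 * M + 1. F (int M - int j)) * F (- (int M + 1)))"
    by (subst prod.lessThan_Suc) simp
  also have "\<dots> = F (int M + 1) * ((F 0 * (\<Prod>i<M. F (int i + 1) * F (- (int i + 1)))) * F (- (int M + 1)))"
    by (simp only: Suc.IH)
  finally show ?case by (simp only: prod.lessThan_Suc mult_ac)
qed simp

context natural_system
begin

definition S :: "real poly \<Rightarrow> real poly" where
  "S f = pp * pderiv (pderiv f) + qt * pderiv f + smult \<mu> f"

lemma S_add: "S (f + h) = S f + S h"
  by (simp add: S_def pderiv_add algebra_simps smult_add_right)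

lemma S_smult: "S (smult c f) = smult c (S f)"
  by (simp add: S_def pderiv_smult smult_add_right mult.commute)

lemma S_0: "S 0 = 0"
  by (simp add: S_def)

lemma S_minus: "S (- f) = - S f"
  using S_smult[of "-1" f] by simp

lemma S_diff: "S (f - h) = S f - S h"
  using S_add[of f "- h"] by (simp add: S_minus)

lemma S_sum: "S (\<Sum>i\<in>I. f i) = (\<Sum>i\<in>I. S (f i))"
  by (induction I rule: infinite_finite_induct) (simp_all add: S_0 S_add)

text \<open>The Wronskian argument again, now with respect to the weight carrying the factor
  \<open>\<eta>^2\<close>.\<close>

lemma S_symmetric: "Lc (S f) h = Lc f (S h)"
proof -
  let ?w = "pderiv f * h - f * pderiv h"
  have "pp * pderiv ?w + qt * ?w = S f * h - f * S h"
    by (simp add: S_def pderiv_mult pderiv_diff algebra_simps)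
  then have "Lf (\<eta> * \<eta> * (S f * h - f * S h)) = 0" using pearson_natural[of ?w] by simp
  then show ?thesis by (simp add: Lc_def right_diff_distrib Lf_diff)
qed

text \<open>Each of the three terms is compared at degree \<open>n\<close>; the argument
  \<open>n + d\<close> translates degrees for \<open>S\<close> into degrees for
  \<open>T\<close>.\<close>

lemma S_degree_coeff:
  assumes "degree f \<le> n"
  shows "degree (S f) \<le> n" "coeff (S f) n = lam (real n + real d) * coeff f n"
proof -
  have d1: "degree (pderiv f) \<le> n - 1" "degree (pderiv (pderiv f)) \<le> n - 2"
    using assms by (simp_all add: degree_pderiv)
  have "degree (pp * pderiv (pderiv f)) \<le> n \<and>
    coeff (pp * pderiv (pderiv f)) n = A * (real n * (real n - 1)) * coeff f n"
  proof (cases "n \<ge> 2")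
    case True
    then obtain m where m: "n = 2 + m" using le_Suc_ex by blast
    have "coeff (pp * pderiv (pderiv f)) (2 + m) = coeff pp 2 * coeff (pderiv (pderiv f)) m"
      using d1(2) by (intro coeff_mult_le degree_pp) (simp add: m)
    moreover have "degree (pp * pderiv (pderiv f)) \<le> 2 + m"
      using degree_mult_le[of pp "pderiv (pderiv f)"] degree_pp d1(2) unfolding m by linarith
    ultimately show ?thesis by (simp add: m coeff_pderiv A_def algebra_simps)
  next
    case False
    then have "degree (pderiv f) = 0" "n = 0 \<or> n = 1" using d1(1) by auto
    then show ?thesis by (auto simp: pderiv_eq_0_iff[THEN iffD2])
  qed
  moreover have "degree (qt * pderiv f) \<le> n \<and> coeff (qt * pderiv f) n = B * real n * coeff f n"
  proof (cases n)
    case 0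
    then show ?thesis using assms by (simp add: pderiv_eq_0_iff[THEN iffD2])
  next
    case (Suc m)
    have "coeff (qt * pderiv f) (1 + m) = coeff qt 1 * coeff (pderiv f) m"
      using d1(1) by (intro coeff_mult_le degree_qt) (simp add: Suc)
    moreover have "degree (qt * pderiv f) \<le> 1 + m"
      using degree_mult_le[of qt "pderiv f"] degree_qt d1(1) unfolding Suc by linarith
    ultimately show ?thesis by (simp add: Suc coeff_pderiv B_def)
  qed
  moreover have "degree (smult \<mu> f) \<le> n" using assms degree_smult_le[of \<mu> f] by linarith
  ultimately show "degree (S f) \<le> n" "coeff (S f) n = lam (real n + real d) * coeff f n"
    unfolding S_def by (auto intro!: degree_add_le simp: lam_def algebra_simps)
qed

section \<open>Polynomials in \<open>S\<close> and orthogonality of its eigenvectors\<close>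

definition sp :: "real poly \<Rightarrow> real poly \<Rightarrow> real poly" where
  "sp \<psi> f = (\<Sum>j\<le>degree \<psi>. smult (coeff \<psi> j) ((S ^^ j) f))"

lemma sp_le: "degree \<psi> \<le> N \<Longrightarrow> sp \<psi> f = (\<Sum>j\<le>N. smult (coeff \<psi> j) ((S ^^ j) f))"
  unfolding sp_def by (rule sum.mono_neutral_left) (auto simp: coeff_eq_0)

lemma sp_0: "sp 0 f = 0"
  by (simp add: sp_def)

lemma sp_pCons: "sp (pCons a \<psi>) f = smult a f + S (sp \<psi> f)"
proof -
  have "sp (pCons a \<psi>) f = (\<Sum>j\<le>Suc (degree \<psi>). smult (coeff (pCons a \<psi>) j) ((S ^^ j) f))"
    by (rule sp_le) (rule degree_pCons_le)
  also have "\<dots> = smult a f + (\<Sum>j\<le>degree \<psi>. smult (coeff \<psi> j) (S ((S ^^ j) f)))"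
    by (subst sum.atMost_Suc_shift) simp
  finally show ?thesis by (simp add: sp_def S_sum S_smult)
qed

lemma sp_1: "sp 1 f = f"
  by (simp add: one_pCons sp_pCons sp_0 S_0)

lemma sp_linear: "sp [:-c, 1:] f = S f - smult c f"
  by (simp add: sp_pCons sp_0 S_0)

lemma sp_add: "sp (\<psi> + \<phi>) f = sp \<psi> f + sp \<phi> f"
proof -
  let ?N = "max (degree \<psi>) (degree \<phi>)"
  have "sp (\<psi> + \<phi>) f = (\<Sum>j\<le>?N. smult (coeff (\<psi> + \<phi>) j) ((S ^^ j) f))"
    by (rule sp_le) (rule degree_add_le_max)
  then show ?thesis by (simp add: sp_le[of \<psi> ?N] sp_le[of \<phi> ?N] smult_add_left sum.distrib)
qed

lemma sp_smult: "sp (smult c \<psi>) f = smult c (sp \<psi> f)"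
proof (induction \<psi>)
  case (pCons a \<psi>)
  then show ?case by (simp add: sp_pCons S_smult smult_add_right)
qed (simp add: sp_0)

lemma sp_mult: "sp (\<psi> * \<phi>) f = sp \<psi> (sp \<phi> f)"
proof (induction \<psi>)
  case (pCons a \<psi>)
  then show ?case by (simp add: sp_pCons sp_add sp_smult)
qed (simp add: sp_0)

lemma sp_arg_add: "sp \<psi> (f + h) = sp \<psi> f + sp \<psi> h"
proof (induction \<psi>)
  case (pCons a \<psi>)
  then show ?case by (simp add: sp_pCons S_add smult_add_right)
qed (simp add: sp_0)

lemma sp_arg_smult: "sp \<psi> (smult c f) = smult c (sp \<psi> f)"
proof (induction \<psi>)
  case (pCons a \<psi>)
  then show ?case by (simp add: sp_pCons S_smult smult_add_right mult.commute)
qed (simp add: sp_0)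

lemma sp_arg_0: "sp \<psi> 0 = 0"
  using sp_arg_smult[of \<psi> 0 0] by simp

lemma sp_arg_sum: "sp \<psi> (\<Sum>i\<in>I. f i) = (\<Sum>i\<in>I. sp \<psi> (f i))"
  by (induction I rule: infinite_finite_induct) (simp_all add: sp_arg_0 sp_arg_add)

lemma sp_commute: "sp \<psi> (S f) = S (sp \<psi> f)"
proof (induction \<psi>)
  case (pCons a \<psi>)
  then show ?case by (simp add: sp_pCons S_add S_smult)
qed (simp add: sp_0 S_0)

lemma sp_symmetric: "Lc (sp \<psi> f) h = Lc f (sp \<psi> h)"
proof (induction \<psi> arbitrary: h)
  case 0
  then show ?case using Lc_0_right[of h] Lc_0_right[of f] by (simp add: sp_0 Lc_commute[of 0])
next
  case (pCons a \<psi>)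
  then show ?case
    by (simp add: sp_pCons Lc_add_left Lc_add_right Lc_smult_left Lc_smult_right S_symmetric sp_commute)
qed

lemma sp_degree_coeff:
  assumes "degree f \<le> n"
  shows "degree (sp \<psi> f) \<le> n" "coeff (sp \<psi> f) n = poly \<psi> (lam (real n + real d)) * coeff f n"
proof (induction \<psi>)
  case (pCons a \<psi>)
  case 1
  show ?case unfolding sp_pCons
    using assms degree_smult_le[of a f] S_degree_coeff(1)[OF pCons(2)] by (intro degree_add_le) auto
  case 2
  show ?case by (simp add: sp_pCons S_degree_coeff(2)[OF pCons(2)] pCons(3) algebra_simps)
qed (simp_all add: sp_0)

lemma funpow_S_degree: "degree f \<le> n \<Longrightarrow> degree ((S ^^ j) f) \<le> n"
  by (induction j) (auto intro: S_degree_coeff(1))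

lemma funpow_S_symmetric: "Lc ((S ^^ j) f) h = Lc f ((S ^^ j) h)"
  by (induction j arbitrary: h) (simp_all add: S_symmetric, simp add: funpow_swap1)

text \<open>Each factor removes one top coefficient, so the product \<open>\<Theta>\<close> brings
  \<open>Z\<close> below degree \<open>n - M\<close>. By symmetry the result \<open>Z'\<close> has
  norm \<open>Lc Z (\<Theta> Z')\<close>, which is zero by hypothesis. No eigenbasis of
  \<open>S\<close> is required.\<close>

lemma band_annihilator:
  assumes n: "M \<le> n" and Z: "degree Z \<le> n + M" and orth: "\<And>h. degree h < n - M \<Longrightarrow> Lc Z h = 0"
  shows "sp (\<Prod>j<2 * M + 1. [:- lam (real n + real d + real_of_int (int M - int j)), 1:]) Z = 0"
proof -
  define c where "c j = lam (real n + real d + real_of_int (int M - int j))" for j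
  define \<Theta> where "\<Theta> j = (\<Prod>i<j. [:- c i, 1:])" for j
  have co: "coeff (sp (\<Theta> j) Z) i = 0" if "j \<le> 2 * M + 1" "i + j > n + M" for i j
    using that
  proof (induction j arbitrary: i)
    case 0
    then show ?case using Z by (simp add: \<Theta>_def sp_1 coeff_eq_0)
  next
    case (Suc j)
    \<comment> \<open>The degree still possible after \<open>j\<close> factors; the next factor is
      \<open>S - lam (t + d)\<close> and kills exactly this coefficient.\<close>
    define t where "t = n + M - j"
    have t: "t + j = n + M" using Suc.prems n by (simp add: t_def)
    define V where "V = sp (\<Theta> j) Z"
    have V: "degree V \<le> t" unfolding V_def using Suc.IH Suc.prems(1) t by (intro degree_le) auto
    have "\<Theta> (Suc j) = [:- c j, 1:] * \<Theta> j" by (simp only: \<Theta>_def prod.lessThan_Suc mult.commute)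
    then have e: "sp (\<Theta> (Suc j)) Z = S V - smult (c j) V" by (simp only: sp_mult sp_linear V_def)
    have ct: "c j = lam (real t + real d)"
    proof -
      have "real t + real j = real n + real M" using t by linarith
      then have "real n + real d + real_of_int (int M - int j) = real t + real d" by simp
      then show ?thesis by (simp only: c_def)
    qed
    show ?case
    proof (cases "i = t")
      case True
      then show ?thesis by (simp add: e S_degree_coeff(2)[OF V] ct)
    next
      case False
      then have "i > t" using Suc.prems t by simp
      then show ?thesis using S_degree_coeff(1)[OF V] V by (simp add: e coeff_eq_0)
    qed
  qed
  define Z' where "Z' = sp (\<Theta> (2 * M + 1)) Z"
  have Z'0: "coeff Z' i = 0" if "i \<ge> n - M" for i
    unfolding Z'_def by (rule co) (use that n in auto)
  have "Z' = 0"
  proof (cases "n - M = 0")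
    case True
    then show ?thesis using Z'0 by (intro poly_eqI) simp
  next
    case False
    have "degree Z' \<le> n - M - 1" using Z'0 by (intro degree_le) auto
    then have "degree (sp (\<Theta> (2 * M + 1)) Z') \<le> n - M - 1" by (rule sp_degree_coeff(1))
    then have "Lc Z (sp (\<Theta> (2 * M + 1)) Z') = 0" using False by (intro orth) simp
    then have "Lc Z' Z' = 0" unfolding Z'_def by (simp add: sp_symmetric)
    then show ?thesis using Lc_pos[of Z'] by fastforce
  qed
  then show ?thesis by (simp only: Z'_def \<Theta>_def c_def)
qed

text \<open>Induction on the degree: \<open>S h\<close> is \<open>lam (degree h + d) * h\<close>
  plus lower terms, already orthogonal to \<open>v\<close>. Symmetry then compares two distinct
  eigenvalues.\<close>

lemma eigenvector_orthogonal:
  assumes Sv: "S v = smult (lam (real \<delta> + real d)) v" and "real \<delta> > bnd" and "degree h < \<delta>"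
  shows "Lc v h = 0"
  using assms(3)
proof (induction "degree h" arbitrary: h rule: less_induct)
  case less
  let ?l = "lam (real (degree h) + real d)" and ?c = "lam (real \<delta> + real d)"
  define h' where "h' = S h - smult ?l h"
  have co: "coeff h' (degree h) = 0" by (simp add: h'_def S_degree_coeff(2))
  have dh': "degree h' \<le> degree h"
    unfolding h'_def using S_degree_coeff(1)[OF order_refl] by (intro degree_diff_le) (auto simp: degree_smult_le)
  have Lh': "Lc v h' = 0"
  proof (cases "h' = 0")
    case False
    then have "degree h' < degree h" using co dh' eq_zero_or_degree_less by blast
    then show ?thesis using less by auto
  qed (simp add: Lc_0_right)
  have "S h = smult ?l h + h'" by (simp add: h'_def)
  then have "Lc v (S h) = ?l * Lc v h" by (simp add: Lc_add_right Lc_smult_right Lh')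
  moreover have "Lc v (S h) = ?c * Lc v h" unfolding S_symmetric[symmetric] Sv by (rule Lc_smult_left)
  ultimately have "(?l - ?c) * Lc v h = 0" unfolding left_diff_distrib by linarith
  moreover have "?l \<noteq> ?c" using less.prems assms(2) by (intro lam_inj) auto
  ultimately show ?case by (metis mult_eq_0_iff right_minus_eq)
qed

definition Sd :: "real diffop" where "Sd = diffop2 (to_fract pp) (to_fract qt) (constf \<mu>)"

lemma dop_Sd: "dop Sd"
  unfolding Sd_def by (rule dop_diffop2)

lemma Sd_to_fract: "Sd (to_fract f) = to_fract (S f)"
  by (simp add: Sd_def diffop2_def S_def to_fract_smult)

lemma funpow_Sd_to_fract: "(Sd ^^ j) (to_fract f) = to_fract ((S ^^ j) f)"
  by (induction j) (simp_all add: Sd_to_fract)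

abbreviation lin :: "real \<Rightarrow> int \<Rightarrow> real poly" where
  "lin x i \<equiv> [:- lam (x + real_of_int i), 1:]"

text \<open>Since \<open>lam\<close> is quadratic, the symmetric functions of \<open>lam (x + i)\<close> and \<open>lam (x - i)\<close> are
  polynomials in \<open>lam x\<close>. This is what makes the next product an operator independent of \<open>k\<close>.\<close>

lemma lin_pair:
  fixes i :: int defines "j \<equiv> real_of_int i"
  shows "lin x i * lin x (- i) = [: (lam x)\<^sup>2 - 2 * A * j\<^sup>2 * lam x + (A\<^sup>2 * j ^ 4 + 4 * A * \<mu> * j\<^sup>2 - j\<^sup>2 * (B - A)\<^sup>2),
    - (2 * lam x) - 2 * A * j\<^sup>2, 1 :]"
proof -
  have "lam (x + j) + lam (x - j) = 2 * lam x + 2 * A * j\<^sup>2"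
    by (simp add: lam_def power2_eq_square algebra_simps)
  moreover have "lam (x + j) * lam (x - j)
      = (lam x)\<^sup>2 - 2 * A * j\<^sup>2 * lam x + (A\<^sup>2 * j ^ 4 + 4 * A * \<mu> * j\<^sup>2 - j\<^sup>2 * (B - A)\<^sup>2)"
  proof -
    define X where "X = x - real d"
    have l: "lam x = A * (X * (X - 1)) + B * X + \<mu>"
      "lam (x + j) = A * ((X + j) * (X + j - 1)) + B * (X + j) + \<mu>"
      "lam (x - j) = A * ((X - j) * (X - j - 1)) + B * (X - j) + \<mu>"
      by (simp_all add: lam_def X_def algebra_simps)
    show ?thesis unfolding l by (simp add: power2_eq_square eval_nat_numeral algebra_simps)
  qed
  ultimately show ?thesis by (simp add: j_def algebra_simps)
qed

text \<open>On \<open>y k\<close> the scalar \<open>lam k\<close> can be produced by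
  \<open>T\<close> acting before \<open>L\<close>. Hence each paired factor, whose coefficients are
  polynomials in \<open>lam k\<close>, is realised by one operator valid for all
  \<open>k\<close>.\<close>

lemma product_operator:
  assumes "dop E" "\<And>f. E (to_fract f) = to_fract (Ep f)"
  shows "\<exists>L. dop L \<and> (\<forall>k. k \<notin> K \<longrightarrow> k \<ge> 2 \<longrightarrow> L (to_fract (y k)) =
    to_fract (sp (\<Prod>i<M. lin (real k) (int i + 1) * lin (real k) (- (int i + 1))) (Ep (y k))))"
proof (induction M)
  case 0
  then show ?case using assms by (intro exI[of _ E]) (simp add: sp_1)
next
  case (Suc M)
  then obtain L where L: "dop L" "\<And>k. k \<notin> K \<Longrightarrow> k \<ge> 2 \<Longrightarrow> L (to_fract (y k)) =
    to_fract (sp (\<Prod>i<M. lin (real k) (int i + 1) * lin (real k) (- (int i + 1))) (Ep (y k)))"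
    by blast
  define j where "j = real_of_int (int M + 1)"
  define c where "c = A\<^sup>2 * j ^ 4 + 4 * A * \<mu> * j\<^sup>2 - j\<^sup>2 * (B - A)\<^sup>2"
  \<comment> \<open>The quadratic of \<open>lin_pair\<close> at \<open>i = M + 1\<close>, with
    powers of \<open>lam x\<close> replaced by powers of \<open>T\<close> to the right of
    \<open>L\<close>.\<close>
  define N where "N = (\<lambda>f. Sd (Sd (L f)) - constf 2 * Sd (L (T f)) - constf (2 * A * j\<^sup>2) * Sd (L f)
    + L (T (T f)) - constf (2 * A * j\<^sup>2) * L (T f) + constf c * L f)"
  have "dop N" unfolding N_def
    by (intro dop_add dop_diff dop_mult L(1) dop_comp[OF L(1) dop_T] dop_comp[OF dop_Sd L(1)]
        dop_comp[OF dop_Sd dop_comp[OF dop_Sd L(1)]] dop_comp[OF dop_Sd dop_comp[OF L(1) dop_T]]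
        dop_comp[OF dop_comp[OF L(1) dop_T] dop_T])
  moreover have "N (to_fract (y k)) =
    to_fract (sp (\<Prod>i<Suc M. lin (real k) (int i + 1) * lin (real k) (- (int i + 1))) (Ep (y k)))"
    if k: "k \<notin> K" "k \<ge> 2" for k
  proof -
    define Z where "Z = sp (\<Prod>i<M. lin (real k) (int i + 1) * lin (real k) (- (int i + 1))) (Ep (y k))"
    define l where "l = lam (real k)"
    have Ty: "T (to_fract (y k)) = constf l * to_fract (y k)"
      using eigen[OF k(1)] ev_eq[OF k] by (simp add: l_def)
    have LZ: "L (to_fract (y k)) = to_fract Z" using L(2)[OF k] by (simp add: Z_def)
    have "N (to_fract (y k)) = to_fract (S (S Z)) - constf 2 * (constf l * to_fract (S Z))
      - constf (2 * A * j\<^sup>2) * to_fract (S Z) + constf l * (constf l * to_fract Z)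
      - constf (2 * A * j\<^sup>2) * (constf l * to_fract Z) + constf c * to_fract Z"
      by (simp only: N_def Ty LZ dop_cmult[OF L(1)] dop_cmult[OF dop_Sd] dop_cmult[OF dop_T] Sd_to_fract)
    also have "\<dots> = to_fract (smult (l\<^sup>2 - 2 * A * j\<^sup>2 * l + c) Z + S (smult (- (2 * l) - 2 * A * j\<^sup>2) Z + S Z))"
    proof -
      have "smult (l\<^sup>2 - 2 * A * j\<^sup>2 * l + c) Z + S (smult (- (2 * l) - 2 * A * j\<^sup>2) Z + S Z)
        = S (S Z) - smult 2 (smult l (S Z)) - smult (2 * A * j\<^sup>2) (S Z) + smult l (smult l Z)
          - smult (2 * A * j\<^sup>2) (smult l Z) + smult c Z"
        by (simp add: S_add S_smult S_diff S_minus smult_add_left smult_diff_left power2_eq_square)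
      then show ?thesis by (simp only: to_fract_add to_fract_diff to_fract_smult)
    qed
    also have "\<dots> = to_fract (sp (lin (real k) (int M + 1) * lin (real k) (- (int M + 1))) Z)"
      unfolding lin_pair by (simp add: sp_pCons sp_0 S_0 l_def c_def j_def)
    also have "sp (lin (real k) (int M + 1) * lin (real k) (- (int M + 1))) Z =
      sp (\<Prod>i<Suc M. lin (real k) (int i + 1) * lin (real k) (- (int i + 1))) (Ep (y k))"
      unfolding Z_def sp_mult[symmetric] prod.lessThan_Suc by (simp only: mult.commute)
    finally show ?thesis .
  qed
  ultimately show ?case by blast
qed

text \<open>The product of all factors over the band annihilates \<open>Ep b e (y k)\<close>.
  Without the central factor it therefore lands in the kernel of \<open>S - lam k\<close>, and
  \<open>product_operator\<close> makes this a differential operator in \<open>y k\<close>.\<close>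

theorem intertwiner_exists:
  obtains L where "dop L" "L \<noteq> (\<lambda>f. 0)" "\<And>f. L (T f) = Sd (L f)"
proof -
  \<comment> \<open>Both half-widths of the band of \<open>G * y k\<close> around degree
    \<open>k - d\<close>: above it the degree is \<open>k + degree G\<close>, below it the weight
    \<open>\<eta>^2\<close> and \<open>G\<close> cost \<open>2 d + degree G\<close>. Multiplication
    by \<open>z ^ e\<close> with \<open>e \<le> N\<close> widens it to \<open>M\<close>.\<close>
  define N where "N = degree G + d"
  define M where "M = 2 * N"
  obtain k1 where k1: "\<And>k v. k \<ge> k1 \<Longrightarrow> k \<notin> K \<Longrightarrow> degree (G * v) < k \<Longrightarrow> Lf (y k * (G * v)) = 0"
    using G_orthogonal by blast
  obtain c :: nat where c: "real c > bnd" using reals_Archimedean2 by blast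
  \<comment> \<open>Covers the orthogonality threshold, injectivity of \<open>lam\<close> on the
    band, the natural subtraction \<open>k - d - M\<close>, and the range of
    \<open>ev_eq\<close>.\<close>
  define k0 where "k0 = k1 + c + 2 * M + d + 2"
  \<comment> \<open>Powers of \<open>S\<close> supply the polynomials in \<open>S\<close> that
    isolate one eigenvector; \<open>z ^ e\<close> then gives it a component at degree
    \<open>k - d\<close>.\<close>
  define Ep where "Ep b e f = monom 1 e * (S ^^ b) (G * f)" for b e f
  define E where "E b e f = to_fract (monom 1 e) * (Sd ^^ b) (to_fract G * f)" for b e f
  have dE: "dop (E b e)" for b e
    unfolding E_def[abs_def] by (intro dop_mult dop_comp[OF dop_funpow[OF dop_Sd] dop_mult_id])
  have Ep: "E b e (to_fract f) = to_fract (Ep b e f)" for b e f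
    by (simp add: E_def Ep_def funpow_Sd_to_fract flip: to_fract_mult)
  define \<Theta> where "\<Theta> k = (\<Prod>i<M. lin (real k) (int i + 1) * lin (real k) (- (int i + 1)))" for k
  have lo: "Lc (G * y k) h = 0" if "k \<ge> k0" "k \<notin> K" "degree h < k - d - N" for k h
  proof -
    have "Lc (G * y k) h = Lf (y k * (G * (\<eta> * \<eta> * h)))" by (simp add: Lc_def mult_ac)
    also have "degree (G * (\<eta> * \<eta> * h)) \<le> degree G + (d + d + degree h)"
      using degree_mult_le[of G "\<eta> * \<eta> * h"] degree_mult_le[of "\<eta> * \<eta>" h] degree_mult_le[of \<eta> \<eta>]
      unfolding d_def by linarith
    then have "degree (G * (\<eta> * \<eta> * h)) < k" using that(3) by (simp add: N_def)
    then have "Lf (y k * (G * (\<eta> * \<eta> * h))) = 0" using k1 that k0_def by simp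
    finally show ?thesis .
  qed
  have hi: "degree (G * y k) \<le> k - d + N" if "k \<ge> k0" "k \<notin> K" for k
    using degree_mult_le[of G "y k"] deg_y[OF that(2)] that(1) by (simp add: N_def k0_def)
  have nd: "real (k - d) + real d = real k" if "k \<ge> k0" for k using that by (simp add: k0_def)
  have band: "sp (lin (real k) 0 * \<Theta> k) (Ep b e (y k)) = 0" if k: "k \<ge> k0" "k \<notin> K" and e: "e \<le> N" for k b e
  proof -
    have "sp (\<Prod>j<2 * M + 1. [:- lam (real (k - d) + real d + real_of_int (int M - int j)), 1:]) (Ep b e (y k)) = 0"
    proof (rule band_annihilator)
      show "M \<le> k - d" using k(1) by (simp add: k0_def)
      have "degree (Ep b e (y k)) \<le> e + (k - d + N)"
        unfolding Ep_def using degree_mult_le[of "monom 1 e" "(S ^^ b) (G * y k)"]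
          funpow_S_degree[OF hi[OF k], of b] degree_monom_le[of "1::real" e] by linarith
      then show "degree (Ep b e (y k)) \<le> k - d + M" using e by (simp add: M_def)
      fix h :: "real poly" assume h: "degree h < k - d - M"
      have "Lc (Ep b e (y k)) h = Lc (G * y k) ((S ^^ b) (monom 1 e * h))"
        unfolding Ep_def Lc_mult funpow_S_symmetric ..
      also have "degree (monom 1 e * h) \<le> e + degree h"
        using degree_mult_le[of "monom 1 e" h] degree_monom_le[of "1::real" e] by linarith
      then have "degree ((S ^^ b) (monom 1 e * h)) \<le> e + degree h" by (rule funpow_S_degree)
      then have "degree ((S ^^ b) (monom 1 e * h)) < k - d - N" using h e by (simp add: M_def)
      then have "Lc (G * y k) ((S ^^ b) (monom 1 e * h)) = 0" by (rule lo[OF k])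
      finally show "Lc (Ep b e (y k)) h = 0" .
    qed
    then show ?thesis unfolding nd[OF k(1)] \<Theta>_def
      using prod_symmetric[of "lin (real k)" M] by simp
  qed
  have "infinite (- K - {..<k0})" by (rule infinite_degrees)
  then obtain k where "k \<in> - K - {..<k0}" using infinite_imp_nonempty by blast
  then have k: "k \<ge> k0" "k \<notin> K" by auto
  have "\<exists>b e. e \<le> N \<and> sp (\<Theta> k) (Ep b e (y k)) \<noteq> 0"
  proof (rule ccontr)
    assume "\<not> ?thesis"
    then have all0: "sp (\<Theta> k) (Ep b e (y k)) = 0" if "e \<le> N" for b e using that by blast
    define n where "n = k - d"
    define Z where "Z = G * y k"
    have Z0: "Z \<noteq> 0" using G_nz y_nz[OF k(2)] by (simp add: Z_def)
    define F where "F j = (\<Prod>i<j. lin (real k) (int N - int i))" for j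
    have "sp (F (2 * N + 1)) Z = 0"
      using band_annihilator[of N "k - d" Z] hi[OF k] lo[OF k] k(1)
      unfolding nd[OF k(1)] by (simp add: Z_def F_def k0_def M_def)
    \<comment> \<open>One factor before the product first annihilates \<open>Z\<close>, it leaves an
      eigenvector \<open>v\<close> of \<open>S\<close> with eigenvalue
      \<open>lam (k + i)\<close>.\<close>
    define j where "j = (LEAST j. sp (F j) Z = 0)"
    have j: "sp (F j) Z = 0" unfolding j_def by (rule LeastI) (rule \<open>sp (F (2 * N + 1)) Z = 0\<close>)
    have jle: "j \<le> 2 * N + 1" unfolding j_def by (rule Least_le) (rule \<open>sp (F (2 * N + 1)) Z = 0\<close>)
    have "j \<noteq> 0"
    proof
      assume "j = 0"
      then have "sp (F 0) Z = 0" using j by simp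
      then show False using Z0 by (simp add: F_def sp_1)
    qed
    then obtain j' where j': "j = Suc j'" by (cases j) auto
    define v where "v = sp (F j') Z"
    have v0: "v \<noteq> 0" unfolding v_def using not_less_Least[of j' "\<lambda>j. sp (F j) Z = 0"] j' by (simp add: j_def)
    define i where "i = int N - int j'"
    have i: "\<bar>i\<bar> \<le> int N" using jle j' by (simp add: i_def)
    have "F j = lin (real k) i * F j'" by (simp only: F_def j' i_def prod.lessThan_Suc mult.commute)
    then have "sp (lin (real k) i) v = 0" using j by (simp only: sp_mult v_def)
    then have Sv: "S v = smult (lam (real k + real_of_int i)) v" by (simp add: sp_linear)
    have kb: "real k > bnd + 2 * real N + 2" using k(1) c by (simp add: k0_def M_def)
    \<comment> \<open>The leading coefficient shows that the eigenvalue is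
      \<open>lam (degree v + d)\<close>, and injectivity beyond \<open>bnd\<close> recovers the
      degree.\<close>
    have dv: "real (degree v) + real d = real k + real_of_int i"
    proof (rule ccontr)
      assume ne: "real (degree v) + real d \<noteq> real k + real_of_int i"
      have "lam (real (degree v) + real d) * lead_coeff v = lam (real k + real_of_int i) * lead_coeff v"
        using S_degree_coeff(2)[OF order_refl, of v] by (metis Sv coeff_smult)
      then have "lam (real (degree v) + real d) = lam (real k + real_of_int i)" using v0 by simp
      moreover have "real_of_int i \<ge> - real N" using i by linarith
      then have "real (degree v) + real d + (real k + real_of_int i) > bnd" using kb by linarith
      ultimately show False using lam_inj[OF ne] by simp
    qed
    then have dvn: "int (degree v) = int n + i"
    proof -
      have "real n + real d = real k" using nd[OF k(1)] by (simp add: n_def)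
      then have "real_of_int (int (degree v)) = real_of_int (int n + i)" using dv by simp
      then show ?thesis by (simp only: of_int_eq_iff)
    qed
    \<comment> \<open>For \<open>i \<le> 0\<close> the factor \<open>z ^ e\<close> lifts
      \<open>v\<close> to degree \<open>n\<close>. For \<open>i > 0\<close> it instead pairs with
      \<open>z ^ n\<close>, and the dual argument is used.\<close>
    define e where "e = nat \<bar>i\<bar>"
    have eN: "e \<le> N" using i by (simp add: e_def)
    define w where "w = monom 1 e * v"
    have w0: "sp (\<Theta> k) w = 0"
    proof -
      have "w = (\<Sum>b\<le>degree (F j'). smult (coeff (F j') b) (Ep b e (y k)))"
        by (simp add: w_def v_def sp_def Ep_def Z_def sum_distrib_left)
      then show ?thesis using all0[OF eN] by (simp add: sp_arg_sum sp_arg_smult)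
    qed
    have ndk: "real n + real d = real k" using nd[OF k(1)] by (simp add: n_def)
    \<comment> \<open>The central factor is absent from \<open>\<Theta> k\<close>, and
      \<open>lam k\<close> differs from \<open>lam (k + t)\<close> for every other shift in the
      band.\<close>
    have \<Theta>nz: "poly (\<Theta> k) (lam (real n + real d)) \<noteq> 0"
    proof -
      have "lam (real k) \<noteq> lam (real k + real_of_int t)" if "t \<noteq> 0" "\<bar>t\<bar> \<le> int M" for t
      proof (rule lam_inj)
        have "real_of_int t \<ge> - real M" using that(2) by linarith
        moreover have "real k > bnd + 2 * real M" using k(1) c by (simp add: k0_def)
        moreover have "real k \<ge> 0" by simp
        moreover have "real M \<ge> 0" by simp
        moreover have "bnd \<ge> 0" by (simp add: bnd_def)
        ultimately show "real k + (real k + real_of_int t) > bnd" by linarith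
      qed (use that in auto)
      then have ne: "poly (lin (real k) t) (lam (real k)) \<noteq> 0" if "t \<noteq> 0" "\<bar>t\<bar> \<le> int M" for t
        using that by simp
      have "\<forall>i\<in>{..<M}. poly (lin (real k) (int i + 1)) (lam (real k))
          * poly (lin (real k) (- (int i + 1))) (lam (real k)) \<noteq> 0"
        by (intro ballI no_zero_divisors ne) auto
      then show ?thesis unfolding ndk \<Theta>_def poly_prod poly_mult
        by (subst prod_zero_iff[OF finite_lessThan]) blast
    qed
    show False
    proof (cases "i \<le> 0")
      case True
      have "degree w = n"
        unfolding w_def using v0 dvn True by (subst degree_mult_eq) (auto simp: degree_monom_eq e_def)
      then have "coeff (sp (\<Theta> k) w) n = poly (\<Theta> k) (lam (real n + real d)) * lead_coeff w"
        using sp_degree_coeff(2)[of w n] by simp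
      moreover have "w \<noteq> 0" using v0 by (simp add: w_def)
      ultimately show False using w0 \<Theta>nz by simp
    next
      case False
      then have de: "degree v = n + e" using dvn by (simp add: e_def)
      have Sv': "S v = smult (lam (real (n + e) + real d)) v"
        using Sv dv de by (simp add: add_ac)
      have big: "real (n + e) > bnd" using kb k(1) c by (simp add: n_def k0_def)
      note vo = eigenvector_orthogonal[OF Sv' big]
      \<comment> \<open>Since \<open>v\<close> is orthogonal to lower degrees,
        \<open>lead_coeff v\<close> times its pairing with \<open>z ^ (n + e)\<close> equals
        \<open>Lc v v\<close>, which is positive.\<close>
      define u where "u = monom (lead_coeff v) (n + e) - v"
      have "degree u < n + e"
      proof -
        have "coeff u (n + e) = 0" by (simp add: u_def de)
        moreover have "degree u \<le> n + e" unfolding u_def by (intro degree_diff_le degree_monom_le) (simp add: de)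
        moreover have "n + e > 0" using False by (simp add: e_def)
        ultimately show ?thesis using eq_zero_or_degree_less[of u "n + e"] by auto
      qed
      then have "Lc v u = 0" by (rule vo)
      then have "Lc v (monom (lead_coeff v) (n + e)) = Lc v v"
        using Lc_add_right[of v u v] by (simp add: u_def)
      moreover have "monom (lead_coeff v) (n + e) = smult (lead_coeff v) (monom 1 (n + e))"
        by (simp add: smult_monom)
      ultimately have "lead_coeff v * Lc v (monom 1 (n + e)) = Lc v v" by (simp only: Lc_smult_right)
      then have vne: "Lc v (monom 1 (n + e)) \<noteq> 0" using Lc_pos[OF v0] by auto
      have wn: "Lc w (monom 1 n) = Lc v (monom 1 (n + e))"
        unfolding w_def Lc_mult by (simp add: mult_monom add.commute)
      \<comment> \<open>The part of \<open>sp (\<Theta> k)\<close> of \<open>z ^ n\<close> below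
        degree \<open>n\<close>; after multiplication by \<open>z ^ e\<close> it is orthogonal to
        \<open>v\<close>, so only the nonzero leading factor counts.\<close>
      define h where "h = sp (\<Theta> k) (monom 1 n) - monom (poly (\<Theta> k) (lam (real n + real d))) n"
      have m: "degree (monom (1::real) n) \<le> n" by (rule degree_monom_le)
      have ch: "coeff h n = 0" by (simp add: h_def sp_degree_coeff(2)[OF m])
      have dh: "degree h \<le> n" unfolding h_def by (intro degree_diff_le sp_degree_coeff(1)[OF m] degree_monom_le)
      have "Lc w h = 0"
      proof (cases "h = 0")
        case False
        then have "degree h < n" using ch dh eq_zero_or_degree_less by blast
        then have "degree (monom 1 e * h) < n + e"
          using degree_mult_le[of "monom 1 e" h] degree_monom_le[of "1::real" e] by linarith
        then show ?thesis unfolding w_def Lc_mult by (rule vo)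
      qed (simp add: Lc_0_right)
      have "monom (poly (\<Theta> k) (lam (real n + real d))) n = smult (poly (\<Theta> k) (lam (real n + real d))) (monom 1 n)"
        by (simp add: smult_monom)
      then have "sp (\<Theta> k) (monom 1 n) = smult (poly (\<Theta> k) (lam (real n + real d))) (monom 1 n) + h"
        by (simp add: h_def)
      then have "Lc w (sp (\<Theta> k) (monom 1 n)) = poly (\<Theta> k) (lam (real n + real d)) * Lc v (monom 1 (n + e))"
        by (simp only: Lc_add_right Lc_smult_right wn \<open>Lc w h = 0\<close>)
      moreover have "Lc w (sp (\<Theta> k) (monom 1 n)) = 0"
        unfolding sp_symmetric[symmetric] w0 using Lc_0_right by (simp add: Lc_commute[of 0])
      ultimately show False using \<Theta>nz vne by simp
    qed
  qed
  then obtain b e where be: "e \<le> N" "sp (\<Theta> k) (Ep b e (y k)) \<noteq> 0" by blast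
  obtain L where L: "dop L" "\<And>k. k \<notin> K \<Longrightarrow> k \<ge> 2 \<Longrightarrow> L (to_fract (y k)) = to_fract (sp (\<Theta> k) (Ep b e (y k)))"
    using product_operator[OF dE Ep, of M b e] unfolding \<Theta>_def by blast
  have "L \<noteq> (\<lambda>f. 0)"
  proof
    assume "L = (\<lambda>f. 0)"
    then have "to_fract (sp (\<Theta> k) (Ep b e (y k))) = 0" using L(2)[OF k(2)] k(1) by (simp add: k0_def)
    then show False using be(2) by simp
  qed
  \<comment> \<open>For large \<open>k\<close> both sides multiply \<open>L (y k)\<close> by
    \<open>lam k\<close>, and agreement on infinitely many \<open>y k\<close> suffices.\<close>
  moreover have "(\<lambda>f. L (T f) - Sd (L f)) = (\<lambda>f. 0)"
  proof (rule dop_vanishing_infinite[of _ "- K - {..<k0}" y])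
    show "dop (\<lambda>f. L (T f) - Sd (L f))" by (intro dop_diff dop_comp[OF L(1) dop_T] dop_comp[OF dop_Sd L(1)])
    show "infinite (- K - {..<k0})" by (rule infinite_degrees)
    fix k assume "k \<in> - K - {..<k0}"
    then have k: "k \<ge> k0" "k \<notin> K" by auto
    then have k2: "k \<ge> 2" by (simp add: k0_def)
    show "degree (y k) = k" "y k \<noteq> 0" using deg_y[OF k(2)] y_nz[OF k(2)] .
    define X where "X = sp (\<Theta> k) (Ep b e (y k))"
    have "sp (lin (real k) 0) X = 0" using band[OF k be(1), of b] by (simp only: sp_mult X_def)
    then have "S X = smult (lam (real k)) X" by (simp add: sp_linear)
    then show "L (T (to_fract (y k))) - Sd (L (to_fract (y k))) = 0"
      using L(2)[OF k(2) k2] eigen[OF k(2)] ev_eq[OF k(2) k2]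
      by (simp add: dop_cmult[OF L(1)] Sd_to_fract X_def[symmetric] to_fract_smult)
  qed
  then have "L (T f) = Sd (L f)" for f by (metis eq_iff_diff_eq_0)
  ultimately show ?thesis using L(1) that by blast
qed

end

section \<open>Affine changes of variable and parameter shifts\<close>

lemma affine_subst_quotient:
  fixes a b :: "'a::field_gcd poly"
  assumes "s \<noteq> 0" "b \<noteq> 0"
  shows "affine_subst s t (to_fract a / to_fract b) = to_fract (pcompose a [:t, s:]) / to_fract (pcompose b [:t, s:])"
proof -
  define f where "f = to_fract a / to_fract b"
  have nz: "pcompose u [:t, s:] \<noteq> 0" if "u \<noteq> 0" for u
    using that assms(1) pcompose_eq_0[of u "[:t, s:]"] by auto
  have "num f * b = a * den f" unfolding f_def using assms(2) by (rule poly_num_den)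
  then have "pcompose (num f) [:t, s:] * pcompose b [:t, s:] = pcompose a [:t, s:] * pcompose (den f) [:t, s:]"
    by (metis pcompose_mult)
  then have "to_fract (pcompose (num f) [:t, s:]) * to_fract (pcompose b [:t, s:])
      = to_fract (pcompose a [:t, s:]) * to_fract (pcompose (den f) [:t, s:])"
    by (simp only: to_fract_mult[symmetric])
  then show ?thesis using nz[of "den f"] nz[OF assms(2)]
    by (simp add: affine_subst_def Fract_conv_to_fract frac_eq_eq flip: f_def)
qed

lemma affine_subst_to_fract: "s \<noteq> 0 \<Longrightarrow> affine_subst s t (to_fract a) = to_fract (pcompose a [:t, s:])"
  for s :: "'a::field_gcd"
  using affine_subst_quotient[of s 1 t a] by (simp add: pcompose_1)

lemma pcompose_linear_nz: "s \<noteq> 0 \<Longrightarrow> u \<noteq> 0 \<Longrightarrow> pcompose u [:t, s:] \<noteq> 0" for s :: "'a::field_gcd"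
  using pcompose_eq_0[of u "[:t, s:]"] by auto

lemma affine_subst_add:
  fixes s :: "'a::field_gcd"
  assumes s: "s \<noteq> 0" shows "affine_subst s t (f + g) = affine_subst s t f + affine_subst s t g"
proof -
  obtain a b where b: "b \<noteq> 0" and f: "f = to_fract a / to_fract b" by (rule fract_cases)
  obtain c d where d: "d \<noteq> 0" and g: "g = to_fract c / to_fract d" by (rule fract_cases)
  have "f + g = to_fract (a * d + c * b) / to_fract (b * d)"
    using b d by (simp add: f g field_simps)
  then have "affine_subst s t (f + g) = to_fract (pcompose (a * d + c * b) [:t, s:]) / to_fract (pcompose (b * d) [:t, s:])"
    using affine_subst_quotient[OF s, of "b * d" t "a * d + c * b"] b d by simp
  then show ?thesis using b d pcompose_linear_nz[OF s b] pcompose_linear_nz[OF s d]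
    by (simp add: f g affine_subst_quotient s pcompose_add pcompose_mult field_simps)
qed

lemma affine_subst_mult:
  fixes s :: "'a::field_gcd"
  assumes s: "s \<noteq> 0" shows "affine_subst s t (f * g) = affine_subst s t f * affine_subst s t g"
proof -
  obtain a b where b: "b \<noteq> 0" and f: "f = to_fract a / to_fract b" by (rule fract_cases)
  obtain c d where d: "d \<noteq> 0" and g: "g = to_fract c / to_fract d" by (rule fract_cases)
  have "f * g = to_fract (a * c) / to_fract (b * d)" using b d by (simp add: f g)
  then have "affine_subst s t (f * g) = to_fract (pcompose (a * c) [:t, s:]) / to_fract (pcompose (b * d) [:t, s:])"
    using affine_subst_quotient[OF s, of "b * d" t "a * c"] b d by simp
  then show ?thesis using b d by (simp add: f g affine_subst_quotient s pcompose_mult)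
qed

lemma affine_subst_const: "s \<noteq> 0 \<Longrightarrow> affine_subst s t (constf c) = constf c" for s :: "'a::field_gcd"
  by (simp add: affine_subst_to_fract)

lemma affine_subst_0: "s \<noteq> 0 \<Longrightarrow> affine_subst s t 0 = 0" for s :: "'a::field_gcd"
  using affine_subst_const[of s t 0] by simp

lemma affine_subst_sum:
  "s \<noteq> 0 \<Longrightarrow> affine_subst s t (\<Sum>i\<in>A. f i) = (\<Sum>i\<in>A. affine_subst s t (f i))" for s :: "'a::field_gcd"
  by (induction A rule: infinite_finite_induct) (simp_all add: affine_subst_0 affine_subst_add)

lemma affine_subst_deriv:
  fixes s :: "'a::field_gcd"
  assumes s: "s \<noteq> 0" shows "fract_deriv (affine_subst s t f) = constf s * affine_subst s t (fract_deriv f)"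
proof -
  obtain a b where b: "b \<noteq> 0" and f: "f = to_fract a / to_fract b" by (rule fract_cases)
  note nz = pcompose_linear_nz[OF s b, of t]
  have pd: "pderiv (pcompose u [:t, s:]) = smult s (pcompose (pderiv u) [:t, s:])" for u
    by (simp add: pderiv_pcompose pderiv_pCons)
  have "fract_deriv (affine_subst s t f)
     = to_fract (smult s (pcompose (pderiv a * b - a * pderiv b) [:t, s:]))
       / to_fract (pcompose (b * b) [:t, s:])"
    unfolding f affine_subst_quotient[OF s b] fract_deriv_Fract[OF nz]
    by (simp only: pd pcompose_mult pcompose_diff smult_diff_right mult_smult_left mult_smult_right)
  also have "\<dots> = constf s * to_fract (pcompose (pderiv a * b - a * pderiv b) [:t, s:]) / to_fract (pcompose (b * b) [:t, s:])"
    by (simp only: to_fract_smult)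
  also have "\<dots> = constf s * affine_subst s t (fract_deriv f)"
    unfolding f fract_deriv_Fract[OF b] by (subst affine_subst_quotient[OF s]) (use b in simp_all)
  finally show ?thesis .
qed

lemma affine_subst_inverse:
  fixes s :: "'a::field_gcd"
  assumes s: "s \<noteq> 0" shows "affine_subst (1 / s) (- t / s) (affine_subst s t f) = f"
proof -
  obtain a b where b: "b \<noteq> 0" and f: "f = to_fract a / to_fract b" by (rule fract_cases)
  have e: "pcompose (pcompose u [:t, s:]) [:- t / s, 1 / s:] = u" for u
  proof -
    have "pcompose [:t, s:] [:- t / s, 1 / s:] = [:0, 1:]" using s by (simp add: pcompose_pCons)
    then show ?thesis by (simp flip: pcompose_assoc)
  qed
  have s': "1 / s \<noteq> 0" using s by simp
  show ?thesis unfolding f affine_subst_quotient[OF s b]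
      affine_subst_quotient[OF s' pcompose_linear_nz[OF s b]] e ..
qed

lemma affine_subst_inverse':
  fixes s :: "'a::field_gcd"
  assumes s: "s \<noteq> 0" shows "affine_subst s t (affine_subst (1 / s) (- t / s) f) = f"
  using affine_subst_inverse[of "1 / s" "- t / s" f] s by simp

lemma affine_subst_funpow_deriv:
  fixes s :: "'a::field_gcd"
  assumes s: "s \<noteq> 0"
  shows "(fract_deriv ^^ i) (affine_subst s t f) = constf (s ^ i) * affine_subst s t ((fract_deriv ^^ i) f)"
proof (induction i)
  case (Suc i)
  then show ?case by (simp add: fract_deriv_cmult affine_subst_deriv[OF s] constf_mult mult_ac)
qed (simp add: one_pCons[symmetric])

text \<open>Conjugation turns \<open>D\<close> into \<open>s D\<close> and substitutes into the
  coefficients.\<close>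

lemma affine_change_Diff:
  fixes s :: "'a::{field_char_0,field_gcd}"
  assumes s: "s \<noteq> 0" and T: "T \<in> Diff n" shows "affine_change s t T \<in> Diff n"
proof -
  have s': "1 / s \<noteq> 0" using s by simp
  from T obtain c where c: "c n \<noteq> 0" "T = (\<lambda>f. \<Sum>i\<le>n. c i * (fract_deriv ^^ i) f)"
    by (auto simp: Diff_def)
  define e where "e i = affine_subst (1 / s) (- t / s) (c i) * constf (s ^ i)" for i
  have "affine_change s t T = (\<lambda>f. \<Sum>i\<le>n. e i * (fract_deriv ^^ i) f)"
    unfolding affine_change_def c(2) e_def
    by (simp only: affine_subst_funpow_deriv[OF s] affine_subst_sum[OF s'] affine_subst_mult[OF s']
        affine_subst_const[OF s'] affine_subst_inverse[OF s] mult.assoc)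
  moreover have "e n \<noteq> 0"
  proof -
    have "affine_subst (1 / s) (- t / s) (c n) \<noteq> 0"
      using affine_subst_inverse'[OF s, of t "c n"] affine_subst_0[OF s] c(1) by metis
    then show ?thesis using s by (simp add: e_def)
  qed
  ultimately show ?thesis unfolding Diff_def by blast
qed

text \<open>Conjugation by an invertible substitution respects composition and fixes constants, so
  it carries factorizations to factorizations.\<close>

lemma rational_darboux_affine:
  assumes s: "s \<noteq> 0" and "rational_darboux T S"
  shows "rational_darboux (affine_change s t T) (affine_change s t S)"
proof -
  from assms(2) obtain A B l where AB: "A \<in> Diff 1" "B \<in> Diff 1"
    "T = (\<lambda>f. B (A f) + constf l * f)" "S = (\<lambda>f. A (B f) + constf l * f)"
    by (auto simp: rational_darboux_def)
  have s': "1 / s \<noteq> 0" using s by simp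
  have e: "affine_change s t (\<lambda>f. X (Y f) + constf l * f)
      = (\<lambda>f. affine_change s t X (affine_change s t Y f) + constf l * f)" for X Y
    by (simp only: affine_change_def affine_subst_inverse'[OF s] affine_subst_inverse[OF s]
        affine_subst_add[OF s'] affine_subst_mult[OF s'] affine_subst_const[OF s'])
  show ?thesis unfolding rational_darboux_def AB(3,4) e
    using affine_change_Diff[OF s AB(1), of t] affine_change_Diff[OF s AB(2), of t] by blast
qed

lemma darboux_connected_affine:
  assumes "s \<noteq> 0" "rational_darboux\<^sup>*\<^sup>* T S"
  shows "rational_darboux\<^sup>*\<^sup>* (affine_change s t T) (affine_change s t S)"
  using assms(2)
  by (induction rule: rtranclp_induct)
    (auto intro: rtranclp.rtrancl_into_rtrancl rational_darboux_affine[OF assms(1)])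

definition bochner_op :: "'a::{field_char_0,field_gcd} poly \<Rightarrow> 'a poly \<Rightarrow> 'a \<Rightarrow> 'a diffop" where
  "bochner_op P Q c = diffop2 (to_fract P) (to_fract Q) (constf c)"

lemma bochner_op_affine:
  fixes s :: "'a::{field_char_0,field_gcd}"
  assumes s: "s \<noteq> 0"
  shows "affine_change s t (bochner_op P Q c) = bochner_op (smult (s\<^sup>2) (pcompose P [:- t / s, 1 / s:]))
    (smult s (pcompose Q [:- t / s, 1 / s:])) c"
proof
  fix f
  have s': "1 / s \<noteq> 0" using s by simp
  have d2: "fract_deriv (fract_deriv (affine_subst s t f)) = constf (s\<^sup>2) * affine_subst s t (fract_deriv (fract_deriv f))"
    using affine_subst_funpow_deriv[OF s, of 2 t f] by (simp add: numeral_2_eq_2)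
  show "affine_change s t (bochner_op P Q c) f = bochner_op (smult (s\<^sup>2) (pcompose P [:- t / s, 1 / s:]))
      (smult s (pcompose Q [:- t / s, 1 / s:])) c f"
    unfolding affine_change_def bochner_op_def diffop2_def d2
    unfolding affine_subst_deriv[OF s] to_fract_smult
    by (simp only: pcompose_const affine_subst_add[OF s'] affine_subst_mult[OF s'] affine_subst_const[OF s']
        affine_subst_inverse[OF s] affine_subst_to_fract[OF s'] mult_ac)
qed

lemma diffop2_in_Diff_2: "p \<noteq> 0 \<Longrightarrow> diffop2 p q r \<in> Diff 2"
  unfolding Diff_def mem_Collect_eq diffop2_def
  by (intro exI[of _ "\<lambda>i::nat. if i = 2 then p else if i = 1 then q else r"])
    (simp add: numeral_2_eq_2 fun_eq_iff add_ac)

text \<open>Exchanging the factors of \<open>(P D + Q) D\<close> gives \<open>D (P D + Q)\<close>.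
  Adding \<open>P'\<close> to \<open>Q\<close> raises the Laguerre parameter, or both Jacobi
  parameters, by 1.\<close>

lemma rational_darboux_shift:
  assumes P: "P \<noteq> 0" and Q: "degree Q \<le> 1"
  shows "rational_darboux (bochner_op P Q c) (bochner_op P (Q + pderiv P) (c + coeff Q 1))"
proof -
  let ?B = "\<lambda>f. to_fract P * fract_deriv f + to_fract Q * f"
  have "fract_deriv \<in> Diff 1" using oplead_deriv unfolding Diff_iff_oplead by (intro exI[of _ 1]) simp
  moreover have "(\<lambda>f. to_fract P * fract_deriv f) \<in> Diff 1"
    using P oplead_mult[OF oplead_deriv, of "to_fract P"] unfolding Diff_iff_oplead
    by (intro exI[of _ "to_fract P"]) simp
  then have "?B \<in> Diff 1" by (rule Diff_shift) simp
  moreover have "bochner_op P Q c = (\<lambda>f. ?B (fract_deriv f) + constf c * f)"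
    by (simp add: bochner_op_def diffop2_def)
  moreover have "pderiv Q = [:coeff Q 1:]"
  proof -
    have "Q = [:coeff Q 0, coeff Q 1:]"
      using Q by (intro poly_eqI) (auto simp: coeff_pCons coeff_eq_0 split: nat.splits)
    then show ?thesis by (metis add.right_neutral pCons_0_0 pderiv_pCons pderiv_singleton)
  qed
  then have "bochner_op P (Q + pderiv P) (c + coeff Q 1) = (\<lambda>f. fract_deriv (?B f) + constf c * f)"
    by (simp add: bochner_op_def diffop2_def fract_deriv_add fract_deriv_mult constf_add algebra_simps)
  ultimately show ?thesis unfolding rational_darboux_def by (intro bexI exI conjI)
qed

section \<open>Reduction to a classical operator\<close>

lemma cpoly_pcompose: "cpoly (pcompose u v) = pcompose (cpoly u) (cpoly v)"
  by (induction u) (simp_all add: pcompose_pCons)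

lemma cpoly_smult: "cpoly (smult c u) = smult (complex_of_real c) (cpoly u)"
  by (rule poly_eqI) (simp add: coeff_map_poly)

lemma scaled_classical_op:
  "bochner_op (cpoly [:a:]) (cpoly [:0, -2 * a:]) c = (\<lambda>f. constf (complex_of_real a) * hermite_op f + constf c * f)"
  "bochner_op (cpoly [:0, a:]) (cpoly [:a * (1 + \<alpha>), - a:]) c
    = (\<lambda>f. constf (complex_of_real a) * laguerre_op \<alpha> f + constf c * f)"
  "bochner_op (cpoly [:a, 0, - a:]) (cpoly [:a * (\<beta> - \<alpha>), - a * (2 + \<alpha> + \<beta>):]) c
    = (\<lambda>f. constf (complex_of_real a) * jacobi_op \<alpha> \<beta> f + constf c * f)"
proof -
  have *: "constf a * (p * f'' + q * f' + 0 * f) = (constf a * p) * f'' + (constf a * q) * f'"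
    for a and p q f f' f'' :: "complex poly fract" by (simp add: algebra_simps)
  show "bochner_op (cpoly [:a:]) (cpoly [:0, -2 * a:]) c = (\<lambda>f. constf (complex_of_real a) * hermite_op f + constf c * f)"
    unfolding bochner_op_def hermite_op_def diffop2_def * to_fract_mult[symmetric] by (simp add: algebra_simps)
  show "bochner_op (cpoly [:0, a:]) (cpoly [:a * (1 + \<alpha>), - a:]) c
    = (\<lambda>f. constf (complex_of_real a) * laguerre_op \<alpha> f + constf c * f)"
    unfolding bochner_op_def laguerre_op_def diffop2_def * to_fract_mult[symmetric] by (simp add: algebra_simps)
  show "bochner_op (cpoly [:a, 0, - a:]) (cpoly [:a * (\<beta> - \<alpha>), - a * (2 + \<alpha> + \<beta>):]) c
    = (\<lambda>f. constf (complex_of_real a) * jacobi_op \<alpha> \<beta> f + constf c * f)"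
    unfolding bochner_op_def jacobi_op_def diffop2_def * to_fract_mult[symmetric] by (simp add: algebra_simps)
qed

lemma bochner_op_affine_real:
  assumes "s \<noteq> 0"
    and "smult (s\<^sup>2) (pcompose P [:- t / s, 1 / s:]) = P'" "smult s (pcompose Q [:- t / s, 1 / s:]) = Q'"
  shows "affine_change (complex_of_real s) (complex_of_real t) (bochner_op (cpoly P) (cpoly Q) c)
    = bochner_op (cpoly P') (cpoly Q') c"
  using assms(1) by (subst bochner_op_affine)
    (simp_all add: assms(2,3)[symmetric] cpoly_smult cpoly_pcompose)

lemma bochner_op_shift_real:
  assumes "P \<noteq> 0" "degree P \<le> 2" "degree Q \<le> 1"
  shows "\<exists>c'. rational_darboux\<^sup>*\<^sup>* (bochner_op (cpoly P) (cpoly Q) (complex_of_real c))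
    (bochner_op (cpoly P) (cpoly (Q + smult (real n) (pderiv P))) (complex_of_real c'))"
proof (induction n)
  case 0
  show ?case by (intro exI[of _ c]) simp
next
  case (Suc n)
  let ?Q = "Q + smult (real n) (pderiv P)"
  from Suc obtain c' where c': "rational_darboux\<^sup>*\<^sup>* (bochner_op (cpoly P) (cpoly Q) (complex_of_real c))
    (bochner_op (cpoly P) (cpoly ?Q) (complex_of_real c'))" by blast
  have "degree ?Q \<le> 1"
    using assms(2,3) degree_smult_le[of "real n" "pderiv P"] degree_pderiv[of P] by (intro degree_add_le) auto
  then have "rational_darboux (bochner_op (cpoly P) (cpoly ?Q) (complex_of_real c'))
      (bochner_op (cpoly P) (cpoly ?Q + pderiv (cpoly P)) (complex_of_real c' + coeff (cpoly ?Q) 1))"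
    using assms(1) by (intro rational_darboux_shift) (simp_all only: degree_cpoly cpoly_eq_0_iff simp_thms)
  moreover have "cpoly ?Q + pderiv (cpoly P) = cpoly (Q + smult (real (Suc n)) (pderiv P))"
    unfolding cpoly_pderiv[symmetric] cpoly_add[symmetric] by (simp add: smult_add_left add_ac)
  moreover have "complex_of_real c' + coeff (cpoly ?Q) 1 = complex_of_real (c' + coeff ?Q 1)"
    unfolding of_real_add by (simp add: coeff_map_poly)
  ultimately have "rational_darboux (bochner_op (cpoly P) (cpoly ?Q) (complex_of_real c'))
      (bochner_op (cpoly P) (cpoly (Q + smult (real (Suc n)) (pderiv P))) (complex_of_real (c' + coeff ?Q 1)))"
    by (simp only:)
  with c' show ?case by (meson rtranclp.rtrancl_into_rtrancl)
qed

lemma smult_pcompose_linear: "smult x (pcompose [:c, b:] [:u, v:]) = [:x * (c + b * u), x * (b * v):]"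
  for x :: real
  by (simp add: pcompose_pCons algebra_simps)

text \<open>The affine map normalises the roots of \<open>pp\<close>, or that of \<open>qt\<close>
  when \<open>pp\<close> is constant. The resulting parameters may be at most -1; repeated shifts
  raise them above it.\<close>

lemma (in natural_system) classical_reduction:
  obtains s t a c :: real and Tcl where "s \<noteq> 0" "a \<noteq> 0" "classical_op Tcl"
    "rational_darboux\<^sup>*\<^sup>* (affine_change (complex_of_real s) (complex_of_real t)
       (bochner_op (cpoly pp) (cpoly qt) (complex_of_real \<mu>)))
     (\<lambda>f. constf (complex_of_real a) * Tcl f + constf (complex_of_real c) * f)"
proof -
  define C where "C = coeff qt 0"
  define b where "b = coeff qt 1"
  have qt': "qt = [:C, b:]" unfolding C_def b_def by (rule qt_eq)
  consider "degree pp = 0" | "degree pp = 1" | "degree pp = 2" using degree_pp by linarith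
  then show ?thesis
  proof cases
    case 1
    then obtain p0 where p0: "pp = [:p0:]" by (rule degree_eq_zeroE)
    have neg: "p0 * b < 0" using degree_0_case[OF p0] by (simp add: b_def)
    then have nz: "p0 \<noteq> 0" "b \<noteq> 0" by auto
    \<comment> \<open>The scale solves \<open>s^2 p0 = - b / 2\<close>, and is real because
      \<open>p0 * b < 0\<close>; \<open>t\<close> moves the root of \<open>qt\<close> to 0.\<close>
    define s where "s = sqrt (- b / (2 * p0))"
    have "- b / (2 * p0) > 0" using neg by (auto simp: divide_less_0_iff mult_less_0_iff)
    then have s: "s > 0" "s\<^sup>2 = - b / (2 * p0)" by (simp_all add: s_def)
    define t where "t = s * C / b"
    define a where "a = - b / 2"
    have e: "affine_change (complex_of_real s) (complex_of_real t)
        (bochner_op (cpoly pp) (cpoly qt) (complex_of_real \<mu>))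
      = bochner_op (cpoly [:a:]) (cpoly [:0, -2 * a:]) (complex_of_real \<mu>)"
    proof (rule bochner_op_affine_real)
      show "s \<noteq> 0" using s(1) by simp
      have "s\<^sup>2 * p0 = a" using nz(1) by (simp add: s(2) a_def)
      then show "smult (s\<^sup>2) (pcompose pp [:- t / s, 1 / s:]) = [:a:]" by (simp add: p0)
      have "s * (C + b * (- t / s)) = 0" using s(1) nz(2) by (simp add: t_def)
      moreover have "s * (b * (1 / s)) = - 2 * a" using s(1) by (simp add: a_def)
      ultimately show "smult s (pcompose qt [:- t / s, 1 / s:]) = [:0, - 2 * a:]"
        by (simp only: qt' smult_pcompose_linear)
    qed
    have "rational_darboux\<^sup>*\<^sup>* (affine_change (complex_of_real s) (complex_of_real t)
       (bochner_op (cpoly pp) (cpoly qt) (complex_of_real \<mu>)))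
     (\<lambda>f. constf (complex_of_real a) * hermite_op f + constf (complex_of_real \<mu>) * f)"
      unfolding e scaled_classical_op(1) by (rule rtranclp.rtrancl_refl)
    moreover have "classical_op hermite_op" by (simp add: classical_op_def)
    moreover have "s \<noteq> 0" "a \<noteq> 0" using s(1) nz(2) by (simp_all add: a_def)
    ultimately show ?thesis by (intro that)
  next
    case 2
    have b: "b \<noteq> 0" using degree_1_case[OF 2] by (simp add: b_def)
    define p0 p1 where "p0 = coeff pp 0" and "p1 = coeff pp 1"
    have pp': "pp = [:p0, p1:]"
      using 2 by (intro poly_eqI) (auto simp: p0_def p1_def coeff_pCons coeff_eq_0 split: nat.splits)
    have p1: "p1 \<noteq> 0" using 2 pp_nz by (metis leading_coeff_0_iff p1_def)
    \<comment> \<open>The scale makes the slopes of the two coefficients opposite, and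
      \<open>t\<close> moves the root of \<open>pp\<close> to 0.\<close>
    define s where "s = - b / p1"
    define t where "t = s * p0 / p1"
    define a where "a = - b"
    define \<alpha> where "\<alpha> = (s * C - b * t) / a - 1"
    have s: "s \<noteq> 0" using b p1 by (simp add: s_def)
    have a: "a \<noteq> 0" "s * p1 = a" using b p1 by (simp_all add: a_def s_def)
    have e: "affine_change (complex_of_real s) (complex_of_real t)
        (bochner_op (cpoly pp) (cpoly qt) (complex_of_real \<mu>))
      = bochner_op (cpoly [:0, a:]) (cpoly [:a * (1 + \<alpha>), - a:]) (complex_of_real \<mu>)"
    proof (rule bochner_op_affine_real[OF s])
      have "s\<^sup>2 * (p0 + p1 * (- t / s)) = 0" using s p1 by (simp add: t_def)
      moreover have "s\<^sup>2 * (p1 * (1 / s)) = a" using s by (simp add: power2_eq_square flip: a(2))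
      ultimately show "smult (s\<^sup>2) (pcompose pp [:- t / s, 1 / s:]) = [:0, a:]"
        by (simp only: pp' smult_pcompose_linear)
      have "s * (C + b * (- t / s)) = s * C - b * t" using s by (simp add: right_diff_distrib)
      also have "\<dots> = a * (1 + \<alpha>)" using a(1) by (simp add: \<alpha>_def)
      finally have "s * (C + b * (- t / s)) = a * (1 + \<alpha>)" .
      moreover have "s * (b * (1 / s)) = - a" using s by (simp add: a_def)
      ultimately show "smult s (pcompose qt [:- t / s, 1 / s:]) = [:a * (1 + \<alpha>), - a:]"
        by (simp only: qt' smult_pcompose_linear)
    qed
    obtain n :: nat where n: "real n > - 1 - \<alpha>" using reals_Archimedean2 by blast
    have "degree [:a * (1 + \<alpha>), - a:] \<le> 1" "degree [:0, a:] \<le> 2" "[:0, a:] \<noteq> 0" using a(1) by simp_all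
    then obtain c where c: "rational_darboux\<^sup>*\<^sup>* (bochner_op (cpoly [:0, a:]) (cpoly [:a * (1 + \<alpha>), - a:]) (complex_of_real \<mu>))
        (bochner_op (cpoly [:0, a:]) (cpoly ([:a * (1 + \<alpha>), - a:] + smult (real n) (pderiv [:0, a:]))) (complex_of_real c))"
      using bochner_op_shift_real by blast
    have sh: "[:a * (1 + \<alpha>), - a:] + smult (real n) (pderiv [:0, a:]) = [:a * (1 + (\<alpha> + real n)), - a:]"
      by (simp add: pderiv_pCons algebra_simps)
    have "classical_op (laguerre_op (\<alpha> + real n))" using n unfolding classical_op_def
      by (intro disjI2 disjI1 exI[of _ "\<alpha> + real n"]) simp
    moreover have "rational_darboux\<^sup>*\<^sup>* (affine_change (complex_of_real s) (complex_of_real t)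
       (bochner_op (cpoly pp) (cpoly qt) (complex_of_real \<mu>)))
     (\<lambda>f. constf (complex_of_real a) * laguerre_op (\<alpha> + real n) f + constf (complex_of_real c) * f)"
      using c unfolding e sh scaled_classical_op(2)[of a "\<alpha> + real n"] .
    ultimately show ?thesis using s a(1) by (intro that)
  next
    case 3
    then obtain x1 x2 where x: "x1 < x2" "pp = smult (coeff pp 2) ([:-x1, 1:] * [:-x2, 1:])"
      by (rule degree_2_case)
    define l where "l = coeff pp 2"
    have ppl: "pp = smult l ([:-x1, 1:] * [:-x2, 1:])" using x(2) by (simp only: l_def)
    have l0: "l \<noteq> 0" using ppl pp_nz by auto
    \<comment> \<open>The map \<open>z \<mapsto> s z + t\<close> sends \<open>x1\<close> to -1 and
      \<open>x2\<close> to 1.\<close>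
    define s where "s = 2 / (x2 - x1)"
    define t where "t = - (x1 + x2) / (x2 - x1)"
    have s: "s \<noteq> 0" using x(1) by (simp add: s_def)
    have st1: "s * (- t / s - x1) = 1" and st2: "s * (- t / s - x2) = - 1"
    proof -
      have e: "s * (- t / s - x) = - t - s * x" for x using s by (simp add: right_diff_distrib)
      define w where "w = x2 - x1"
      have w: "w > 0" "x2 = x1 + w" using x(1) by (simp_all add: w_def)
      have "s = 2 / w" "t = - (2 * x1 + w) / w" using w(2) by (simp_all add: s_def t_def)
      then have "- t - s * x1 = 1" "- t - s * x2 = - 1"
        using w(1) by (simp_all add: w(2) add_divide_distrib diff_divide_distrib distrib_left)
      then show "s * (- t / s - x1) = 1" "s * (- t / s - x2) = - 1" by (simp_all only: e)
    qed
    define a where "a = - l"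
    \<comment> \<open>The required values of \<open>\<beta> - \<alpha>\<close> and
      \<open>\<alpha> + \<beta>\<close>, read off from the transformed \<open>qt\<close>.\<close>
    define u v where "u = (s * C - b * t) / a" and "v = - b / a - 2"
    define \<alpha> \<beta> where "\<alpha> = (v - u) / 2" and "\<beta> = (v + u) / 2"
    have a: "a \<noteq> 0" using l0 by (simp add: a_def)
    have e: "affine_change (complex_of_real s) (complex_of_real t)
        (bochner_op (cpoly pp) (cpoly qt) (complex_of_real \<mu>))
      = bochner_op (cpoly [:a, 0, - a:]) (cpoly [:a * (\<beta> - \<alpha>), - a * (2 + \<alpha> + \<beta>):]) (complex_of_real \<mu>)"
    proof (rule bochner_op_affine_real[OF s])
      let ?l = "[:- t / s, 1 / s:]"
      have sl: "smult s (pcompose [:- x, 1:] ?l) = [:s * (- t / s - x), 1:]" for x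
        using s by (simp add: smult_pcompose_linear add.commute)
      have "smult (s\<^sup>2) (pcompose pp ?l) = smult l (smult s (pcompose [:- x1, 1:] ?l) * smult s (pcompose [:- x2, 1:] ?l))"
        unfolding ppl pcompose_smult pcompose_mult
        by (simp only: mult_smult_left mult_smult_right smult_smult power2_eq_square mult_ac)
      also have "\<dots> = [:a, 0, - a:]" unfolding sl st1 st2 by (simp add: a_def)
      finally show "smult (s\<^sup>2) (pcompose pp ?l) = [:a, 0, - a:]" .
      have "\<beta> - \<alpha> = u" by (simp add: \<alpha>_def \<beta>_def field_simps)
      moreover have "s * (C + b * (- t / s)) = s * C - b * t" using s by (simp add: right_diff_distrib)
      ultimately have "s * (C + b * (- t / s)) = a * (\<beta> - \<alpha>)" using a by (simp add: u_def)
      moreover have "s * (b * (1 / s)) = - a * (2 + \<alpha> + \<beta>)"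
      proof -
        have "\<alpha> + \<beta> = v" by (simp add: \<alpha>_def \<beta>_def field_simps)
        then have "2 + \<alpha> + \<beta> = - b / a" by (simp add: v_def)
        then show ?thesis using s a by (simp only:) simp
      qed
      ultimately show "smult s (pcompose qt ?l) = [:a * (\<beta> - \<alpha>), - a * (2 + \<alpha> + \<beta>):]"
        by (simp only: qt' smult_pcompose_linear)
    qed
    obtain n :: nat where n: "real n > max (- 1 - \<alpha>) (- 1 - \<beta>)" using reals_Archimedean2 by blast
    let ?\<alpha> = "\<alpha> + real n" and ?\<beta> = "\<beta> + real n"
    have "degree [:a * (\<beta> - \<alpha>), - a * (2 + \<alpha> + \<beta>):] \<le> 1" "degree [:a, 0, - a:] \<le> 2" "[:a, 0, - a:] \<noteq> 0"
      using a by simp_all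
    then obtain c where c: "rational_darboux\<^sup>*\<^sup>*
        (bochner_op (cpoly [:a, 0, - a:]) (cpoly [:a * (\<beta> - \<alpha>), - a * (2 + \<alpha> + \<beta>):]) (complex_of_real \<mu>))
        (bochner_op (cpoly [:a, 0, - a:]) (cpoly ([:a * (\<beta> - \<alpha>), - a * (2 + \<alpha> + \<beta>):]
          + smult (real n) (pderiv [:a, 0, - a:]))) (complex_of_real c))"
      using bochner_op_shift_real by blast
    have sh: "[:a * (\<beta> - \<alpha>), - a * (2 + \<alpha> + \<beta>):] + smult (real n) (pderiv [:a, 0, - a:])
        = [:a * (?\<beta> - ?\<alpha>), - a * (2 + ?\<alpha> + ?\<beta>):]"
      by (simp add: pderiv_pCons algebra_simps)
    have "classical_op (jacobi_op ?\<alpha> ?\<beta>)" using n unfolding classical_op_def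
      by (intro disjI2 exI[of _ ?\<alpha>] conjI exI[of _ ?\<beta>]) simp_all
    moreover have "rational_darboux\<^sup>*\<^sup>* (affine_change (complex_of_real s) (complex_of_real t)
       (bochner_op (cpoly pp) (cpoly qt) (complex_of_real \<mu>)))
     (\<lambda>f. constf (complex_of_real a) * jacobi_op ?\<alpha> ?\<beta> f + constf (complex_of_real c) * f)"
      using c unfolding e sh scaled_classical_op(3)[of a ?\<beta> ?\<alpha>] .
    ultimately show ?thesis using s a by (intro that)
  qed
qed

lemma (in natural_system) connected_to_bochner_op:
  "rational_darboux\<^sup>*\<^sup>* (diffop2 (complexify p) (complexify q) (complexify r))
    (bochner_op (cpoly pp) (cpoly qt) (complex_of_real \<mu>))"
proof -
  let ?T = "diffop2 (complexify p) (complexify q) (complexify r)"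
  let ?S = "bochner_op (cpoly pp) (cpoly qt) (complex_of_real \<mu>)"
  obtain L where L: "dop L" "L \<noteq> (\<lambda>f. 0)" "\<And>f. L (T f) = Sd (L f)" by (rule intertwiner_exists) (rule that)
  obtain M where M: "dop M" "\<And>f. M (complexify f) = complexify (L f)"
    using L(1) by (rule complexify_dop) (rule that)
  have S: "complexify (Sd f) = ?S (complexify f)" for f
    by (simp add: Sd_def bochner_op_def complexify_diffop2)
  have "M \<noteq> (\<lambda>f. 0)"
  proof
    assume "M = (\<lambda>f. 0)"
    then have "complexify (L f) = 0" for f using M(2)[of f] by simp
    then show False using L(2) by (auto simp: fun_eq_iff)
  qed
  with M(1) obtain n where n: "M \<in> Diff n" by (auto elim: dop_cases)
  have dS: "dop ?S" unfolding bochner_op_def by (rule dop_diffop2)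
  have "(\<lambda>f. M (?T f)) = (\<lambda>f. ?S (M f))"
  proof (rule dop_eq_on_real)
    show "dop (\<lambda>f. M (?T f))" by (rule dop_comp[OF M(1) dop_diffop2])
    show "dop (\<lambda>f. ?S (M f))" by (rule dop_comp[OF dS M(1)])
    fix u
    have "M (?T (complexify (to_fract u))) = ?S (M (complexify (to_fract u)))"
      unfolding complexify_diffop2[symmetric] M(2) L(3) S ..
    then show "M (?T (to_fract (cpoly u))) = ?S (M (to_fract (cpoly u)))" by simp
  qed
  then have "M (?T f) = ?S (M f)" for f by (rule fun_cong)
  moreover have "?T \<in> Diff 2" using p_nz by (intro diffop2_in_Diff_2) simp
  \<comment> \<open>The parameter shift supplies the Darboux partner of \<open>?S\<close> on which
    the descent ends.\<close>
  moreover have "rational_darboux ?S (bochner_op (cpoly pp) (cpoly qt + pderiv (cpoly pp))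
      (complex_of_real \<mu> + coeff (cpoly qt) 1))"
    using pp_nz degree_qt by (intro rational_darboux_shift) simp_all
  ultimately show ?thesis using intertwined_imp_darboux_connected[OF n] by blast
qed

theorem theorem1p2:
  fixes p q r :: "real poly fract" and K :: "nat set" and y :: "nat \<Rightarrow> real poly"
  assumes "sl_ops p q r K y"
  shows "\<exists>(s::real) (t::real) (a::real) (c::real) Tcl.
    s \<noteq> 0 \<and> a \<noteq> 0 \<and> classical_op Tcl \<and>
    factorization_chain
      (\<lambda>f. constf (complex_of_real a) * Tcl f + constf (complex_of_real c) * f)
      (affine_change (complex_of_real s) (complex_of_real t)
        (diffop2 (complexify p) (complexify q) (complexify r)))"
proof -
  from assms have p: "p \<noteq> 0" and K: "finite K"
    and y: "\<And>k. k \<notin> K \<Longrightarrow> degree (y k) = k \<and> eigenpolynomial (diffop2 p q r) (y k)"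
    unfolding sl_ops_def by blast+
  from assms obtain a b W where ab: "a < b" and W: "sl_weight p q a b W"
    and moments: "\<And>j. set_integrable lborel (einterval a b) (\<lambda>x. x ^ j * W x)"
    and boundary: "\<And>u. ((\<lambda>e. let x = real_of_ereal e in poly u x * fract_eval p x * W x) \<longlongrightarrow> 0) (at_right a)"
      "\<And>u. ((\<lambda>e. let x = real_of_ereal e in poly u x * fract_eval p x * W x) \<longlongrightarrow> 0) (at_left b)"
    unfolding sl_ops_def by blast
  have "\<forall>k. \<exists>l. k \<notin> K \<longrightarrow> diffop2 p q r (to_fract (y k)) = constf l * to_fract (y k)"
    using y unfolding eigenpolynomial_def by blast
  then obtain ev where ev: "\<And>k. k \<notin> K \<Longrightarrow> diffop2 p q r (to_fract (y k)) = constf (ev k) * to_fract (y k)"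
    unfolding choice_iff by blast
  interpret E: eigensystem p q r K y ev
    using p K y ev by unfold_locales (auto simp: eigenpolynomial_def)
  obtain g P Q R where gPQR: "g \<noteq> 0" "to_fract g * p = to_fract P" "to_fract g * q = to_fract Q"
    "to_fract g * r = to_fract R" by (rule E.cleared_denominators) (rule that)
  interpret C: cleared_eigensystem p q r K y ev g P Q R
    using gPQR by unfold_locales
  obtain pp \<eta> where pp: "P = g * pp" "\<eta> \<noteq> 0" "g * \<eta> dvd \<eta> * Q + 2 * P * pderiv \<eta>"
    by (rule natural_gauge[OF C.cleared_eigensystem_axioms]) (rule that)
  from pp(3) obtain qt where qt: "\<eta> * Q + 2 * P * pderiv \<eta> = g * \<eta> * qt" by (elim dvdE)
  have pp0: "pp \<noteq> 0" using pp(1) C.P_nz by auto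
  have "to_fract g * p = to_fract g * to_fract pp" using gPQR(2) pp(1) by simp
  then have p_eq: "p = to_fract pp" using gPQR(1) by simp
  interpret W: weight p q pp a b W
    using p_eq pp0 ab W moments boundary by unfold_locales
  interpret N: natural_system p q r K y ev g P Q R pp \<eta> qt W.Lf
    using pp qt by unfold_locales (auto intro: W.Lf_add W.Lf_smult W.Lf_pos W.Lf_pearson)
  obtain s t a c :: real and Tcl where st: "s \<noteq> 0" "a \<noteq> 0" "classical_op Tcl"
    and S: "rational_darboux\<^sup>*\<^sup>* (affine_change (complex_of_real s) (complex_of_real t)
       (bochner_op (cpoly pp) (cpoly qt) (complex_of_real N.\<mu>)))
     (\<lambda>f. constf (complex_of_real a) * Tcl f + constf (complex_of_real c) * f)"
    by (rule N.classical_reduction) (rule that)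
  let ?T = "affine_change (complex_of_real s) (complex_of_real t) (diffop2 (complexify p) (complexify q) (complexify r))"
  let ?Tcl = "\<lambda>f. constf (complex_of_real a) * Tcl f + constf (complex_of_real c) * f"
  have "rational_darboux\<^sup>*\<^sup>* ?T ?Tcl"
    using darboux_connected_affine[OF _ N.connected_to_bochner_op, of "complex_of_real s" "complex_of_real t"] S st(1)
    by (simp add: rtranclp_trans[of rational_darboux])
  then have conn: "rational_darboux\<^sup>*\<^sup>* ?Tcl ?T" by (rule darboux_connected_sym)
  have "?T \<in> Diff 2" using st(1) p by (intro affine_change_Diff diffop2_in_Diff_2) simp_all
  \<comment> \<open>Either the path is trivial and the two operators coincide, or its first step
    exhibits a factorization of order 2.\<close>
  then have "?Tcl \<in> Diff 2" using conn
    by (auto elim: converse_rtranclpE dest: rational_darboux_Diff(1))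
  with conn have "factorization_chain ?Tcl ?T" by (rule factorization_chainI)
  with st show ?thesis by blast
qed

end
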